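(* For every positive integer $r$ there is an $\aleph_1$-separable abelian group $M=M_r$ of cardinality $\aleph_1$ such that for all positive integers $m$ and $k$, $M^m$ is isomorphic to $M^k$ if and only if $m\equiv k \pmod r$.
   Context: An abelian group $M$ is $\aleph_1$-separable if every countable subset of $M$ is contained in a countable free (abelian) direct summand of $M$. For a group $M$ and positive integer $m$, $M^m$ denotes the direct sum of $m$ copies of $M$. This is proved in ZFC. *)

theory Defs
  imports "HOL-Algebra.Free_Abelian_Groups" "HOL-Number_Theory.Cong"
begin

text \<open>A group is free abelian if it is isomorphic to the free abelian group on some set
  (the basis may be taken inside the group's own element type).\<close>
definition free_abelian_grp :: "('a, 'b) monoid_scheme \<Rightarrow> bool" where
  "free_abelian_grp G \<longleftrightarrow> comm_group G \<and> (\<exists>B :: 'a set. G \<cong> free_Abelian_group B)"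

definition direct_summand :: "'a set \<Rightarrow> ('a, 'b) monoid_scheme \<Rightarrow> bool" where
  "direct_summand N M \<longleftrightarrow> subgroup N M \<and>
     (\<exists>K. subgroup K M \<and> N \<inter> K = {\<one>\<^bsub>M\<^esub>} \<and> N <#>\<^bsub>M\<^esub> K = carrier M)"

definition aleph1_separable :: "('a, 'b) monoid_scheme \<Rightarrow> bool" where
  "aleph1_separable M \<longleftrightarrow> comm_group M \<and>
     (\<forall>S. S \<subseteq> carrier M \<and> countable S \<longrightarrow>
        (\<exists>N. S \<subseteq> N \<and> countable N \<and> direct_summand N M \<and>
             free_abelian_grp (M\<lparr>carrier := N\<rparr>)))"

definition dsum_pow :: "('a, 'b) monoid_scheme \<Rightarrow> nat \<Rightarrow> (nat \<Rightarrow> 'a) monoid" where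
  "dsum_pow M m = sum_group {..<m} (\<lambda>_. M)"

definition has_card_aleph1 :: "'a set \<Rightarrow> bool" where
  "has_card_aleph1 A \<longleftrightarrow> ordIso2 (card_of A) (cardSuc natLeq)"

end

theory Submission
  imports HOL.Modules Defs "HOL-Library.Function_Algebras" "HOL-Library.Countable_Set_Type"
begin

text \<open>
  Let \<open>A\<close> be the Leavitt ring with \<open>A \<cong> A ^ (r + 1)\<close> as a right module; it carries a trace with values
  in the integers modulo \<open>r\<close> and value \<open>1\<close> at the identity, so that invertible matrices over \<open>A\<close>
  are square modulo \<open>r\<close>. The group \<open>M\<close> is a left \<open>A\<close>-module of functions from \<open>\<omega>\<^sub>1\<close> to \<open>A \<times> A\<close>,
  generated by the functions with one-point support and, for every limit \<open>\<delta>\<close> with a fixed ladder,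
  by \<open>\<Sum> l! x\<^sub>l (v, v g)\<close> and its quotients by powers of a prime \<open>p\<^sub>g\<close>, one prime for every \<open>g\<close> in \<open>A\<close>.
  As a subgroup of a product of copies of the integers, \<open>M\<close> has only free countable subgroups, and
  restriction of functions to an initial segment splits off countable summands. The
  \<open>p\<^sub>g\<close>-divisible part of \<open>M\<close> modulo the functions bounded below \<open>\<delta>\<close> is the graph of right
  multiplication by \<open>g\<close>. An isomorphism of \<open>M ^ m\<close> with \<open>M ^ k\<close> is compatible with the filtration at
  some \<open>\<delta>\<close>, hence preserves these graphs and is given there by an invertible matrix over \<open>A\<close> up to
  denominators prime to \<open>r\<close>; comparing traces gives \<open>m \<equiv> k\<close> modulo \<open>r\<close>.
\<close>

section \<open>Countable groups of integer-valued functions are free\<close>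

text \<open>An isomorphism between powers of \<open>M\<close> is merely additive, so linearity over
  \<open>A\<close> has to be recovered from the abelian group. This is the purpose of the pairs and
  the primes: infinite height at \<open>pr i\<close> modulo bounded functions is an additive notion,
  and an additive map that preserves both coordinate axes and every graph is linear. The axes take
  part as the indices \<open>None\<close> and \<open>Some 0\<close>. The factorial \<open>l!\<close>
  is eventually divisible by every fixed prime power, so the quotients exist up to finitely many
  ladder points, that is, up to a bounded function. A ladder with top \<delta> has only finitely
  many points below any smaller \<alpha>; hence restriction to an initial segment preserves
  \<open>M\<close>, although its generators may have infinite support. All primes are coprime to
  \<open>r\<close>, so the denominators are units modulo \<open>r\<close>. Realising the Leavitt
  ring by operators on integer sequences yields the integer-valued functionals behind freeness and a
  concrete diagonal to sum for the trace. Since \<open>q = r + 1\<close> is 1 modulo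
  \<open>r\<close>, enlarging the truncation by a factor \<open>q\<close> eventually leaves that sum
  unchanged modulo \<open>r\<close>.\<close>

definition add_subgroup :: "'a::ab_group_add set \<Rightarrow> bool" where
  "add_subgroup H \<longleftrightarrow> 0 \<in> H \<and> (\<forall>x\<in>H. \<forall>y\<in>H. x - y \<in> H)"

lemma add_subgroup_zero: "add_subgroup H \<Longrightarrow> 0 \<in> H"
  by (simp add: add_subgroup_def)

lemma add_subgroup_diff: "add_subgroup H \<Longrightarrow> x \<in> H \<Longrightarrow> y \<in> H \<Longrightarrow> x - y \<in> H"
  by (simp add: add_subgroup_def)

lemma add_subgroup_uminus: "add_subgroup H \<Longrightarrow> x \<in> H \<Longrightarrow> - x \<in> H"
  using add_subgroup_diff[of H 0 x] add_subgroup_zero by auto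

lemma add_subgroup_add: "add_subgroup H \<Longrightarrow> x \<in> H \<Longrightarrow> y \<in> H \<Longrightarrow> x + y \<in> H"
  using add_subgroup_diff[of H x "- y"] add_subgroup_uminus by auto

lemma add_subgroup_sum:
  "add_subgroup H \<Longrightarrow> (\<And>i. i \<in> I \<Longrightarrow> f i \<in> H) \<Longrightarrow> sum f I \<in> H"
  by (induction I rule: infinite_finite_induct) (auto intro: add_subgroup_zero add_subgroup_add)

lemma add_subgroup_of_int_mult:
  fixes x :: "'a::ring_1"
  assumes "add_subgroup H" "x \<in> H" shows "of_int k * x \<in> H"
proof -
  have nat: "of_nat n * x \<in> H" for n
    by (induction n) (use assms in \<open>auto simp: algebra_simps intro: add_subgroup_zero add_subgroup_add\<close>)
  show ?thesis
    using nat[of "nat k"] add_subgroup_uminus[OF assms(1) nat[of "nat (- k)"]]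
    by (cases "k \<ge> 0") auto
qed

inductive_set zspan :: "'a::ab_group_add set \<Rightarrow> 'a set" for S where
  zspan_zero: "0 \<in> zspan S"
| zspan_add_base: "x \<in> zspan S \<Longrightarrow> s \<in> S \<Longrightarrow> x + s \<in> zspan S"
| zspan_diff_base: "x \<in> zspan S \<Longrightarrow> s \<in> S \<Longrightarrow> x - s \<in> zspan S"

lemma zspan_base: "s \<in> S \<Longrightarrow> s \<in> zspan S"
  using zspan_add_base[OF zspan_zero] by fastforce

lemma add_subgroup_zspan: "add_subgroup (zspan S)"
proof -
  have "x - y \<in> zspan S" if "x \<in> zspan S" "y \<in> zspan S" for x y
    using that(2,1)
  proof (induction y arbitrary: x)
    case (zspan_add_base y s)
    then show ?case using zspan.zspan_diff_base[of "x - y" S s] by (simp add: algebra_simps)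
  next
    case (zspan_diff_base y s)
    then show ?case using zspan.zspan_add_base[of "x - y" S s] by (simp add: algebra_simps)
  qed simp
  then show ?thesis unfolding add_subgroup_def by (auto intro: zspan_zero)
qed

lemma zspan_least: "add_subgroup H \<Longrightarrow> S \<subseteq> H \<Longrightarrow> zspan S \<subseteq> H"
proof
  fix x assume "x \<in> zspan S" "add_subgroup H" "S \<subseteq> H"
  then show "x \<in> H"
    by (induction x) (auto intro: add_subgroup_zero add_subgroup_add add_subgroup_diff)
qed

text \<open>Every element of the span is a difference of two sums of lists over \<open>S\<close>,
  and there are only countably many lists.\<close>

lemma countable_zspan:
  assumes "countable S" shows "countable (zspan S)"
proof (rule countable_subset)
  let ?f = "\<lambda>(xs, ys). sum_list xs - sum_list ys"
  show "zspan S \<subseteq> ?f ` (lists S \<times> lists S)"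
  proof
    fix x assume "x \<in> zspan S"
    then show "x \<in> ?f ` (lists S \<times> lists S)"
    proof (induction x)
      case zspan_zero
      then show ?case by (intro image_eqI[of _ _ "([], [])"]) auto
    next
      case (zspan_add_base x s)
      then obtain xs ys where "xs \<in> lists S" "ys \<in> lists S" "x = sum_list xs - sum_list ys" by auto
      then show ?case using zspan_add_base
        by (intro image_eqI[of _ _ "(s # xs, ys)"]) (auto simp: algebra_simps)
    next
      case (zspan_diff_base x s)
      then obtain xs ys where "xs \<in> lists S" "ys \<in> lists S" "x = sum_list xs - sum_list ys" by auto
      then show ?case using zspan_diff_base
        by (intro image_eqI[of _ _ "(xs, s # ys)"]) (auto simp: algebra_simps)
    qed
  qed
  show "countable (?f ` (lists S \<times> lists S))"
    using assms by (intro countable_image countable_SIGMA countable_lists)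
qed

lemma additive_of_int_mult:
  fixes f :: "'a::ring_1 \<Rightarrow> 'b::ring_1"
  assumes "additive f"
  shows "f (of_int k * x) = of_int k * f x"
proof -
  interpret additive f by fact
  have nat: "f (of_nat n * x) = of_nat n * f x" for n
    by (induction n) (simp_all add: algebra_simps zero add)
  show ?thesis
  proof (cases "k \<ge> 0")
    case True then show ?thesis using nat[of "nat k"] by simp
  next
    case False then show ?thesis using nat[of "nat (-k)"] minus[of "of_int k * x"] by simp
  qed
qed

lemma of_int_fun_apply [simp]: "(of_int k :: 'i \<Rightarrow> 'a::ring_1) x = of_int k"
  by (cases k rule: int_cases2) simp_all

lemma power_fun_apply [simp]: "(f ^ n) x = f x ^ n" for f :: "'i \<Rightarrow> 'a::monoid_mult"
  by (induction n) simp_all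

lemma sum_fun_apply: "(sum f I) x = (\<Sum>i\<in>I. f i x)" for f :: "'i \<Rightarrow> 'b \<Rightarrow> 'c::comm_monoid_add"
  by (induction I rule: infinite_finite_induct) simp_all

lemma additive_eval: "additive (\<lambda>x :: 'i \<Rightarrow> 'a::ab_group_add. x j)"
  by unfold_locales simp

section \<open>Rational dependence, denominators cleared, and functionals that detect it\<close>

definition rat_dep :: "(nat \<Rightarrow> 'a::comm_ring_1) \<Rightarrow> nat \<Rightarrow> 'a \<Rightarrow> bool" where
  "rat_dep g n x \<longleftrightarrow> (\<exists>k c. k \<noteq> (0::int) \<and> of_int k * x = (\<Sum>i<n. of_int (c i) * g i))"

lemma rat_dep_Suc:
  "rat_dep g (Suc n) x \<longleftrightarrow> (\<exists>k l. k \<noteq> 0 \<and> (\<exists>c. of_int k * x = (\<Sum>i<n. of_int (c i) * g i) + of_int l * g n))"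
proof
  assume "rat_dep g (Suc n) x"
  then show "\<exists>k l. k \<noteq> 0 \<and> (\<exists>c. of_int k * x = (\<Sum>i<n. of_int (c i) * g i) + of_int l * g n)"
    unfolding rat_dep_def sum.lessThan_Suc by blast
next
  assume "\<exists>k l. k \<noteq> 0 \<and> (\<exists>c. of_int k * x = (\<Sum>i<n. of_int (c i) * g i) + of_int l * g n)"
  then obtain k l c where k: "k \<noteq> 0" "of_int k * x = (\<Sum>i<n. of_int (c i) * g i) + of_int l * g n"
    by blast
  have "of_int k * x = (\<Sum>i<Suc n. of_int ((c(n := l)) i) * g i)"
    using k(2) by simp
  then show "rat_dep g (Suc n) x" unfolding rat_dep_def using k(1) by blast
qed

lemma rat_dep_additive_zero:
  fixes \<phi> :: "'a::comm_ring_1 \<Rightarrow> int"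
  assumes "additive \<phi>" "\<And>i. i < n \<Longrightarrow> \<phi> (g i) = 0" "rat_dep g n x"
  shows "\<phi> x = 0"
proof -
  obtain k c where k: "k \<noteq> 0" "of_int k * x = (\<Sum>i<n. of_int (c i) * g i)"
    using assms(3) unfolding rat_dep_def by blast
  have "k * \<phi> x = \<phi> (of_int k * x)" using additive_of_int_mult[OF assms(1)] by simp
  also have "\<dots> = 0"
    unfolding k(2) additive.sum[OF assms(1)]
    by (rule sum.neutral) (use assms(2) additive_of_int_mult[OF assms(1)] in auto)
  finally show ?thesis using k(1) by simp
qed

lemma additive_comb:
  fixes \<phi> \<psi> :: "'a::ab_group_add \<Rightarrow> int"
  assumes "additive \<phi>" "additive \<psi>"
  shows "additive (\<lambda>x. a * \<phi> x - b * \<psi> x)"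
  by unfold_locales (simp add: additive.add[OF assms(1)] additive.add[OF assms(2)] algebra_simps)

lemma rat_dep_combine:
  assumes "rat_dep g n (of_int a * x - of_int b * g n)" "a \<noteq> 0"
  shows "rat_dep g (Suc n) x"
proof -
  obtain k c where k: "k \<noteq> 0" "of_int k * (of_int a * x - of_int b * g n) = (\<Sum>i<n. of_int (c i) * g i)"
    using assms(1) unfolding rat_dep_def by blast
  have "of_int (k * a) * x = (\<Sum>i<n. of_int (c i) * g i) + of_int (k * b) * g n"
    using k(2) by (simp add: algebra_simps)
  then show ?thesis unfolding rat_dep_Suc using k(1) assms(2) by (metis mult_eq_0_iff)
qed

lemma rat_dep_Suc_redundant:
  assumes "rat_dep g n (g n)" "rat_dep g (Suc n) x"
  shows "rat_dep g n x"
proof -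
  obtain k c where k: "k \<noteq> 0" "of_int k * g n = (\<Sum>i<n. of_int (c i) * g i)"
    using assms(1) unfolding rat_dep_def by blast
  obtain l m d where l: "l \<noteq> 0" "of_int l * x = (\<Sum>i<n. of_int (d i) * g i) + of_int m * g n"
    using assms(2) unfolding rat_dep_Suc by blast
  have "of_int (k * l) * x = of_int k * (of_int l * x)" by (simp add: mult.assoc)
  also have "\<dots> = of_int k * (\<Sum>i<n. of_int (d i) * g i) + of_int m * (of_int k * g n)"
    unfolding l(2) by (simp add: algebra_simps)
  also have "\<dots> = (\<Sum>i<n. of_int (k * d i + m * c i) * g i)"
    unfolding k(2) by (simp add: sum_distrib_left sum.distrib algebra_simps)
  finally show ?thesis unfolding rat_dep_def using k(1) l(1)
    by (intro exI[of _ "k * l"] exI[of _ "\<lambda>i. k * d i + m * c i"]) auto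
qed

lemma rat_dep_mono_Suc: "rat_dep g n x \<Longrightarrow> rat_dep g (Suc n) x"
  using rat_dep_combine[of g n 1 x 0] by simp

text \<open>Elimination on functionals instead of vectors. For \<open>n = 0\<close> some coordinate
  detects \<open>x\<close>; this is where integer-valued functions enter. In the inductive step an
  independent \<open>g n\<close> is detected by \<open>\<psi>\<close>, which is then used to correct
  a second functional so that it also vanishes at \<open>g n\<close>.\<close>

lemma separating_functional:
  fixes g :: "nat \<Rightarrow> 'i \<Rightarrow> int"
  assumes "\<not> rat_dep g n x"
  shows "\<exists>\<phi> :: ('i \<Rightarrow> int) \<Rightarrow> int. additive \<phi> \<and> (\<forall>i<n. \<phi> (g i) = 0) \<and> \<phi> x \<noteq> 0"
  using assms
proof (induction n arbitrary: x)
  case 0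
  then have "x \<noteq> 0" unfolding rat_dep_def by (auto dest!: spec[of _ 1])
  then obtain j where "x j \<noteq> 0" by (auto simp: fun_eq_iff)
  then show ?case using additive_eval[of j] by blast
next
  case (Suc n)
  show ?case
  proof (cases "rat_dep g n (g n)")
    case True
    have "\<not> rat_dep g n x" using Suc.prems rat_dep_mono_Suc by blast
    with Suc.IH obtain \<phi> :: "('i \<Rightarrow> int) \<Rightarrow> int"
      where p: "additive \<phi>" "\<forall>i<n. \<phi> (g i) = 0" "\<phi> x \<noteq> 0" by blast
    then have "\<phi> (g n) = 0" using rat_dep_additive_zero[OF p(1) _ True] by blast
    with p show ?thesis by (metis less_Suc_eq)
  next
    case False
    with Suc.IH obtain \<psi> :: "('i \<Rightarrow> int) \<Rightarrow> int"
      where p: "additive \<psi>" "\<forall>i<n. \<psi> (g i) = 0" "\<psi> (g n) \<noteq> 0" by blast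
    \<comment> \<open>\<open>x'\<close> is \<open>x\<close> with its \<open>\<psi>\<close>-value
      cleared against \<open>g n\<close>; the corrected functional at the end takes at
      \<open>x\<close> the value of \<open>\<chi>\<close> at \<open>x'\<close>.\<close>
    define x' where "x' = of_int (\<psi> (g n)) * x - of_int (\<psi> x) * g n"
    have "\<not> rat_dep g n x'"
      using rat_dep_combine[of g n "\<psi> (g n)" x "\<psi> x"] Suc.prems p(3) unfolding x'_def by blast
    with Suc.IH obtain \<chi> :: "('i \<Rightarrow> int) \<Rightarrow> int"
      where c: "additive \<chi>" "\<forall>i<n. \<chi> (g i) = 0" "\<chi> x' \<noteq> 0" by blast
    have "\<chi> x' = \<psi> (g n) * \<chi> x - \<psi> x * \<chi> (g n)"
      unfolding x'_def additive.diff[OF c(1)] additive_of_int_mult[OF c(1)] by simp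
    with c(3) have "\<psi> (g n) * \<chi> x - \<chi> (g n) * \<psi> x \<noteq> 0" by (simp add: mult.commute)
    moreover have "\<forall>i<Suc n. \<psi> (g n) * \<chi> (g i) - \<chi> (g n) * \<psi> (g i) = 0"
      using p(2) c(2) by (auto simp: less_Suc_eq)
    ultimately show ?thesis using additive_comb[OF c(1) p(1)] by blast
  qed
qed

text \<open>The values of \<open>\<phi>\<close> on \<open>H\<close> form a subgroup of the integers;
  one of least nonzero absolute value generates it, by division with remainder.\<close>

lemma subgroup_functional_generator:
  fixes \<phi> :: "'a::comm_ring_1 \<Rightarrow> int"
  assumes H: "add_subgroup H" and "additive \<phi>" and x0: "x0 \<in> H" "\<phi> x0 \<noteq> 0"
  shows "\<exists>b\<in>H. \<phi> b \<noteq> 0 \<and> (\<forall>x\<in>H. \<phi> b dvd \<phi> x)"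
proof -
  interpret additive \<phi> by fact
  obtain b where b: "b \<in> H" "\<phi> b \<noteq> 0"
    and min: "\<And>y. y \<in> H \<Longrightarrow> \<phi> y \<noteq> 0 \<Longrightarrow> nat \<bar>\<phi> b\<bar> \<le> nat \<bar>\<phi> y\<bar>"
    using ex_has_least_nat[of "\<lambda>y. y \<in> H \<and> \<phi> y \<noteq> 0" x0 "\<lambda>y. nat \<bar>\<phi> y\<bar>"] x0 by blast
  have "\<phi> b dvd \<phi> x" if "x \<in> H" for x
  proof (rule ccontr)
    assume n: "\<not> \<phi> b dvd \<phi> x"
    define y where "y = x - of_int (\<phi> x div \<phi> b) * b"
    have "y \<in> H" unfolding y_def
      using that b(1) H by (intro add_subgroup_diff add_subgroup_of_int_mult) auto
    have "\<phi> y = \<phi> x mod \<phi> b"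
      unfolding y_def diff additive_of_int_mult[OF assms(2)] by (simp add: minus_div_mult_eq_mod)
    moreover have "\<phi> x mod \<phi> b \<noteq> 0" using n by (simp add: dvd_eq_mod_eq_0)
    moreover have "\<bar>\<phi> x mod \<phi> b\<bar> < \<bar>\<phi> b\<bar>" using b(2) by (simp add: abs_mod_less)
    ultimately show False using min[OF \<open>y \<in> H\<close>] by auto
  qed
  with b show ?thesis by blast
qed

text \<open>\<open>I\<close> is an arbitrary set of positions because the enumeration used below
  skips the elements that depend rationally on earlier ones.\<close>

definition int_basis :: "nat set \<Rightarrow> (nat \<Rightarrow> 'i \<Rightarrow> int) \<Rightarrow> ('i \<Rightarrow> int) set \<Rightarrow> bool" where
  "int_basis I b H \<longleftrightarrow> (\<forall>n\<in>I. b n \<in> H) \<and>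
     (\<forall>x\<in>H. \<exists>J c. finite J \<and> J \<subseteq> I \<and> x = (\<Sum>i\<in>J. of_int (c i) * b i)) \<and>
     (\<forall>J c. finite J \<longrightarrow> J \<subseteq> I \<longrightarrow> (\<Sum>i\<in>J. of_int (c i) * b i) = 0 \<longrightarrow> (\<forall>i\<in>J. c i = (0::int)))"

text \<open>With \<open>P n\<close> the pure closure of the first \<open>n\<close> elements of an enumeration, a functional that
  vanishes on \<open>P n\<close> but not on the next element embeds \<open>P (Suc n) / P n\<close> into the integers.\<close>

lemma countable_subgroup_basis:
  fixes H :: "('i \<Rightarrow> int) set"
  assumes H: "add_subgroup H" and "countable H"
  shows "\<exists>I b. int_basis I b H"
proof -
  define g where "g = from_nat_into H"
  have g: "range g = H"
    unfolding g_def using H \<open>countable H\<close> add_subgroup_zero by (intro range_from_nat_into) auto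
  define P where "P n = {x \<in> H. rat_dep g n x}" for n
  define I where "I = {n. \<not> rat_dep g n (g n)}"
  have "\<forall>n. \<exists>\<phi> :: ('i \<Rightarrow> int) \<Rightarrow> int. n \<in> I \<longrightarrow> additive \<phi> \<and> (\<forall>i<n. \<phi> (g i) = 0) \<and> \<phi> (g n) \<noteq> 0"
    using separating_functional[of g] unfolding I_def by blast
  then obtain \<phi> :: "nat \<Rightarrow> ('i \<Rightarrow> int) \<Rightarrow> int"
    where \<phi>: "\<And>n. n \<in> I \<Longrightarrow> additive (\<phi> n)" "\<And>n i. n \<in> I \<Longrightarrow> i < n \<Longrightarrow> \<phi> n (g i) = 0"
      "\<And>n. n \<in> I \<Longrightarrow> \<phi> n (g n) \<noteq> 0" by metis
  have dep_self: "rat_dep g (Suc n) (g n)" for n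
    unfolding rat_dep_Suc
    by (intro exI[of _ 1] conjI exI[of _ "\<lambda>_. 0"]) auto
  have Psub: "add_subgroup (P n)" for n
  proof -
    have "rat_dep g n (x - y)" if xy: "rat_dep g n x" "rat_dep g n y" for x y
    proof -
      obtain k c where k: "k \<noteq> 0" "of_int k * x = (\<Sum>i<n. of_int (c i) * g i)"
        using xy(1) unfolding rat_dep_def by blast
      obtain l d where l: "l \<noteq> 0" "of_int l * y = (\<Sum>i<n. of_int (d i) * g i)"
        using xy(2) unfolding rat_dep_def by blast
      have "of_int (k * l) * (x - y) = of_int l * (of_int k * x) - of_int k * (of_int l * y)"
        by (simp add: algebra_simps)
      also have "\<dots> = (\<Sum>i<n. of_int (l * c i - k * d i) * g i)"
        unfolding k(2) l(2) by (simp add: sum_distrib_left sum_subtractf algebra_simps)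
      finally show ?thesis unfolding rat_dep_def using k(1) l(1)
        by (intro exI[of _ "k * l"] exI[of _ "\<lambda>i. l * c i - k * d i"]) auto
    qed
    moreover have "rat_dep g n 0"
      unfolding rat_dep_def by (intro exI[of _ 1] exI[of _ "\<lambda>_. 0"]) auto
    ultimately show ?thesis
      using H unfolding P_def add_subgroup_def by auto
  qed
  have gP: "g n \<in> P (Suc n)" for n using g dep_self unfolding P_def by auto
  have "\<forall>n. \<exists>b. n \<in> I \<longrightarrow> b \<in> P (Suc n) \<and> \<phi> n b \<noteq> 0 \<and> (\<forall>x\<in>P (Suc n). \<phi> n b dvd \<phi> n x)"
    using subgroup_functional_generator[OF Psub _ gP] \<phi>(1,3) by meson
  then obtain b where b: "\<And>n. n \<in> I \<Longrightarrow> b n \<in> P (Suc n)" "\<And>n. n \<in> I \<Longrightarrow> \<phi> n (b n) \<noteq> 0"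
    "\<And>n x. n \<in> I \<Longrightarrow> x \<in> P (Suc n) \<Longrightarrow> \<phi> n (b n) dvd \<phi> n x" by metis
  have kill: "\<phi> n x = 0" if "n \<in> I" "x \<in> P n" for n x
    using rat_dep_additive_zero[OF \<phi>(1)] \<phi>(2) that unfolding P_def by blast
  \<comment> \<open>Applying \<open>\<phi> n\<close> to the relation of \<open>x\<close> leaves only
    the coefficient of \<open>g n\<close>, which must therefore vanish.\<close>
  have kernel: "x \<in> P n" if n: "n \<in> I" and x: "x \<in> P (Suc n)" "\<phi> n x = 0" for n x
  proof -
    obtain k l c where k: "k \<noteq> 0" "of_int k * x = (\<Sum>i<n. of_int (c i) * g i) + of_int l * g n"
      using x(1) unfolding P_def rat_dep_Suc by blast
    have "\<phi> n (of_int k * x) = \<phi> n (\<Sum>i<n. of_int (c i) * g i) + l * \<phi> n (g n)"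
      unfolding k(2) additive.add[OF \<phi>(1)[OF n]] additive_of_int_mult[OF \<phi>(1)[OF n]] by simp
    moreover have "\<phi> n (\<Sum>i<n. of_int (c i) * g i) = 0"
      unfolding additive.sum[OF \<phi>(1)[OF n]] additive_of_int_mult[OF \<phi>(1)[OF n]]
      using \<phi>(2)[OF n] by simp
    ultimately have "l = 0"
      using x(2) \<phi>(3)[OF n] by (simp add: additive_of_int_mult[OF \<phi>(1)[OF n]])
    then have "rat_dep g n x" unfolding rat_dep_def using k by auto
    then show ?thesis using x unfolding P_def by simp
  qed
  have Pmono: "P m \<subseteq> P n" if "m \<le> n" for m n
    by (rule lift_Suc_mono_le[OF _ that]) (auto simp: P_def intro: rat_dep_mono_Suc)
  have gen: "\<exists>c. x = (\<Sum>i\<in>I \<inter> {..<n}. of_int (c i) * b i)" if "x \<in> P n" for x n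
    using that
  proof (induction n arbitrary: x)
    case 0
    then obtain k where "k \<noteq> 0" "of_int k * x = 0" unfolding P_def rat_dep_def by auto
    then have "x = 0" by (simp add: fun_eq_iff)
    then show ?case by simp
  next
    case (Suc n)
    show ?case
    proof (cases "n \<in> I")
      case False
      then have "x \<in> P n" using Suc.prems rat_dep_Suc_redundant[of g n x] unfolding I_def P_def by auto
      moreover have "I \<inter> {..<Suc n} = I \<inter> {..<n}" using False by (auto simp: less_Suc_eq)
      ultimately show ?thesis using Suc.IH by simp
    next
      case True
      obtain q where q: "\<phi> n x = \<phi> n (b n) * q" using b(3)[OF True Suc.prems] by (auto simp: dvd_def)
      define y where "y = x - of_int q * b n"
      have "y \<in> P (Suc n)" unfolding y_def
        using Suc.prems b(1)[OF True] Psub by (intro add_subgroup_diff add_subgroup_of_int_mult) auto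
      moreover have "\<phi> n y = 0"
        unfolding y_def additive.diff[OF \<phi>(1)[OF True]] additive_of_int_mult[OF \<phi>(1)[OF True]]
        using q by simp
      ultimately have "y \<in> P n" using kernel True by blast
      then obtain c where c: "y = (\<Sum>i\<in>I \<inter> {..<n}. of_int (c i) * b i)" using Suc.IH by blast
      have I: "I \<inter> {..<Suc n} = insert n (I \<inter> {..<n})" using True by (auto simp: less_Suc_eq)
      have "x = of_int q * b n + y" unfolding y_def by simp
      also have "\<dots> = (\<Sum>i\<in>I \<inter> {..<Suc n}. of_int ((c(n := q)) i) * b i)"
        unfolding I c by (subst sum.insert) (auto intro!: sum.cong)
      finally show ?thesis by blast
    qed
  qed
  have "int_basis I b H"
    unfolding int_basis_def
  proof (intro conjI allI impI ballI)
    show "b n \<in> H" if "n \<in> I" for n using b(1)[OF that] unfolding P_def by simp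
    show "\<exists>J c. finite J \<and> J \<subseteq> I \<and> x = (\<Sum>i\<in>J. of_int (c i) * b i)" if x: "x \<in> H" for x
    proof -
      obtain n where "x = g n" using x g by blast
      then obtain c where "x = (\<Sum>i\<in>I \<inter> {..<Suc n}. of_int (c i) * b i)" using gen gP by blast
      then show ?thesis by (intro exI[of _ "I \<inter> {..<Suc n}"] exI[of _ c]) auto
    qed
    show "c j = 0"
      if J: "finite J" "J \<subseteq> I" and s: "(\<Sum>i\<in>J. of_int (c i) * b i) = 0" and j: "j \<in> J"
      for J c j
    proof (rule ccontr)
      assume "\<not> ?thesis"
      then have ne: "{i\<in>J. c i \<noteq> 0} \<noteq> {}" using j by blast
      \<comment> \<open>The largest position with a nonzero coefficient: \<open>\<phi> n\<close>
        kills all earlier basis elements but not \<open>b n\<close>.\<close>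
      define n where "n = Max {i\<in>J. c i \<noteq> 0}"
      have fin: "finite {i\<in>J. c i \<noteq> 0}" using J(1) by simp
      have n: "n \<in> J" "c n \<noteq> 0" using Max_in[OF fin ne] unfolding n_def by auto
      have nI: "n \<in> I" using n J by blast
      have big: "c i = 0" if "i \<in> J" "n < i" for i
        using Max_ge[OF fin, of i] that unfolding n_def by fastforce
      have "0 = \<phi> n (\<Sum>i\<in>J. of_int (c i) * b i)" unfolding s using additive.zero[OF \<phi>(1)[OF nI]] by simp
      also have "\<dots> = (\<Sum>i\<in>J. c i * \<phi> n (b i))"
        unfolding additive.sum[OF \<phi>(1)[OF nI]] additive_of_int_mult[OF \<phi>(1)[OF nI]] by simp
      also have "\<dots> = (\<Sum>i\<in>{n}. c i * \<phi> n (b i))"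
      proof (rule sum.mono_neutral_right)
        show "\<forall>i\<in>J - {n}. c i * \<phi> n (b i) = 0"
        proof
          fix i assume i: "i \<in> J - {n}"
          show "c i * \<phi> n (b i) = 0"
          proof (cases "i < n")
            case True
            then have "b i \<in> P n" using b(1)[of i] i J Pmono[of "Suc i" n] by auto
            then show ?thesis using kill nI by simp
          next
            case False then show ?thesis using big i by auto
          qed
        qed
      qed (use J n in auto)
      finally show False using n b(2)[OF nI] by simp
    qed
  qed
  then show ?thesis by blast
qed

text \<open>The basis found in the image is pulled back to elements of \<open>G\<close>, because
  \<open>free_abelian_grp\<close> asks for a basis in the type of the group. The homomorphism that
  extends the inclusion of this basis is shown to be bijective by computing after
  \<open>h\<close>.\<close>

theorem free_abelian_grpI_embedding:
  fixes G :: "('a, 'b) monoid_scheme" and h :: "'a \<Rightarrow> 'i \<Rightarrow> int"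
  assumes "comm_group G" and count: "countable (carrier G)"
    and hom: "\<And>x y. x \<in> carrier G \<Longrightarrow> y \<in> carrier G \<Longrightarrow> h (x \<otimes>\<^bsub>G\<^esub> y) = h x + h y"
    and inj: "inj_on h (carrier G)"
  shows "free_abelian_grp G"
proof -
  interpret G: comm_group G by fact
  let ?H = "h ` carrier G"
  have h1: "h \<one>\<^bsub>G\<^esub> = 0" using hom[of "\<one>\<^bsub>G\<^esub>" "\<one>\<^bsub>G\<^esub>"] by simp
  have hinv: "h (inv\<^bsub>G\<^esub> x) = - h x" if "x \<in> carrier G" for x
    using hom[of x "inv\<^bsub>G\<^esub> x"] that h1 by (simp add: eq_neg_iff_add_eq_0 add.commute)
  have "h x - h y = h (x \<otimes>\<^bsub>G\<^esub> inv\<^bsub>G\<^esub> y)" if "x \<in> carrier G" "y \<in> carrier G" for x y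
    using that hom hinv by simp
  moreover have "0 \<in> ?H" using h1 by (metis G.one_closed image_eqI)
  ultimately have sub: "add_subgroup ?H"
    unfolding add_subgroup_def by (auto intro!: image_eqI intro: G.inv_closed G.m_closed)
  obtain I b where "int_basis I b ?H"
    using countable_subgroup_basis[OF sub countable_image[OF count]] by blast
  then have b: "\<And>n. n \<in> I \<Longrightarrow> b n \<in> ?H"
    "\<And>x. x \<in> ?H \<Longrightarrow> \<exists>J c. finite J \<and> J \<subseteq> I \<and> x = (\<Sum>i\<in>J. of_int (c i) * b i)"
    "\<And>J c. finite J \<Longrightarrow> J \<subseteq> I \<Longrightarrow> (\<Sum>i\<in>J. of_int (c i) * b i) = 0 \<Longrightarrow> \<forall>i\<in>J. c i = (0::int)"
    unfolding int_basis_def by blast+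
  define b' where "b' n = inv_into (carrier G) h (b n)" for n
  have b': "b' n \<in> carrier G" "h (b' n) = b n" if "n \<in> I" for n
    using b(1)[OF that] unfolding b'_def by (simp_all add: inv_into_into f_inv_into_f)
  have inj_b: "inj_on b' I"
  proof (rule inj_onI, rule ccontr)
    fix i j assume ij: "i \<in> I" "j \<in> I" "b' i = b' j" "i \<noteq> j"
    then have "b i = b j" using b' by metis
    then have "(\<Sum>k\<in>{i,j}. of_int (if k = i then 1 else -1) * b k) = 0"
      using ij by simp
    then show False using b(3)[of "{i,j}" "\<lambda>k. if k = i then 1 else -1"] ij by auto
  qed
  let ?B = "b' ` I"
  let ?F = "free_Abelian_group ?B"
  obtain \<theta> where \<theta>: "\<theta> \<in> hom ?F G" "\<And>x. x \<in> ?B \<Longrightarrow> \<theta> (frag_of x) = x"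
    using G.free_Abelian_group_universal[of "\<lambda>x. x" ?B] b'(1) by auto
  have \<theta>_closed: "\<theta> x \<in> carrier G" if "Poly_Mapping.keys x \<subseteq> ?B" for x
    using \<theta>(1) that by (auto simp: hom_def Pi_iff)
  have \<theta>_add: "h (\<theta> (x + y)) = h (\<theta> x) + h (\<theta> y)"
    if "Poly_Mapping.keys x \<subseteq> ?B" "Poly_Mapping.keys y \<subseteq> ?B" for x y
    using \<theta>(1) that hom \<theta>_closed by (auto simp: hom_def)
  have \<theta>_diff: "h (\<theta> (x - y)) = h (\<theta> x) - h (\<theta> y)"
    if "Poly_Mapping.keys x \<subseteq> ?B" "Poly_Mapping.keys y \<subseteq> ?B" for x y
  proof -
    have "Poly_Mapping.keys (x - y) \<subseteq> ?B" using keys_diff[of x y] that by blast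
    from \<theta>_add[OF this that(2)] show ?thesis by simp
  qed
  \<comment> \<open>The sum ranges over any finite \<open>K\<close> containing the support, so that
    in the difference case both terms can be summed over one common set.\<close>
  have \<theta>_eq: "finite K \<Longrightarrow> Poly_Mapping.keys x \<subseteq> K \<Longrightarrow>
      h (\<theta> x) = (\<Sum>a\<in>K. of_int (Poly_Mapping.lookup x a) * h a)"
    if "Poly_Mapping.keys x \<subseteq> ?B" for x K
    using that
  proof (induction x arbitrary: K rule: free_Abelian_group_induct[consumes 1, case_names zero diff frag])
    case zero then show ?case using \<theta>_diff[of 0 0] by simp
  next
    case (diff x y)
    define L where "L = K \<union> Poly_Mapping.keys x \<union> Poly_Mapping.keys y"
    have L: "finite L" "K \<subseteq> L" "Poly_Mapping.keys x \<subseteq> L" "Poly_Mapping.keys y \<subseteq> L"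
      using diff.prems unfolding L_def by auto
    have "h (\<theta> (x - y)) = (\<Sum>a\<in>L. of_int (Poly_Mapping.lookup (x - y) a) * h a)"
      unfolding \<theta>_diff[OF diff(1,2)] diff(3)[OF L(1,3)] diff(4)[OF L(1,4)]
        lookup_minus of_int_diff left_diff_distrib sum_subtractf ..
    also have "\<dots> = (\<Sum>a\<in>K. of_int (Poly_Mapping.lookup (x - y) a) * h a)"
    proof (rule sum.mono_neutral_right)
      have "Poly_Mapping.lookup (x - y) i = 0" if "i \<notin> K" for i
        using that diff.prems by (meson in_keys_iff subsetD)
      then show "\<forall>i\<in>L - K. of_int (Poly_Mapping.lookup (x - y) i) * h i = 0" by simp
    qed (use L in auto)
    finally show ?case .
  next
    case (frag a)
    have eq: "(\<Sum>c\<in>K. of_int (Poly_Mapping.lookup (frag_of a) c) * h c) = (\<Sum>c\<in>{a}. of_int (Poly_Mapping.lookup (frag_of a) c) * h c)"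
      using frag by (intro sum.mono_neutral_right) (auto simp: lookup_single when_def)
    show ?case unfolding \<theta>(2)[OF frag(1)] eq by simp
  qed
  have "\<theta> \<in> iso ?F G"
    unfolding iso_def bij_betw_def
  proof (intro CollectI conjI \<theta>(1))
    have "x = y" if xy: "Poly_Mapping.keys x \<subseteq> ?B" "Poly_Mapping.keys y \<subseteq> ?B" "\<theta> x = \<theta> y" for x y
    proof -
      let ?z = "x - y"
      have z: "Poly_Mapping.keys ?z \<subseteq> ?B" using keys_diff[of x y] xy by blast
      obtain J where J: "J \<subseteq> I" "finite J" "Poly_Mapping.keys ?z = b' ` J"
        using z finite_keys[of ?z] by (meson finite_subset_image)
      have injJ: "inj_on b' J" using inj_b J(1) by (rule inj_on_subset)
      have "0 = h (\<theta> ?z)" using \<theta>_diff[OF xy(1,2)] xy(3) by simp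
      also have "\<dots> = (\<Sum>a\<in>b' ` J. of_int (Poly_Mapping.lookup ?z a) * h a)"
        using \<theta>_eq[OF z] J by simp
      also have "\<dots> = (\<Sum>j\<in>J. of_int (Poly_Mapping.lookup ?z (b' j)) * b j)"
        unfolding sum.reindex[OF injJ] using J b' by (intro sum.cong) auto
      finally have "\<forall>j\<in>J. Poly_Mapping.lookup ?z (b' j) = 0"
        using b(3)[OF J(2,1), of "\<lambda>j. Poly_Mapping.lookup ?z (b' j)"] by metis
      then have "Poly_Mapping.keys ?z = {}" using J(3) by (force simp: in_keys_iff)
      then show "x = y" by simp
    qed
    then show "inj_on \<theta> (carrier ?F)" by (auto simp: inj_on_def)
    show "\<theta> ` carrier ?F = carrier G"
    proof
      show "\<theta> ` carrier ?F \<subseteq> carrier G" using \<theta>_closed by auto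
      show "carrier G \<subseteq> \<theta> ` carrier ?F"
      proof
        fix x assume x: "x \<in> carrier G"
        then have "h x \<in> ?H" by simp
        from b(2)[OF this] obtain J c
          where J: "finite J" "J \<subseteq> I" "h x = (\<Sum>i\<in>J. of_int (c i) * b i)" by blast
        define u where "u = (\<Sum>i\<in>J. frag_cmul (c i) (frag_of (b' i)))"
        have keys: "Poly_Mapping.keys (frag_cmul k (frag_of (b' i))) \<subseteq> ?B" if "i \<in> I" for i k
          using keys_cmul[of k "frag_of (b' i)"] that by auto
        have val: "h (\<theta> (frag_cmul k (frag_of (b' i)))) = of_int k * b i" if "i \<in> I" for i k
        proof -
          have "Poly_Mapping.keys (frag_cmul k (frag_of (b' i))) \<subseteq> {b' i}"
            using keys_cmul[of k "frag_of (b' i)"] by auto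
          from \<theta>_eq[OF keys[OF that] _ this] show ?thesis using b'(2)[OF that] by simp
        qed
        have "Poly_Mapping.keys u \<subseteq> ?B \<and> h (\<theta> u) = (\<Sum>i\<in>J. of_int (c i) * b i)"
          unfolding u_def using J(1,2)
        proof (induction J rule: finite_induct)
          case empty then show ?case using \<theta>_diff[of 0 0] by simp
        next
          case (insert i J)
          have "Poly_Mapping.keys (frag_cmul (c i) (frag_of (b' i)) + (\<Sum>i\<in>J. frag_cmul (c i) (frag_of (b' i)))) \<subseteq> ?B"
            using insert keys[of i "c i"] by (intro order_trans[OF keys_add]) auto
          then show ?case
            using insert keys[of i "c i"] val[of i "c i"] \<theta>_add by simp
        qed
        then have "Poly_Mapping.keys u \<subseteq> ?B" "h (\<theta> u) = h x" using J(3) by auto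
        then show "x \<in> \<theta> ` carrier ?F"
          using inj x \<theta>_closed by (metis carrier_free_Abelian_group_iff image_eqI inj_onD)
      qed
    qed
  qed
  then have "G \<cong> ?F"
    using group.iso_sym[OF group_free_Abelian_group] unfolding is_iso_def by blast
  then show ?thesis unfolding free_abelian_grp_def using \<open>comm_group G\<close> by blast
qed

section \<open>The Leavitt ring and its trace\<close>

text \<open>Additive operators become a type so that the class \<open>ring_1\<close> applies with
  composition as product. Integer sequences are chosen because the integers \<open>app T f N\<close>
  separate operators.\<close>

typedef endo = "{T :: (nat \<Rightarrow> int) \<Rightarrow> nat \<Rightarrow> int. \<forall>f g. T (f + g) = T f + T g}"
  morphisms app Endo
  by (rule exI[of _ "\<lambda>f. f"]) simp

lemma app_Endo: "(\<And>f g. T (f + g) = T f + T g) \<Longrightarrow> app (Endo T) = T"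
  by (rule Endo_inverse) simp

lemma app_add_right: "app T (f + g) = app T f + app T g"
  using app[of T] by simp

lemma app_zero_right: "app T 0 = 0"
  using app_add_right[of T 0 0] by simp

lemma endo_eqI: "(\<And>f N. app S f N = app T f N) \<Longrightarrow> S = T"
  by (metis app_inject ext)

instantiation endo :: ring_1
begin

definition "0 = Endo (\<lambda>f. 0)"
definition "1 = Endo (\<lambda>f. f)"
definition "S + T = Endo (\<lambda>f. app S f + app T f)"
definition "- T = Endo (\<lambda>f. - app T f)"
definition "S - T = Endo (\<lambda>f. app S f - app T f)"
definition "S * T = Endo (\<lambda>f. app S (app T f))"

lemma app_simps:
  "app 0 f = 0" "app 1 f = f" "app (S + T) f = app S f + app T f" "app (- T) f = - app T f"
  "app (S - T) f = app S f - app T f" "app (S * T) f = app S (app T f)"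
  unfolding zero_endo_def one_endo_def plus_endo_def uminus_endo_def minus_endo_def times_endo_def
  by (subst app_Endo; simp add: app_add_right)+

instance
proof
  have "app (0::endo) (\<lambda>_. 1) 0 \<noteq> app 1 (\<lambda>_. 1) 0" by (simp add: app_simps)
  then show "(0::endo) \<noteq> 1" by metis
qed (rule endo_eqI; simp add: app_simps app_add_right algebra_simps)+

end

lemma app_sum: "app (sum S I) f = (\<Sum>i\<in>I. app (S i) f)"
  by (induction I rule: infinite_finite_induct) (simp_all add: app_simps)

text \<open>Residues modulo \<open>q\<close> split a sequence into \<open>q\<close> sequences.
  \<open>shift_in\<close> places a sequence as the \<open>i\<close>-th part and
  \<open>shift_out\<close> reads that part off; these are the Leavitt generators, with relations
  \<open>shift_out_in\<close> and \<open>sum_shift_in_out\<close>.\<close>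

definition shift_in :: "nat \<Rightarrow> nat \<Rightarrow> endo" where
  "shift_in q i = Endo (\<lambda>f N. if N mod q = i then f (N div q) else 0)"

definition shift_out :: "nat \<Rightarrow> nat \<Rightarrow> endo" where
  "shift_out q i = Endo (\<lambda>f N. f (q * N + i))"

text \<open>A product of \<open>l\<close> insertions followed on the right by \<open>k\<close>
  extractions. For \<open>a < q ^ l\<close> and \<open>b < q ^ k\<close> it sends the unit vector at
  \<open>q ^ k * s + b\<close> to the one at \<open>q ^ l * s + a\<close>.\<close>

definition monomial :: "nat \<Rightarrow> nat \<Rightarrow> nat \<Rightarrow> nat \<Rightarrow> nat \<Rightarrow> endo" where
  "monomial q l a k b = Endo (\<lambda>f N. if N mod q ^ l = a then f (q ^ k * (N div q ^ l) + b) else 0)"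

lemma app_shift_in: "app (shift_in q i) f N = (if N mod q = i then f (N div q) else 0)"
  unfolding shift_in_def by (subst app_Endo) (auto simp: fun_eq_iff)

lemma app_shift_out: "app (shift_out q i) f N = f (q * N + i)"
  unfolding shift_out_def by (subst app_Endo) (auto simp: fun_eq_iff)

lemma app_monomial:
  "app (monomial q l a k b) f N = (if N mod q ^ l = a then f (q ^ k * (N div q ^ l) + b) else 0)"
  unfolding monomial_def by (subst app_Endo) (auto simp: fun_eq_iff)

lemma shift_out_in:
  assumes "i < q" "j < q"
  shows "shift_out q i * shift_in q j = (if i = j then 1 else 0)"
  using assms by (intro endo_eqI) (simp add: app_simps app_shift_in app_shift_out)

lemma sum_shift_in_out:
  assumes "q > 0"
  shows "(\<Sum>i<q. shift_in q i * shift_out q i) = 1"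
proof (rule endo_eqI)
  fix f N
  have "app (\<Sum>i<q. shift_in q i * shift_out q i) f N
      = (\<Sum>i<q. if N mod q = i then f (q * (N div q) + i) else 0)"
    by (simp add: app_sum sum_fun_apply app_simps app_shift_in app_shift_out)
  also have "\<dots> = f (q * (N div q) + N mod q)"
    using assms by (subst sum.delta') auto
  finally show "app (\<Sum>i<q. shift_in q i * shift_out q i) f N = app 1 f N"
    by (simp add: app_simps)
qed

section \<open>Words in the generators and their normal form\<close>

definition gen :: "nat \<Rightarrow> bool \<times> nat \<Rightarrow> endo" where
  "gen q = (\<lambda>(u, i). if u then shift_in q i else shift_out q i)"

definition word :: "nat \<Rightarrow> (bool \<times> nat) list \<Rightarrow> endo" where
  "word q ws = prod_list (map (gen q) ws)"

text \<open>The span of the words rather than the ring of all operators: \<open>A\<close> must be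
  countable, and the truncated traces below stabilise on words.\<close>

definition leavitt :: "nat \<Rightarrow> endo set" where
  "leavitt q = zspan (word q ` lists (UNIV \<times> {..<q}))"

text \<open>In base \<open>q\<close>, the inserted index \<open>i\<close> becomes the new lowest
  digit of the residue \<open>a\<close>.\<close>

lemma shift_in_monomial:
  assumes "i < q" "a < q ^ l"
  shows "shift_in q i * monomial q l a k b = monomial q (Suc l) (q * a + i) k b"
proof (rule endo_eqI)
  fix f N
  have "N mod (q * q ^ l) = q * (N div q mod q ^ l) + N mod q" by (simp add: mod_mult2_eq)
  moreover have "q * x + y = q * a + i \<longleftrightarrow> x = a \<and> y = i" if "y < q" for x y
  proof
    assume e: "q * x + y = q * a + i"
    have "(q * x + y) div q = x" "(q * a + i) div q = a" using that assms by auto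
    then show "x = a \<and> y = i" using e by auto
  qed auto
  ultimately have "N mod (q * q ^ l) = q * a + i \<longleftrightarrow> N mod q = i \<and> N div q mod q ^ l = a"
    using assms by auto
  then show "app (shift_in q i * monomial q l a k b) f N = app (monomial q (Suc l) (q * a + i) k b) f N"
    by (simp add: app_simps app_shift_in app_monomial div_mult2_eq)
qed

text \<open>With no insertion left to cancel, \<open>i\<close> is put in front of \<open>b\<close>
  as a leading digit.\<close>

lemma shift_out_monomial_0:
  "shift_out q i * monomial q 0 0 k b = monomial q 0 0 (Suc k) (q ^ k * i + b)"
  by (rule endo_eqI) (simp add: app_simps app_shift_out app_monomial algebra_simps)

text \<open>The extraction compares \<open>i\<close> with the lowest digit of \<open>a\<close> and
  either cancels it or kills the product.\<close>

lemma shift_out_monomial_Suc: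
  assumes "i < q"
  shows "shift_out q i * monomial q (Suc l) a k b = (if a mod q = i then monomial q l (a div q) k b else 0)"
proof (rule endo_eqI)
  fix f N
  have "(q * N + i) mod (q * q ^ l) = q * (N mod q ^ l) + i"
    using assms by (simp add: mod_mult2_eq)
  moreover have "q * (N mod q ^ l) + i = a \<longleftrightarrow> a mod q = i \<and> N mod q ^ l = a div q"
    using assms by auto
  ultimately show "app (shift_out q i * monomial q (Suc l) a k b) f N =
      app (if a mod q = i then monomial q l (a div q) k b else 0) f N"
    using assms by (simp add: app_simps app_shift_out app_monomial div_mult2_eq)
qed

text \<open>By induction from the right end, each extraction cancels against an insertion standing
  next to it, so a nonzero word can be written with all insertions to the left of all
  extractions.\<close>

lemma word_normal_form:
  assumes "q > 0" "ws \<in> lists (UNIV \<times> {..<q})"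
  shows "word q ws = 0 \<or> (\<exists>l a k b. a < q ^ l \<and> b < q ^ k \<and> word q ws = monomial q l a k b)"
  using assms(2)
proof (induction ws)
  case Nil
  have "word q [] = monomial q 0 0 0 0"
    unfolding word_def by (intro endo_eqI) (simp add: app_simps app_monomial)
  then show ?case by (metis less_one power_0)
next
  case (Cons g ws)
  obtain u i where g: "g = (u, i)" "i < q" using Cons.hyps(1) by auto
  have w: "word q (g # ws) = (if u then shift_in q i else shift_out q i) * word q ws"
    unfolding word_def gen_def g by simp
  show ?case
  proof (cases "word q ws = 0")
    case True then show ?thesis using w by simp
  next
    case False
    then obtain l a k b where m: "a < q ^ l" "b < q ^ k" "word q ws = monomial q l a k b"
      using Cons.IH by blast
    show ?thesis
    proof (cases u)
      case True
      have "q * a + i < q * (a + 1)" using g by simp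
      also have "\<dots> \<le> q * q ^ l" using m(1) by (intro mult_left_mono) auto
      finally have "q * a + i < q ^ Suc l" by simp
      moreover have "word q (g # ws) = monomial q (Suc l) (q * a + i) k b"
        using w m True shift_in_monomial[OF g(2) m(1)] by simp
      ultimately show ?thesis using m(2) by blast
    next
      case False
      show ?thesis
      proof (cases l)
        case 0
        have "q ^ k * i + b < q ^ k * (i + 1)" using m(2) by simp
        also have "\<dots> \<le> q ^ k * q" using g by (intro mult_left_mono) auto
        finally have "q ^ k * i + b < q ^ Suc k" by (simp add: mult.commute)
        moreover have "word q (g # ws) = monomial q 0 0 (Suc k) (q ^ k * i + b)"
          using w m False 0 shift_out_monomial_0 by simp
        ultimately show ?thesis by (metis less_one power_0)
      next
        case (Suc l')
        have "a div q < q ^ l'" using m(1) Suc by (simp add: less_mult_imp_div_less mult.commute)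
        moreover have "word q (g # ws) = (if a mod q = i then monomial q l' (a div q) k b else 0)"
          using w m False Suc shift_out_monomial_Suc[OF g(2)] by simp
        ultimately show ?thesis using m(2) by metis
      qed
    qed
  qed
qed

lemma add_subgroup_leavitt: "add_subgroup (leavitt q)"
  unfolding leavitt_def by (rule add_subgroup_zspan)

lemma countable_leavitt: "countable (leavitt q)"
  unfolding leavitt_def by (intro countable_zspan countable_image) (rule countableI_type)

lemma word_leavitt: "ws \<in> lists (UNIV \<times> {..<q}) \<Longrightarrow> word q ws \<in> leavitt q"
  unfolding leavitt_def by (intro zspan_base) auto

lemma one_leavitt: "1 \<in> leavitt q"
  using word_leavitt[of "[]"] by (simp add: word_def)

lemma shift_in_leavitt: "i < q \<Longrightarrow> shift_in q i \<in> leavitt q"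
  using word_leavitt[of "[(True, i)]"] by (simp add: word_def gen_def)

lemma shift_out_leavitt: "i < q \<Longrightarrow> shift_out q i \<in> leavitt q"
  using word_leavitt[of "[(False, i)]"] by (simp add: word_def gen_def)

lemma mult_leavitt:
  assumes "S \<in> leavitt q" "T \<in> leavitt q"
  shows "S * T \<in> leavitt q"
proof -
  have word: "word q ws * U \<in> leavitt q" if "ws \<in> lists (UNIV \<times> {..<q})" "U \<in> leavitt q" for ws U
  proof -
    have "leavitt q \<subseteq> {U. word q ws * U \<in> leavitt q}"
      unfolding leavitt_def
    proof (rule zspan_least, unfold leavitt_def[symmetric])
      show "add_subgroup {U. word q ws * U \<in> leavitt q}"
        using add_subgroup_leavitt[of q] unfolding add_subgroup_def by (auto simp: algebra_simps)
      show "word q ` lists (UNIV \<times> {..<q}) \<subseteq> {U. word q ws * U \<in> leavitt q}"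
      proof
        fix U assume "U \<in> word q ` lists (UNIV \<times> {..<q})"
        then obtain vs where "vs \<in> lists (UNIV \<times> {..<q})" "U = word q vs" by blast
        then show "U \<in> {U. word q ws * U \<in> leavitt q}"
          using word_leavitt[of "ws @ vs" q] that(1) by (simp add: word_def)
      qed
    qed
    then show ?thesis using that(2) by blast
  qed
  have "leavitt q \<subseteq> {S. S * T \<in> leavitt q}"
    unfolding leavitt_def
  proof (rule zspan_least, unfold leavitt_def[symmetric])
    show "add_subgroup {S. S * T \<in> leavitt q}"
      using add_subgroup_leavitt[of q] unfolding add_subgroup_def by (auto simp: algebra_simps)
    show "word q ` lists (UNIV \<times> {..<q}) \<subseteq> {S. S * T \<in> leavitt q}"
      using word assms(2) by blast
  qed
  then show ?thesis using assms(1) by blast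
qed

section \<open>Truncated diagonal sums modulo \<open>q - 1\<close>\<close>

definition delta :: "nat \<Rightarrow> nat \<Rightarrow> int" where
  "delta N K = (if K = N then 1 else 0)"

text \<open>Modulo \<open>q - 1\<close> this stabilises as \<open>n\<close> grows, and the stable value is a trace: a monomial
  with \<open>l = k\<close> and \<open>a = b\<close> has \<open>q ^ (n - l)\<close> diagonal entries \<open>1\<close> below \<open>q ^ n\<close>, and every other
  monomial has at most one.\<close>
definition trunc_trace :: "nat \<Rightarrow> nat \<Rightarrow> endo \<Rightarrow> int" where
  "trunc_trace q n T = (\<Sum>N<q ^ n. app T (delta N) N)"

lemma additive_trunc_trace: "additive (trunc_trace q n)"
  by unfold_locales (simp add: trunc_trace_def app_simps sum.distrib)

lemma trunc_trace_one: "trunc_trace q n 1 = int q ^ n"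
  by (simp add: trunc_trace_def app_simps delta_def)

text \<open>The ends of the range are multiples of \<open>p\<close>, so the residue class inside it
  is exactly the image of \<open>{A..<B}\<close>.\<close>

lemma sum_residue_class:
  fixes h :: "nat \<Rightarrow> 'a::comm_monoid_add"
  assumes "a < p"
  shows "(\<Sum>N\<in>{p * A..<p * B}. if N mod p = a then h N else 0) = (\<Sum>M\<in>{A..<B}. h (p * M + a))"
proof -
  have inj: "inj_on (\<lambda>M. p * M + a) {A..<B}" using assms by (auto simp: inj_on_def)
  have img: "{N \<in> {p * A..<p * B}. N mod p = a} = (\<lambda>M. p * M + a) ` {A..<B}"
  proof (intro equalityI subsetI)
    fix N assume N: "N \<in> {N \<in> {p * A..<p * B}. N mod p = a}"
    then have eq: "N = p * (N div p) + a" by auto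
    have "A \<le> N div p" using N assms by (simp add: less_eq_div_iff_mult_less_eq mult.commute)
    moreover have "N div p < B" using N assms by (simp add: less_mult_imp_div_less mult.commute)
    ultimately show "N \<in> (\<lambda>M. p * M + a) ` {A..<B}" using eq by auto
  next
    fix N assume "N \<in> (\<lambda>M. p * M + a) ` {A..<B}"
    then obtain M where M: "A \<le> M" "M < B" "N = p * M + a" by auto
    have "p * A \<le> p * M" using M by simp
    then have "p * A \<le> N" using M(3) by linarith
    moreover have "p * M + p \<le> p * B" using mult_le_mono2[of "M + 1" B p] M by simp
    then have "N < p * B" using M(3) assms by linarith
    ultimately show "N \<in> {N \<in> {p * A..<p * B}. N mod p = a}" using M assms by auto
  qed
  have "(\<Sum>N\<in>{p * A..<p * B}. if N mod p = a then h N else 0)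
      = (\<Sum>N\<in>{N \<in> {p * A..<p * B}. N mod p = a}. h N)"
    by (rule sum.inter_filter[symmetric]) simp
  also have "\<dots> = (\<Sum>M\<in>{A..<B}. h (p * M + a))"
    unfolding img by (subst sum.reindex[OF inj]) simp
  finally show ?thesis .
qed

text \<open>For equal slopes the equation holds for all \<open>s\<close> or for none, and the window
  has \<open>r * q ^ m\<close> elements. For different slopes every solution satisfies
  \<open>s \<le> b + c\<close>, and late windows start beyond that bound.\<close>

lemma diagonal_count:
  fixes \<alpha> \<beta> b c q :: nat
  assumes q: "q = Suc r" "r > 0"
  shows "eventually (\<lambda>m. [(\<Sum>s\<in>{q ^ m..<q ^ Suc m}. if \<alpha> * s + b = \<beta> * s + c then 1 else 0) = (0::int)] (mod int r)) sequentially"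
proof (cases "\<alpha> = \<beta>")
  case True
  have "[(\<Sum>s\<in>{q ^ m..<q ^ Suc m}. if \<alpha> * s + b = \<beta> * s + c then 1 else 0) = (0::int)] (mod int r)" for m
  proof (cases "b = c")
    case True
    have "(\<Sum>s\<in>{q ^ m..<q ^ Suc m}. if \<alpha> * s + b = \<beta> * s + c then 1 else 0) = int r * int (q ^ m)"
      using \<open>\<alpha> = \<beta>\<close> True q by simp
    then show ?thesis by (simp only: cong_0_iff dvd_triv_left)
  qed (simp add: \<open>\<alpha> = \<beta>\<close>)
  then show ?thesis by simp
next
  case False
  have bound: "s \<le> b + c" if "\<alpha> * s + b = \<beta> * s + c" for s
  proof (cases "\<alpha> < \<beta>")
    case True
    then have "(\<alpha> + 1) * s \<le> \<beta> * s" by (intro mult_right_mono) auto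
    then show ?thesis using that by (simp add: algebra_simps)
  next
    case F: False
    then have "(\<beta> + 1) * s \<le> \<alpha> * s" using False by (intro mult_right_mono) auto
    then show ?thesis using that by (simp add: algebra_simps)
  qed
  have "\<forall>m\<ge>b + c. [(\<Sum>s\<in>{q ^ m..<q ^ Suc m}. if \<alpha> * s + b = \<beta> * s + c then 1 else 0) = (0::int)] (mod int r)"
  proof (intro allI impI)
    fix m assume "b + c \<le> m"
    moreover have "m < q ^ m" using q by (intro less_exp[THEN less_le_trans] power_mono) auto
    ultimately have "\<alpha> * s + b \<noteq> \<beta> * s + c" if "s \<in> {q ^ m..<q ^ Suc m}" for s
      using bound[of s] that by auto
    then have "(\<Sum>s\<in>{q ^ m..<q ^ Suc m}. if \<alpha> * s + b = \<beta> * s + c then 1 else 0) = (0::int)"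
      by (intro sum.neutral) auto
    then show "[(\<Sum>s\<in>{q ^ m..<q ^ Suc m}. if \<alpha> * s + b = \<beta> * s + c then 1 else 0) = (0::int)] (mod int r)"
      by (simp only: cong_refl)
  qed
  then show ?thesis unfolding eventually_sequentially by blast
qed

context
  fixes q r :: nat
  assumes q: "q = Suc r" "r > 0"
begin

lemma trunc_trace_stable_word:
  assumes "ws \<in> lists (UNIV \<times> {..<q})"
  shows "eventually (\<lambda>m. [trunc_trace q (Suc m) (word q ws) = trunc_trace q m (word q ws)] (mod int r)) sequentially"
proof (cases "word q ws = 0")
  case True then show ?thesis by (simp add: trunc_trace_def app_simps)
next
  case False
  then obtain l a k b where m: "a < q ^ l" "b < q ^ k" "word q ws = monomial q l a k b"
    using word_normal_form[OF _ assms] q by auto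
  have quot: "(q ^ l * s + a) div q ^ l = s" for s
  proof -
    have "(p * s + a) div p = s" if "a < p" for p using that by auto
    then show ?thesis using m(1) .
  qed
  \<comment> \<open>Truncation levels start at \<open>l\<close>, so that both ends of the added
    window are multiples of \<open>q ^ l\<close>; writing \<open>N = q ^ l * s + a\<close> turns its
    diagonal entries into the count of \<open>diagonal_count\<close>.\<close>
  have diff: "trunc_trace q (Suc (n + l)) (word q ws) - trunc_trace q (n + l) (word q ws)
    = (\<Sum>s\<in>{q ^ n..<q ^ Suc n}. if q ^ k * s + b = q ^ l * s + a then 1 else 0)" for n
  proof -
    have "q ^ (n + l) \<le> q ^ Suc (n + l)" using q by (intro power_increasing) auto
    then have split: "{..<q ^ Suc (n + l)} = {..<q ^ (n + l)} \<union> {q ^ (n + l)..<q ^ Suc (n + l)}"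
      by (rule ivl_disj_un_one(2)[symmetric])
    have "trunc_trace q (Suc (n + l)) (word q ws) - trunc_trace q (n + l) (word q ws)
      = (\<Sum>N\<in>{q ^ (n + l)..<q ^ Suc (n + l)}. app (word q ws) (delta N) N)"
      unfolding trunc_trace_def by (subst split) (subst sum.union_disjoint, auto)
    also have "{q ^ (n + l)..<q ^ Suc (n + l)} = {q ^ l * q ^ n..<q ^ l * q ^ Suc n}"
      by (simp add: power_add algebra_simps)
    also have "(\<Sum>N\<in>\<dots>. app (word q ws) (delta N) N) =
        (\<Sum>N\<in>{q ^ l * q ^ n..<q ^ l * q ^ Suc n}. if N mod q ^ l = a
          then (if q ^ k * (N div q ^ l) + b = N then 1 else 0) else 0)"
      unfolding m(3) app_monomial delta_def by simp
    also have "\<dots> = (\<Sum>s\<in>{q ^ n..<q ^ Suc n}. if q ^ k * ((q ^ l * s + a) div q ^ l) + b = q ^ l * s + a then 1 else 0)"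
      by (rule sum_residue_class[OF m(1)])
    finally show ?thesis unfolding quot .
  qed
  have "eventually (\<lambda>n. [trunc_trace q (Suc (n + l)) (word q ws) = trunc_trace q (n + l) (word q ws)] (mod int r)) sequentially"
    using diagonal_count[OF q, of "q ^ k" b "q ^ l" a]
    unfolding diff[symmetric] cong_diff_iff_cong_0 .
  then show ?thesis
    using eventually_sequentially_seg[where P = "\<lambda>n. [trunc_trace q (Suc n) (word q ws) = trunc_trace q n (word q ws)] (mod int r)", of l]
    by blast
qed

lemma trunc_trace_stable:
  assumes "T \<in> leavitt q"
  shows "eventually (\<lambda>m. [trunc_trace q (Suc m) T = trunc_trace q m T] (mod int r)) sequentially"
proof -
  let ?H = "{T. eventually (\<lambda>m. [trunc_trace q (Suc m) T = trunc_trace q m T] (mod int r)) sequentially}"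
  have "add_subgroup ?H"
    unfolding add_subgroup_def
  proof (intro conjI ballI)
    show "0 \<in> ?H" by (simp add: additive.zero[OF additive_trunc_trace])
    fix S T assume "S \<in> ?H" "T \<in> ?H"
    then have "eventually (\<lambda>m. [trunc_trace q (Suc m) S = trunc_trace q m S] (mod int r)) sequentially"
       "eventually (\<lambda>m. [trunc_trace q (Suc m) T = trunc_trace q m T] (mod int r)) sequentially" by auto
    then have "eventually (\<lambda>m. [trunc_trace q (Suc m) (S - T) = trunc_trace q m (S - T)] (mod int r)) sequentially"
      by eventually_elim (simp only: additive.diff[OF additive_trunc_trace] cong_diff)
    then show "S - T \<in> ?H" by simp
  qed
  moreover have "word q ` lists (UNIV \<times> {..<q}) \<subseteq> ?H" using trunc_trace_stable_word by auto
  ultimately show ?thesis using zspan_least[of ?H] assms unfolding leavitt_def by blast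
qed

lemma app_shift_in_delta: "i < q \<Longrightarrow> app (shift_in q i) (delta N) = delta (q * N + i)"
  by (auto simp: fun_eq_iff app_shift_in delta_def)

lemma app_shift_out_delta:
  assumes "i < q"
  shows "app (shift_out q i) (delta N) = (if N mod q = i then delta (N div q) else 0)"
proof
  fix K
  have "q * K + i = N \<longleftrightarrow> N mod q = i \<and> K = N div q" using assms by auto
  then show "app (shift_out q i) (delta N) K = (if N mod q = i then delta (N div q) else 0) K"
    by (simp add: app_shift_out delta_def)
qed

text \<open>Equality is exact, with truncation levels one apart: the rows of
  \<open>shift_in q i * T\<close> vanish outside the residue class of \<open>i\<close>, and the rows
  of that class below \<open>q ^ Suc m\<close> are numbered by \<open>M < q ^ m\<close>. Eventual
  stability later absorbs the change of level.\<close>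

lemma trunc_trace_shift_in:
  assumes "i < q"
  shows "trunc_trace q (Suc m) (shift_in q i * T) = trunc_trace q m (T * shift_in q i)"
  using sum_residue_class[OF assms, where A = 0 and B = "q ^ m" and h = "\<lambda>N. app T (delta N) (N div q)"] assms
  by (simp add: trunc_trace_def lessThan_atLeast0 app_simps app_shift_in app_shift_in_delta)

text \<open>Dual to \<open>trunc_trace_shift_in\<close>: here the columns outside the residue class
  vanish.\<close>

lemma trunc_trace_shift_out:
  assumes "i < q"
  shows "trunc_trace q (Suc m) (T * shift_out q i) = trunc_trace q m (shift_out q i * T)"
proof -
  have "app T (app (shift_out q i) (delta N)) N = (if N mod q = i then app T (delta (N div q)) N else 0)" for N
    using app_zero_right[of T] by (simp add: app_shift_out_delta[OF assms])
  then show ?thesis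
    using sum_residue_class[OF assms, where A = 0 and B = "q ^ m" and h = "\<lambda>N. app T (delta (N div q)) N"] assms
    by (simp add: trunc_trace_def lessThan_atLeast0 app_simps app_shift_out)
qed

lemma trunc_trace_commute_gen:
  assumes i: "i < q" and T: "T \<in> leavitt q"
  shows "eventually (\<lambda>m. [trunc_trace q m (gen q (u, i) * T) = trunc_trace q m (T * gen q (u, i))] (mod int r)) sequentially"
proof -
  have "eventually (\<lambda>m. [trunc_trace q (Suc m) (gen q (u, i) * T) = trunc_trace q (Suc m) (T * gen q (u, i))] (mod int r)) sequentially"
  proof (cases u)
    case True
    have "T * shift_in q i \<in> leavitt q" using T shift_in_leavitt[OF i] mult_leavitt by blast
    from trunc_trace_stable[OF this] show ?thesis
      by eventually_elim (simp add: True gen_def trunc_trace_shift_in[OF i] cong_sym_eq)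
  next
    case False
    have "shift_out q i * T \<in> leavitt q" using T shift_out_leavitt[OF i] mult_leavitt by blast
    from trunc_trace_stable[OF this] show ?thesis
      by eventually_elim (simp add: False gen_def trunc_trace_shift_out[OF i])
  qed
  then show ?thesis
    using eventually_sequentially_Suc[where P = "\<lambda>m. [trunc_trace q m (gen q (u, i) * T) = trunc_trace q m (T * gen q (u, i))] (mod int r)"]
    by blast
qed

lemma trunc_trace_commute:
  assumes S: "S \<in> leavitt q" and T: "T \<in> leavitt q"
  shows "eventually (\<lambda>m. [trunc_trace q m (S * T) = trunc_trace q m (T * S)] (mod int r)) sequentially"
proof -
  \<comment> \<open>\<open>T\<close> is quantified inside the induction because moving the first
    generator around the cycle replaces \<open>T\<close> by \<open>T * gen q g\<close>.\<close>
  have word: "\<forall>T\<in>leavitt q. eventually (\<lambda>m. [trunc_trace q m (word q ws * T) = trunc_trace q m (T * word q ws)] (mod int r)) sequentially"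
    if "ws \<in> lists (UNIV \<times> {..<q})" for ws
    using that
  proof (induction ws)
    case Nil then show ?case by (simp add: word_def)
  next
    case (Cons g ws)
    obtain u i where g: "g = (u, i)" "i < q" using Cons.hyps(1) by auto
    have g_in: "gen q g \<in> leavitt q"
      using g shift_in_leavitt shift_out_leavitt by (auto simp: gen_def)
    show ?case
    proof
      fix T assume T: "T \<in> leavitt q"
      have "eventually (\<lambda>m. [trunc_trace q m (gen q g * (word q ws * T)) = trunc_trace q m ((word q ws * T) * gen q g)] (mod int r)) sequentially"
        unfolding g(1) using Cons.hyps T by (intro trunc_trace_commute_gen g mult_leavitt word_leavitt)
      moreover have "eventually (\<lambda>m. [trunc_trace q m (word q ws * (T * gen q g)) = trunc_trace q m ((T * gen q g) * word q ws)] (mod int r)) sequentially"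
        using Cons.IH mult_leavitt[OF T g_in] by blast
      ultimately have "eventually (\<lambda>m. [trunc_trace q m (gen q g * word q ws * T) = trunc_trace q m (T * (gen q g * word q ws))] (mod int r)) sequentially"
        by eventually_elim (simp add: mult.assoc, metis cong_trans)
      then show "eventually (\<lambda>m. [trunc_trace q m (word q (g # ws) * T) = trunc_trace q m (T * word q (g # ws))] (mod int r)) sequentially"
        by (simp add: word_def)
    qed
  qed
  let ?H = "{S. eventually (\<lambda>m. [trunc_trace q m (S * T) = trunc_trace q m (T * S)] (mod int r)) sequentially}"
  have "add_subgroup ?H"
    unfolding add_subgroup_def
  proof (intro conjI ballI)
    show "0 \<in> ?H" by simp
    fix S S' assume "S \<in> ?H" "S' \<in> ?H"
    then have "eventually (\<lambda>m. [trunc_trace q m (S * T) = trunc_trace q m (T * S)] (mod int r)) sequentially"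
       "eventually (\<lambda>m. [trunc_trace q m (S' * T) = trunc_trace q m (T * S')] (mod int r)) sequentially" by auto
    then have "eventually (\<lambda>m. [trunc_trace q m ((S - S') * T) = trunc_trace q m (T * (S - S'))] (mod int r)) sequentially"
      by eventually_elim (simp only: left_diff_distrib right_diff_distrib additive.diff[OF additive_trunc_trace] cong_diff)
    then show "S - S' \<in> ?H" by simp
  qed
  moreover have "word q ` lists (UNIV \<times> {..<q}) \<subseteq> ?H" using word T by auto
  ultimately show ?thesis using zspan_least[of ?H] S unfolding leavitt_def by blast
qed

end

section \<open>The first uncountable ordinal\<close>

text \<open>\<open>cardSuc natLeq\<close> is a relation on \<open>nat set\<close>; through
  \<open>Rep_w1\<close> this later puts a group of this cardinality on elements of type
  \<open>nat set\<close>.\<close>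

typedef w1 = "Field (cardSuc natLeq)"
  using Field_cardSuc_not_empty[OF natLeq_Card_order] by blast

lemma Well_order_cardSuc_natLeq: "Well_order (cardSuc natLeq)"
  using natLeq_Card_order by (rule cardSuc_Well_order)

instantiation w1 :: wellorder
begin

definition less_eq_w1 :: "w1 \<Rightarrow> w1 \<Rightarrow> bool" where
  "a \<le> b \<longleftrightarrow> (Rep_w1 a, Rep_w1 b) \<in> cardSuc natLeq"

definition less_w1 :: "w1 \<Rightarrow> w1 \<Rightarrow> bool" where
  "a < b \<longleftrightarrow> (Rep_w1 a, Rep_w1 b) \<in> cardSuc natLeq - Id"

instance
proof
  note W = Well_order_cardSuc_natLeq[unfolded order_on_defs]
  have refl: "refl_on (Field (cardSuc natLeq)) (cardSuc natLeq)" and trans: "trans (cardSuc natLeq)"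
    and antisym: "antisym (cardSuc natLeq)" and total: "total_on (Field (cardSuc natLeq)) (cardSuc natLeq)"
    and wf: "wf (cardSuc natLeq - Id)"
    using W by auto
  fix x y z :: w1
  show "x \<le> x" using refl Rep_w1[of x] by (simp add: less_eq_w1_def refl_on_def)
  show "x \<le> y \<Longrightarrow> y \<le> z \<Longrightarrow> x \<le> z" using trans unfolding less_eq_w1_def by (meson transD)
  show anti: "x \<le> y \<Longrightarrow> y \<le> x \<Longrightarrow> x = y"
    using antisym unfolding less_eq_w1_def by (metis Rep_w1_inject antisymD)
  show "x < y \<longleftrightarrow> x \<le> y \<and> \<not> y \<le> x"
    using antisym refl Rep_w1[of x] unfolding less_eq_w1_def less_w1_def refl_on_def by (auto dest: antisymD)
  show "x \<le> y \<or> y \<le> x"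
    using total refl Rep_w1[of x] Rep_w1[of y] unfolding less_eq_w1_def total_on_def refl_on_def
    by (cases "Rep_w1 x = Rep_w1 y") auto
  show "P a" if step: "\<And>x. (\<And>y. y < x \<Longrightarrow> P y) \<Longrightarrow> P x" for P and a :: w1
  proof -
    have "wf (inv_image (cardSuc natLeq - Id) Rep_w1)" using wf by (rule wf_inv_image)
    then show ?thesis
    proof (induction a rule: wf_induct_rule)
      case (less x)
      show ?case by (rule step, rule less) (simp add: less_w1_def inv_image_def)
    qed
  qed
qed

end

lemma card_of_w1: "|UNIV :: w1 set| =o cardSuc natLeq"
proof -
  have "bij_betw Rep_w1 UNIV (Field (cardSuc natLeq))"
    using type_definition.Rep_range[OF type_definition_w1] Rep_w1_inject
    by (auto simp: bij_betw_def inj_on_def)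
  then have "|UNIV :: w1 set| =o |Field (cardSuc natLeq)|" using card_of_ordIso by blast
  also have "|Field (cardSuc natLeq)| =o cardSuc natLeq"
    using cardSuc_Card_order[OF natLeq_Card_order] by (rule card_of_Field_ordIso)
  finally show ?thesis .
qed

lemma countable_lessThan_w1: "countable {..<a :: w1}"
proof -
  have "|underS (cardSuc natLeq) (Rep_w1 a)| <o cardSuc natLeq"
    using card_of_underS[OF cardSuc_Card_order[OF natLeq_Card_order]] Rep_w1 by blast
  then have "|underS (cardSuc natLeq) (Rep_w1 a)| \<le>o natLeq"
    using cardSuc_ordLeq_ordLess[OF natLeq_Card_order card_of_Card_order] by blast
  then have "countable (underS (cardSuc natLeq) (Rep_w1 a))"
    by (simp add: countable_card_le_natLeq)
  moreover have "Rep_w1 ` {..<a} \<subseteq> underS (cardSuc natLeq) (Rep_w1 a)"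
    by (auto simp: underS_def less_w1_def)
  ultimately have "countable (Rep_w1 ` {..<a})" by (rule countable_subset[rotated])
  then show ?thesis by (rule countable_image_inj_on) (auto simp: inj_on_def Rep_w1_inject)
qed

lemma uncountable_w1: "uncountable (UNIV :: w1 set)"
proof
  assume "countable (UNIV :: w1 set)"
  then have "|UNIV :: w1 set| \<le>o natLeq" by (simp add: countable_card_le_natLeq)
  then have "cardSuc natLeq \<le>o natLeq" using card_of_w1 by (metis ordIso_ordLeq_trans ordIso_symmetric)
  moreover have "natLeq <o cardSuc natLeq" using natLeq_Card_order by (rule cardSuc_greater)
  ultimately show False by (simp add: not_ordLess_ordLeq)
qed

text \<open>If \<open>X\<close> were unbounded, the countably many countable initial segments given
  by its elements would cover the uncountable type.\<close>

lemma countable_bounded_w1: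
  fixes X :: "w1 set"
  assumes "countable X"
  shows "\<exists>b. \<forall>x\<in>X. x < b"
proof (rule ccontr)
  assume "\<not> ?thesis"
  then have "\<exists>x\<in>X. b \<le> x" for b by (metis not_le)
  then have "UNIV = (\<Union>x\<in>X. insert x {..<x})" by (auto simp: order_le_less)
  moreover have "countable (\<Union>x\<in>X. insert x {..<x})"
    using assms countable_lessThan_w1 by auto
  ultimately show False using uncountable_w1 by simp
qed

section \<open>The module and its germs at limit stages\<close>

definition ladder :: "w1 \<Rightarrow> (nat \<Rightarrow> w1) \<Rightarrow> bool" where
  "ladder \<delta> \<eta> \<longleftrightarrow> strict_mono \<eta> \<and> (\<forall>l. \<eta> l < \<delta>) \<and> (\<forall>\<beta><\<delta>. \<exists>l. \<beta> < \<eta> l)"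

definition cof_omega :: "w1 set" where
  "cof_omega = {\<delta>. \<exists>\<eta>. ladder \<delta> \<eta>}"

definition lad :: "w1 \<Rightarrow> nat \<Rightarrow> w1" where
  "lad \<delta> = (SOME \<eta>. ladder \<delta> \<eta>)"

lemma ladder_lad: "\<delta> \<in> cof_omega \<Longrightarrow> ladder \<delta> (lad \<delta>)"
  unfolding cof_omega_def lad_def by (simp add: someI_ex)

lemma lad_less: "\<delta> \<in> cof_omega \<Longrightarrow> lad \<delta> l < \<delta>"
  using ladder_lad unfolding ladder_def by blast

lemma lad_strict_mono: "\<delta> \<in> cof_omega \<Longrightarrow> strict_mono (lad \<delta>)"
  using ladder_lad unfolding ladder_def by blast

lemma lad_eq_iff: "\<delta> \<in> cof_omega \<Longrightarrow> lad \<delta> l = lad \<delta> l' \<longleftrightarrow> l = l'"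
  using lad_strict_mono strict_mono_eq by blast

lemma lad_le_iff: "\<delta> \<in> cof_omega \<Longrightarrow> lad \<delta> l \<le> lad \<delta> l' \<longleftrightarrow> l \<le> l'"
  using lad_strict_mono strict_mono_less_eq by blast

lemma lad_cofinal:
  assumes "\<delta> \<in> cof_omega" "\<beta> < \<delta>"
  shows "\<exists>L. \<forall>l\<ge>L. \<beta> < lad \<delta> l"
proof -
  obtain L where "\<beta> < lad \<delta> L" using ladder_lad[OF assms(1)] assms(2) unfolding ladder_def by blast
  then show ?thesis using lad_le_iff[OF assms(1)] by (meson less_le_trans)
qed

lemma finite_bounded_below:
  assumes "\<delta> \<in> cof_omega" "finite X" "\<And>x. x \<in> X \<Longrightarrow> x < \<delta>"
  shows "\<exists>\<beta><\<delta>. \<forall>x\<in>X. x < \<beta>"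
proof (cases "X = {}")
  case True then show ?thesis using lad_less[OF assms(1)] by blast
next
  case False
  then have "Max X < \<delta>" using assms by simp
  then obtain L where "Max X < lad \<delta> L" using lad_cofinal[OF assms(1)] by blast
  then show ?thesis using assms(2) lad_less[OF assms(1)] by (meson Max_ge le_less_trans)
qed

text \<open>Each block of \<open>p\<close> consecutive factors contributes a factor
  \<open>p\<close>. This is the origin of the threshold \<open>n * pr i\<close> in
  \<open>zed\<close>.\<close>

lemma prime_power_dvd_fact:
  fixes p :: nat
  assumes "n * p \<le> l" "p > 0"
  shows "p ^ n dvd fact l"
proof -
  have "p ^ n dvd fact (n * p)"
  proof (induction n)
    case (Suc n)
    have "p dvd (fact p :: nat)" using assms(2) by (simp add: dvd_fact)
    then have "p * p ^ n dvd fact p * fact (n * p)" using Suc by (rule mult_dvd_mono)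
    also have "\<dots> dvd fact (p + n * p)" by (rule fact_fact_dvd_fact)
    finally show ?case by simp
  qed simp
  also have "fact (n * p) dvd (fact l :: nat)" using assms(1) by (rule fact_dvd)
  finally show ?thesis .
qed

section \<open>Bounded functions, restrictions, and the lines indexed by ring elements\<close>

definition below :: "w1 \<Rightarrow> (w1 \<Rightarrow> 'b::zero) \<Rightarrow> bool" where
  "below \<alpha> f \<longleftrightarrow> (\<forall>\<gamma>\<ge>\<alpha>. f \<gamma> = 0)"

definition restr :: "w1 \<Rightarrow> (w1 \<Rightarrow> 'b::zero) \<Rightarrow> w1 \<Rightarrow> 'b" where
  "restr \<alpha> f = (\<lambda>\<gamma>. if \<gamma> < \<alpha> then f \<gamma> else 0)"

lemma below_mono: "below \<alpha> f \<Longrightarrow> \<alpha> \<le> \<beta> \<Longrightarrow> below \<beta> f"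
  unfolding below_def by auto

lemma below_diff: "below \<alpha> f \<Longrightarrow> below \<alpha> g \<Longrightarrow> below \<alpha> (f - g)" for f g :: "w1 \<Rightarrow> 'b::ab_group_add"
  unfolding below_def by auto

lemma below_zero: "below \<alpha> (0 :: w1 \<Rightarrow> 'b::ab_group_add)"
  unfolding below_def by auto

lemma below_restr: "below \<alpha> (restr \<alpha> f)"
  unfolding below_def restr_def by auto

lemma restr_below: "below \<alpha> f \<Longrightarrow> restr \<alpha> f = f"
  unfolding below_def restr_def by (auto simp: fun_eq_iff)

lemma restr_diff: "restr \<alpha> (f - g) = restr \<alpha> f - restr \<alpha> g" for f g :: "w1 \<Rightarrow> 'b::ab_group_add"
  unfolding restr_def by (auto simp: fun_eq_iff)

lemma restr_zero: "restr \<alpha> 0 = (0 :: w1 \<Rightarrow> 'b::ab_group_add)"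
  unfolding restr_def by (auto simp: fun_eq_iff)

definition single :: "w1 \<Rightarrow> 'b \<Rightarrow> w1 \<Rightarrow> 'b::zero" where
  "single \<beta> w = (\<lambda>\<gamma>. if \<gamma> = \<beta> then w else 0)"

text \<open>A pair \<open>(a, b)\<close> is coded as the function with \<open>False \<mapsto> a\<close> and \<open>True \<mapsto> b\<close>; the index \<open>None\<close> stands
  for the second coordinate axis and \<open>Some g\<close> for the graph of right multiplication by \<open>g\<close>.\<close>
definition dir :: "'a::ring_1 option \<Rightarrow> 'a \<Rightarrow> bool \<Rightarrow> 'a" where
  "dir i v = (\<lambda>b. case i of None \<Rightarrow> (if b then v else 0) | Some g \<Rightarrow> (if b then v * g else v))"

text \<open>The equation of the line \<open>dir i\<close>: its kernel is exactly the range of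
  \<open>dir i\<close>, and it is left linear over the ring.\<close>

definition codir :: "'a::ring_1 option \<Rightarrow> (bool \<Rightarrow> 'a) \<Rightarrow> 'a" where
  "codir i w = (case i of None \<Rightarrow> w False | Some g \<Rightarrow> w True - w False * g)"

lemma codir_dir: "codir i (dir i v) = 0"
  unfolding codir_def dir_def by (cases i) auto

lemma additive_codir: "additive (codir i)"
  by unfold_locales (cases i; simp add: codir_def algebra_simps)

text \<open>\<open>ev\<close> is a separating family of integer-valued functionals. It makes the
  ring torsion free and reduced, and it later embeds countable subgroups of \<open>M\<close> in
  groups of integer-valued functions.\<close>

locale ladder_module =
  fixes A :: "'a::ring_1 set" and ev :: "'t \<Rightarrow> 'a \<Rightarrow> int"
    and pr :: "'a option \<Rightarrow> nat" and r :: nat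
  assumes A_sub: "add_subgroup A" and A_one: "1 \<in> A"
    and A_mult: "\<And>a b. a \<in> A \<Longrightarrow> b \<in> A \<Longrightarrow> a * b \<in> A"
    and A_countable: "countable A"
    and ev_additive: "\<And>t. additive (ev t)"
    and ev_separates: "\<And>v. v \<noteq> 0 \<Longrightarrow> \<exists>t. ev t v \<noteq> 0"
    and pr_inj: "inj_on pr (insert None (Some ` A))"
    and pr_prime: "\<And>i. prime (pr i)"
    and pr_coprime: "\<And>i. coprime (pr i) r"
begin

definition "Ind = insert None (Some ` A)"
definition "A2 = {w :: bool \<Rightarrow> 'a. \<forall>b. w b \<in> A}"

definition coef :: "'a option \<Rightarrow> nat \<Rightarrow> nat \<Rightarrow> int" where
  "coef i n l = int (fact l div pr i ^ n)"

text \<open>Up to finitely many entries this is \<open>zed \<delta> i 0 v\<close> divided by \<open>pr i ^ n\<close>; the entries that are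
  dropped have \<open>l < n * pr i\<close>, where \<open>pr i ^ n\<close> need not divide \<open>l!\<close>.\<close>
definition zed :: "w1 \<Rightarrow> 'a option \<Rightarrow> nat \<Rightarrow> 'a \<Rightarrow> w1 \<Rightarrow> bool \<Rightarrow> 'a" where
  "zed \<delta> i n v = (\<lambda>\<beta>. if \<beta> \<in> lad \<delta> ` {n * pr i..}
     then of_int (coef i n (inv_into UNIV (lad \<delta>) \<beta>)) * dir i v else 0)"

definition gens :: "(w1 \<Rightarrow> bool \<Rightarrow> 'a) set" where
  "gens = (\<lambda>(\<beta>, w). single \<beta> w) ` (UNIV \<times> A2) \<union>
          (\<lambda>(\<delta>, i, n, v). zed \<delta> i n v) ` (cof_omega \<times> Ind \<times> UNIV \<times> A)"

definition M :: "(w1 \<Rightarrow> bool \<Rightarrow> 'a) set" where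
  "M = zspan gens"

lemma coef_0: "coef i 0 l = fact l"
  by (simp add: coef_def)

lemma coef_mult:
  assumes "n * pr i \<le> l" shows "int (pr i) ^ n * coef i n l = fact l"
proof -
  have "pr i ^ n dvd fact l"
    by (rule prime_power_dvd_fact[OF assms prime_gt_0_nat[OF pr_prime]])
  then have "pr i ^ n * (fact l div pr i ^ n) = fact l" by (rule dvd_mult_div_cancel)
  then have "int (pr i ^ n * (fact l div pr i ^ n)) = int (fact l)" by (rule arg_cong)
  then show ?thesis unfolding coef_def by (simp only: of_nat_mult of_nat_power of_nat_fact)
qed

lemma zed_lad:
  assumes "\<delta> \<in> cof_omega"
  shows "zed \<delta> i n v (lad \<delta> l) = (if n * pr i \<le> l then of_int (coef i n l) * dir i v else 0)"
proof -
  have "inj (lad \<delta>)" using lad_eq_iff[OF assms] by (auto simp: inj_def)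
  then have "lad \<delta> l \<in> lad \<delta> ` {n * pr i..} \<longleftrightarrow> n * pr i \<le> l"
    using lad_eq_iff[OF assms] by auto
  with \<open>inj (lad \<delta>)\<close> show ?thesis unfolding zed_def by simp
qed

lemma zed_off: "\<gamma> \<notin> range (lad \<delta>) \<Longrightarrow> zed \<delta> i n v \<gamma> = 0"
  unfolding zed_def by auto

lemma zed_below: "\<delta> \<in> cof_omega \<Longrightarrow> below \<delta> (zed \<delta> i n v)"
  unfolding below_def using zed_off lad_less by (metis imageE not_le)

lemma dir_A2: "i \<in> Ind \<Longrightarrow> v \<in> A \<Longrightarrow> dir i v \<in> A2"
  unfolding A2_def dir_def Ind_def using add_subgroup_zero[OF A_sub] A_mult by auto

lemma A2_sub: "add_subgroup A2"
  using A_sub unfolding A2_def add_subgroup_def by auto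

lemma single_gens: "w \<in> A2 \<Longrightarrow> single \<beta> w \<in> gens"
  unfolding gens_def by auto

lemma zed_gens: "\<delta> \<in> cof_omega \<Longrightarrow> i \<in> Ind \<Longrightarrow> v \<in> A \<Longrightarrow> zed \<delta> i n v \<in> gens"
  unfolding gens_def by (intro UnI2 image_eqI[of _ _ "(\<delta>, i, n, v)"]) auto

lemma gens_cases:
  assumes "s \<in> gens"
  obtains (single) \<beta> w where "w \<in> A2" "s = single \<beta> w"
  | (zed) \<delta> i n v where "\<delta> \<in> cof_omega" "i \<in> Ind" "v \<in> A" "s = zed \<delta> i n v"
  using assms unfolding gens_def by auto

lemma M_sub: "add_subgroup M"
  unfolding M_def by (rule add_subgroup_zspan)

lemma gens_M: "s \<in> gens \<Longrightarrow> s \<in> M"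
  unfolding M_def by (rule zspan_base)

lemma M_induct:
  assumes "f \<in> M" "add_subgroup H" "\<And>s. s \<in> gens \<Longrightarrow> s \<in> H"
  shows "f \<in> H"
  using zspan_least[of H gens] assms unfolding M_def by blast

lemma torsion_free:
  assumes "of_int k * v = (0::'a)" "k \<noteq> 0" shows "v = 0"
proof (rule ccontr)
  assume "v \<noteq> 0"
  then obtain t where "ev t v \<noteq> 0" using ev_separates by blast
  moreover have "k * ev t v = 0"
    using additive_of_int_mult[OF ev_additive, of t k v] assms(1) additive.zero[OF ev_additive] by simp
  ultimately show False using assms(2) by simp
qed

text \<open>A functional with \<open>ev t v \<noteq> 0\<close> would give a nonzero integer
  divisible by every power of \<open>p\<close>; the exponent \<open>\<bar>ev t v\<bar>\<close> is
  already too large, since \<open>n < p ^ n\<close>.\<close>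

lemma reduced:
  assumes "\<And>n. \<exists>w. v = of_int (int p ^ n) * w" "p > 1" shows "v = (0::'a)"
proof (rule ccontr)
  assume "v \<noteq> 0"
  then obtain t where t: "ev t v \<noteq> 0" using ev_separates by blast
  define n where "n = nat \<bar>ev t v\<bar>"
  obtain w where "v = of_int (int p ^ n) * w" using assms(1) by blast
  then have "ev t v = int p ^ n * ev t w"
    using additive_of_int_mult[OF ev_additive, of t "int p ^ n" w] by simp
  then have "int p ^ n dvd ev t v" by simp
  then have "int p ^ n \<le> \<bar>ev t v\<bar>" using t by (simp add: zdvd_imp_le zdvd_not_zless)
  moreover have "n < p ^ n" by (rule power_gt_expt) (use assms(2) in simp)
  then have "\<bar>ev t v\<bar> < int p ^ n" unfolding n_def by (metis nat_less_iff abs_ge_zero of_nat_power)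
  ultimately show False by simp
qed

text \<open>The ladder is cofinal in \<delta>, so only finitely many of its points lie below a
  smaller \<alpha>.\<close>

lemma restr_zed_sum:
  assumes \<delta>: "\<delta> \<in> cof_omega" and "\<alpha> < \<delta>"
  shows "\<exists>S. finite S \<and> (\<forall>l\<in>S. lad \<delta> l < \<alpha>) \<and>
    restr \<alpha> (zed \<delta> i n v) = (\<Sum>l\<in>S. single (lad \<delta> l) (of_int (coef i n l) * dir i v))"
proof -
  obtain L where L: "\<And>l. l \<ge> L \<Longrightarrow> \<alpha> < lad \<delta> l" using lad_cofinal[OF assms] by blast
  define S where "S = {l. n * pr i \<le> l \<and> lad \<delta> l < \<alpha>}"
  have "l < L" if "l \<in> S" for l using L[of l] that unfolding S_def by (metis (mono_tags) mem_Collect_eq not_le less_asym)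
  then have fin: "finite S" by (meson finite_nat_iff_bounded lessThan_iff subsetI)
  have "restr \<alpha> (zed \<delta> i n v) \<gamma> = (\<Sum>l\<in>S. single (lad \<delta> l) (of_int (coef i n l) * dir i v)) \<gamma>" for \<gamma>
  proof (cases "\<gamma> \<in> range (lad \<delta>)")
    case True
    then obtain k where k: "\<gamma> = lad \<delta> k" by blast
    have "(\<Sum>l\<in>S. single (lad \<delta> l) (of_int (coef i n l) * dir i v)) \<gamma>
      = (\<Sum>l\<in>S. if k = l then of_int (coef i n l) * dir i v else 0)"
      unfolding sum_fun_apply single_def k lad_eq_iff[OF \<delta>] ..
    also have "\<dots> = (if k \<in> S then of_int (coef i n k) * dir i v else 0)"
      using fin by (rule sum.delta')
    also have "\<dots> = restr \<alpha> (zed \<delta> i n v) \<gamma>"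
      unfolding k restr_def zed_lad[OF \<delta>] S_def by auto
    finally show ?thesis ..
  next
    case False
    then have "(\<Sum>l\<in>S. single (lad \<delta> l) (of_int (coef i n l) * dir i v)) \<gamma> = 0"
      by (subst sum_fun_apply, intro sum.neutral) (auto simp: single_def)
    then show ?thesis using zed_off[OF False] unfolding restr_def by simp
  qed
  then show ?thesis using fin unfolding S_def by (intro exI[of _ S]) (auto simp: S_def)
qed

text \<open>The top \<delta> = \<alpha> is included because \<open>zed \<alpha>\<close> is supported
  strictly below \<alpha>.\<close>

definition gens_upto :: "w1 \<Rightarrow> (w1 \<Rightarrow> bool \<Rightarrow> 'a) set" where
  "gens_upto \<alpha> = (\<lambda>(\<beta>, w). single \<beta> w) ` ({..<\<alpha>} \<times> A2) \<union>
          (\<lambda>(\<delta>, i, n, v). zed \<delta> i n v) ` ((cof_omega \<inter> {..\<alpha>}) \<times> Ind \<times> UNIV \<times> A)"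

lemma gens_upto_subset: "gens_upto \<alpha> \<subseteq> gens"
  unfolding gens_upto_def gens_def by blast

lemma countable_gens_upto: "countable (gens_upto \<alpha>)"
proof -
  have "countable A2"
  proof (rule countable_subset)
    show "A2 \<subseteq> (\<lambda>(a, b) c. if c then a else b) ` (A \<times> A)"
      unfolding A2_def
      by (auto simp: fun_eq_iff image_iff split: if_splits) (metis (full_types))
  qed (use A_countable in auto)
  moreover have "countable (cof_omega \<inter> {..\<alpha>})"
  proof (rule countable_subset)
    show "cof_omega \<inter> {..\<alpha>} \<subseteq> insert \<alpha> {..<\<alpha>}" by auto
  qed (use countable_lessThan_w1 in auto)
  ultimately show ?thesis
    unfolding gens_upto_def Ind_def using A_countable countable_lessThan_w1
    by (intro countable_Un countable_image countable_SIGMA) auto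
qed

text \<open>The reason for separability: cutting a generator at \<alpha> leaves it unchanged, kills
  it, or turns it into a finite sum of one-point functions. It yields both that restriction maps
  \<open>M\<close> into itself and that the part of \<open>M\<close> below \<alpha> is
  countable.\<close>

lemma restr_M_zspan:
  assumes "f \<in> M" shows "restr \<alpha> f \<in> zspan (gens_upto \<alpha>)"
proof -
  have "f \<in> {f. restr \<alpha> f \<in> zspan (gens_upto \<alpha>)}"
    using assms
  proof (rule M_induct)
    show "add_subgroup {f. restr \<alpha> f \<in> zspan (gens_upto \<alpha>)}"
      using add_subgroup_zspan[of "gens_upto \<alpha>"] unfolding add_subgroup_def
      by (auto simp: restr_diff restr_zero)
    fix s assume "s \<in> gens"
    then have "restr \<alpha> s \<in> zspan (gens_upto \<alpha>)"
    proof (cases rule: gens_cases)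
      case (single \<beta> w)
      show ?thesis
      proof (cases "\<beta> < \<alpha>")
        case True
        then have "restr \<alpha> s = s" unfolding single restr_def single_def by auto
        moreover have "s \<in> gens_upto \<alpha>" unfolding gens_upto_def using single True by auto
        ultimately show ?thesis using zspan_base by simp
      next
        case False
        then have "restr \<alpha> s = 0" unfolding single restr_def single_def by (auto simp: fun_eq_iff)
        then show ?thesis using zspan_zero by simp
      qed
    next
      case (zed \<delta> i n v)
      show ?thesis
      proof (cases "\<delta> \<le> \<alpha>")
        case True
        then have "restr \<alpha> s = s" using zed restr_below below_mono zed_below by metis
        moreover have "s \<in> gens_upto \<alpha>" unfolding gens_upto_def zed
          by (rule UnI2, rule image_eqI[of _ _ "(\<delta>, i, n, v)"]) (use zed True in auto)
        ultimately show ?thesis using zspan_base by simp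
      next
        case False
        then obtain S where S: "\<And>l. l \<in> S \<Longrightarrow> lad \<delta> l < \<alpha>"
          "restr \<alpha> s = (\<Sum>l\<in>S. single (lad \<delta> l) (of_int (coef i n l) * dir i v))"
          using restr_zed_sum[OF zed(1), of \<alpha> i n v] unfolding zed by (meson not_le)
        have "single (lad \<delta> l) (of_int (coef i n l) * dir i v) \<in> gens_upto \<alpha>" if "l \<in> S" for l
          unfolding gens_upto_def using S(1)[OF that] zed dir_A2
          by (intro UnI1 image_eqI[of _ _ "(lad \<delta> l, of_int (coef i n l) * dir i v)"])
            (auto intro: add_subgroup_of_int_mult[OF A2_sub])
        then show ?thesis unfolding S(2) by (intro add_subgroup_sum add_subgroup_zspan zspan_base) auto
      qed
    qed
    then show "s \<in> {f. restr \<alpha> f \<in> zspan (gens_upto \<alpha>)}" by simp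
  qed
  then show ?thesis by simp
qed

lemma restr_M: "f \<in> M \<Longrightarrow> restr \<alpha> f \<in> M"
  using restr_M_zspan zspan_least[OF M_sub, of "gens_upto \<alpha>"] gens_upto_subset gens_M by blast

lemma countable_M_below: "countable {f \<in> M. below \<alpha> f}"
proof (rule countable_subset)
  show "{f \<in> M. below \<alpha> f} \<subseteq> zspan (gens_upto \<alpha>)"
    using restr_M_zspan restr_below by (metis (mono_tags) mem_Collect_eq subsetI)
  show "countable (zspan (gens_upto \<alpha>))" by (rule countable_zspan[OF countable_gens_upto])
qed

lemma M_below:
  assumes "f \<in> M" shows "\<exists>\<alpha>. below \<alpha> f"
proof -
  have "f \<in> {f. \<exists>\<alpha>. below \<alpha> f}"
    using assms
  proof (rule M_induct)
    show "add_subgroup {f :: w1 \<Rightarrow> bool \<Rightarrow> 'a. \<exists>\<alpha>. below \<alpha> f}"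
      unfolding add_subgroup_def
    proof (intro conjI ballI)
      fix f g :: "w1 \<Rightarrow> bool \<Rightarrow> 'a" assume "f \<in> {f. \<exists>\<alpha>. below \<alpha> f}" "g \<in> {f. \<exists>\<alpha>. below \<alpha> f}"
      then obtain \<alpha> \<beta> where "below \<alpha> f" "below \<beta> g" by blast
      then have "below (max \<alpha> \<beta>) (f - g)" by (intro below_diff) (auto intro: below_mono)
      then show "f - g \<in> {f. \<exists>\<alpha>. below \<alpha> f}" by blast
    qed (auto intro: below_zero)
    fix s assume "s \<in> gens"
    then show "s \<in> {f. \<exists>\<alpha>. below \<alpha> f}"
    proof (cases rule: gens_cases)
      case (single \<beta> w)
      obtain \<alpha> where "\<beta> < \<alpha>" using countable_bounded_w1[of "{\<beta>}"] by auto
      then have "below \<alpha> s" unfolding single below_def single_def by auto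
      then show ?thesis by blast
    next
      case (zed \<delta> i n v) then show ?thesis using zed_below by blast
    qed
  qed
  then show ?thesis by simp
qed

section \<open>Germs just below a limit stage\<close>

definition vanishes_near :: "w1 \<Rightarrow> (w1 \<Rightarrow> bool \<Rightarrow> 'a) \<Rightarrow> bool" where
  "vanishes_near \<delta> f \<longleftrightarrow> (\<exists>\<beta><\<delta>. \<forall>\<gamma>. \<beta> \<le> \<gamma> \<longrightarrow> \<gamma> < \<delta> \<longrightarrow> f \<gamma> = 0)"

text \<open>Just below \<delta> only the generators with top \<delta> are visible: a smaller top
  bounds the support, and a ladder with a larger top has finitely many points below
  \<delta>.\<close>

lemma gens_near:
  assumes s: "s \<in> gens" and \<delta>: "\<delta> \<in> cof_omega"
  shows "vanishes_near \<delta> s \<or> (\<exists>i n v. i \<in> Ind \<and> v \<in> A \<and> s = zed \<delta> i n v)"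
  using s
proof (cases rule: gens_cases)
  case (single \<beta> w)
  \<comment> \<open>The point \<beta> may also lie at or above \<delta>, where it does not affect
    the germ.\<close>
  have "finite ({\<beta>} \<inter> {..<\<delta>})" by auto
  then obtain \<beta>' where b: "\<beta>' < \<delta>" "\<forall>x\<in>{\<beta>} \<inter> {..<\<delta>}. x < \<beta>'"
    using finite_bounded_below[OF \<delta>] by (metis Int_iff lessThan_iff)
  then have "\<forall>\<gamma>. \<beta>' \<le> \<gamma> \<longrightarrow> \<gamma> < \<delta> \<longrightarrow> s \<gamma> = 0"
    unfolding single single_def by (auto simp: not_le[symmetric])
  then show ?thesis using b(1) unfolding vanishes_near_def by blast
next
  case (zed \<delta>' i n v)
  consider "\<delta>' < \<delta>" | "\<delta>' = \<delta>" | "\<delta> < \<delta>'" by (rule linorder_cases)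
  then show ?thesis
  proof cases
    case 1
    then show ?thesis using zed_below[OF zed(1), of i n v] unfolding zed vanishes_near_def below_def by blast
  next
    case 2 then show ?thesis using zed by blast
  next
    case 3
    obtain S where S: "finite S" "restr \<delta> s = (\<Sum>l\<in>S. single (lad \<delta>' l) (of_int (coef i n l) * dir i v))"
        "\<forall>l\<in>S. lad \<delta>' l < \<delta>"
      using restr_zed_sum[OF zed(1) 3, of i n v] unfolding zed by blast
    obtain \<beta> where b: "\<beta> < \<delta>" "\<forall>x\<in>lad \<delta>' ` S. x < \<beta>"
      using finite_bounded_below[OF \<delta>, of "lad \<delta>' ` S"] S(1,3) by auto
    have "s \<gamma> = 0" if g: "\<beta> \<le> \<gamma>" "\<gamma> < \<delta>" for \<gamma>
    proof -
      have "s \<gamma> = restr \<delta> s \<gamma>" using g unfolding restr_def by simp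
      also have "\<dots> = 0"
        unfolding S(2) using b(2) g(1)
        by (subst sum_fun_apply, intro sum.neutral) (auto simp: single_def)
      finally show ?thesis .
    qed
    then show ?thesis using b(1) unfolding vanishes_near_def by blast
  qed
qed

text \<open>Hence near \<delta> an element of \<open>M\<close> is known from its values on the
  ladder; \<open>near_zed\<close> relies on this.\<close>

lemma off_ladder:
  assumes "f \<in> M" and \<delta>: "\<delta> \<in> cof_omega"
  shows "\<exists>\<beta><\<delta>. \<forall>\<gamma>. \<beta> \<le> \<gamma> \<longrightarrow> \<gamma> < \<delta> \<longrightarrow> \<gamma> \<notin> range (lad \<delta>) \<longrightarrow> f \<gamma> = 0"
proof -
  let ?H = "{f :: w1 \<Rightarrow> bool \<Rightarrow> 'a. \<exists>\<beta><\<delta>. \<forall>\<gamma>. \<beta> \<le> \<gamma> \<longrightarrow> \<gamma> < \<delta> \<longrightarrow> \<gamma> \<notin> range (lad \<delta>) \<longrightarrow> f \<gamma> = 0}"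
  have "f \<in> ?H"
    using assms(1)
  proof (rule M_induct)
    show "add_subgroup ?H"
      unfolding add_subgroup_def
    proof (intro conjI ballI)
      show "0 \<in> ?H" using lad_less[OF \<delta>] by auto
      fix f g assume "f \<in> ?H" "g \<in> ?H"
      then obtain \<beta> \<beta>' where b: "\<beta> < \<delta>" "\<forall>\<gamma>. \<beta> \<le> \<gamma> \<longrightarrow> \<gamma> < \<delta> \<longrightarrow> \<gamma> \<notin> range (lad \<delta>) \<longrightarrow> f \<gamma> = 0"
        "\<beta>' < \<delta>" "\<forall>\<gamma>. \<beta>' \<le> \<gamma> \<longrightarrow> \<gamma> < \<delta> \<longrightarrow> \<gamma> \<notin> range (lad \<delta>) \<longrightarrow> g \<gamma> = 0" by blast
      then have "max \<beta> \<beta>' < \<delta>" "\<forall>\<gamma>. max \<beta> \<beta>' \<le> \<gamma> \<longrightarrow> \<gamma> < \<delta> \<longrightarrow> \<gamma> \<notin> range (lad \<delta>) \<longrightarrow> (f - g) \<gamma> = 0"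
        by auto
      then show "f - g \<in> ?H" by blast
    qed
    fix s assume "s \<in> gens"
    then consider "vanishes_near \<delta> s" | i n v where "s = zed \<delta> i n v" using gens_near[OF _ \<delta>] by blast
    then show "s \<in> ?H"
    proof cases
      case 1 then show ?thesis unfolding vanishes_near_def by blast
    next
      case 2
      have "lad \<delta> 0 < \<delta>" using lad_less[OF \<delta>] .
      then show ?thesis unfolding 2 using zed_off by blast
    qed
  qed
  then show ?thesis by simp
qed

text \<open>Denominators come only from the powers of \<open>pr j\<close> in generators with
  direction \<open>j\<close>, and a direction killed by \<open>\<Lambda>\<close> contributes none.
  There are two uses: \<open>\<Lambda> = codir i\<close> with \<open>t = pr i\<close>, where the
  dangerous direction is killed, and the first coordinate with \<open>t = r\<close>, where all
  primes are coprime to \<open>t\<close>.\<close>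

lemma germ:
  fixes \<Lambda> :: "(bool \<Rightarrow> 'a) \<Rightarrow> 'b::ring_1" and t :: int
  assumes "f \<in> M" and \<delta>: "\<delta> \<in> cof_omega" and \<Lambda>: "additive \<Lambda>"
    and t: "\<And>j. j \<in> Ind \<Longrightarrow> (\<forall>v. \<Lambda> (dir j v) = 0) \<or> coprime (int (pr j)) t"
  shows "\<exists>N w. N > 0 \<and> coprime N t \<and> w \<in> A2 \<and>
    (\<exists>L. \<forall>l\<ge>L. of_int N * \<Lambda> (f (lad \<delta> l)) = of_int (fact l) * \<Lambda> w)"
proof -
  let ?H = "{f. \<exists>N w. N > 0 \<and> coprime N t \<and> w \<in> A2 \<and>
    (\<exists>L. \<forall>l\<ge>L. of_int N * \<Lambda> (f (lad \<delta> l)) = of_int (fact l) * \<Lambda> w)}"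
  have zero: "f \<in> ?H" if "\<exists>L. \<forall>l\<ge>L. \<Lambda> (f (lad \<delta> l)) = 0" for f
    using that additive.zero[OF \<Lambda>] add_subgroup_zero[OF A2_sub]
    by (intro CollectI exI[of _ 1] exI[of _ 0]) auto
  have "f \<in> ?H"
    using assms(1)
  proof (rule M_induct)
    show "add_subgroup ?H"
      unfolding add_subgroup_def
    proof (intro conjI ballI)
      show "0 \<in> ?H" using zero[of 0] additive.zero[OF \<Lambda>] by simp
      fix f g assume "f \<in> ?H" "g \<in> ?H"
      then obtain N w L N' w' L' where
        f: "N > 0" "coprime N t" "w \<in> A2" "\<And>l. l \<ge> L \<Longrightarrow> of_int N * \<Lambda> (f (lad \<delta> l)) = of_int (fact l) * \<Lambda> w"
        and g: "N' > 0" "coprime N' t" "w' \<in> A2" "\<And>l. l \<ge> L' \<Longrightarrow> of_int N' * \<Lambda> (g (lad \<delta> l)) = of_int (fact l) * \<Lambda> w'"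
        by blast
      define u where "u = of_int N' * w - of_int N * w'"
      have "of_int (N * N') * \<Lambda> ((f - g) (lad \<delta> l)) = of_int (fact l) * \<Lambda> u" if "l \<ge> max L L'" for l
      proof -
        have "of_int (N * N') * \<Lambda> ((f - g) (lad \<delta> l)) =
            of_int N' * (of_int N * \<Lambda> (f (lad \<delta> l))) - of_int N * (of_int N' * \<Lambda> (g (lad \<delta> l)))"
          by (simp add: additive.diff[OF \<Lambda>] right_diff_distrib flip: mult.assoc of_int_mult)
            (simp add: mult.commute)
        also have "\<dots> = of_int N' * (of_int (fact l) * \<Lambda> w) - of_int N * (of_int (fact l) * \<Lambda> w')"
          using f(4) g(4) that by simp
        also have "\<dots> = of_int (fact l) * (of_int N' * \<Lambda> w - of_int N * \<Lambda> w')"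
          by (simp only: right_diff_distrib mult.assoc[symmetric] of_int_mult[symmetric] mult.commute)
        also have "\<dots> = of_int (fact l) * \<Lambda> u"
          unfolding u_def by (simp only: additive.diff[OF \<Lambda>] additive_of_int_mult[OF \<Lambda>])
        finally show ?thesis .
      qed
      then have "\<exists>L. \<forall>l\<ge>L. of_int (N * N') * \<Lambda> ((f - g) (lad \<delta> l)) = of_int (fact l) * \<Lambda> u"
        by blast
      moreover have "u \<in> A2" unfolding u_def
        using f(3) g(3) A2_sub by (intro add_subgroup_diff add_subgroup_of_int_mult)
      moreover have "N * N' > 0" "coprime (N * N') t" using f(1,2) g(1,2) by simp_all
      ultimately show "f - g \<in> ?H" by blast
    qed
    fix s assume "s \<in> gens"
    then consider "vanishes_near \<delta> s" | i n v where "i \<in> Ind" "v \<in> A" "s = zed \<delta> i n v"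
      using gens_near[OF _ \<delta>] by blast
    then show "s \<in> ?H"
    proof cases
      case 1
      then obtain \<beta> where b: "\<beta> < \<delta>" "\<And>\<gamma>. \<beta> \<le> \<gamma> \<Longrightarrow> \<gamma> < \<delta> \<Longrightarrow> s \<gamma> = 0"
        unfolding vanishes_near_def by blast
      obtain L where "\<forall>l\<ge>L. \<beta> < lad \<delta> l" using lad_cofinal[OF \<delta> b(1)] by blast
      then have "\<forall>l\<ge>L. \<Lambda> (s (lad \<delta> l)) = 0"
        using b(2) lad_less[OF \<delta>] additive.zero[OF \<Lambda>] by (simp add: order_less_imp_le)
      then show ?thesis using zero by blast
    next
      case 2
      show ?thesis
      proof (cases "\<forall>v. \<Lambda> (dir i v) = 0")
        case True
        then have "\<Lambda> (s (lad \<delta> l)) = 0" for l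
          unfolding 2 zed_lad[OF \<delta>] using additive.zero[OF \<Lambda>] additive_of_int_mult[OF \<Lambda>] by simp
        then show ?thesis using zero by blast
      next
        case False
        then have "coprime (int (pr i)) t" using t 2 by blast
        then have "coprime (int (pr i) ^ n) t" by simp
        moreover have "of_int (int (pr i) ^ n) * \<Lambda> (s (lad \<delta> l)) = of_int (fact l) * \<Lambda> (dir i v)"
          if "l \<ge> n * pr i" for l
        proof -
          have "of_int (int (pr i) ^ n) * \<Lambda> (s (lad \<delta> l)) = of_int (int (pr i) ^ n * coef i n l) * \<Lambda> (dir i v)"
            unfolding 2 zed_lad[OF \<delta>] using that additive_of_int_mult[OF \<Lambda>] by (simp add: mult.assoc)
          then show ?thesis unfolding coef_mult[OF that] .
        qed
        moreover have "int (pr i) ^ n > 0" using prime_gt_0_nat[OF pr_prime] by simp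
        ultimately show ?thesis using dir_A2[OF 2(1,2)]
          by (intro CollectI exI[of _ "int (pr i) ^ n"] exI[of _ "dir i v"]) blast
      qed
    qed
  qed
  then show ?thesis by simp
qed

end

section \<open>Homomorphisms at a closed stage\<close>

lemma of_int_scale: "of_int a * (of_int b * x) = of_int (a * b) * (x :: 'a::ring_1)"
  by (simp add: mult.assoc)

section \<open>Partial homomorphisms and tuples\<close>

definition hom_on :: "'a::ab_group_add set \<Rightarrow> ('a \<Rightarrow> 'b::ab_group_add) \<Rightarrow> bool" where
  "hom_on H F \<longleftrightarrow> (\<forall>x\<in>H. \<forall>y\<in>H. F (x + y) = F x + F y)"

lemma hom_on_zero: "add_subgroup H \<Longrightarrow> hom_on H F \<Longrightarrow> F 0 = 0"
  using add_subgroup_zero unfolding hom_on_def by fastforce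

lemma hom_on_diff:
  assumes "add_subgroup H" "hom_on H F" "x \<in> H" "y \<in> H"
  shows "F (x - y) = F x - F y"
proof -
  have "x - y \<in> H" using assms by (simp add: add_subgroup_diff)
  then have "F (x - y + y) = F (x - y) + F y" using assms unfolding hom_on_def by blast
  then show ?thesis by simp
qed

lemma hom_on_sum:
  assumes "add_subgroup H" "hom_on H F" "\<And>i. i \<in> I \<Longrightarrow> f i \<in> H"
  shows "F (sum f I) = (\<Sum>i\<in>I. F (f i))"
  using assms(3)
proof (induction I rule: infinite_finite_induct)
  case (insert i I)
  then have "sum f I \<in> H" using assms(1) by (intro add_subgroup_sum) auto
  then show ?case using insert assms(2) by (simp add: hom_on_def)
qed (use hom_on_zero[OF assms(1,2)] in auto)

lemma hom_on_of_int_mult: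
  fixes F :: "'a::ring_1 \<Rightarrow> 'b::ring_1"
  assumes H: "add_subgroup H" "hom_on H F" "x \<in> H"
  shows "F (of_int k * x) = of_int k * F x"
proof -
  have nat: "F (of_int (int n) * x) = of_int (int n) * F x" for n
  proof (induction n)
    case 0 then show ?case using hom_on_zero[OF H(1,2)] by simp
  next
    case (Suc n)
    have "F (of_int (int n) * x + x) = F (of_int (int n) * x) + F x"
      using H add_subgroup_of_int_mult[OF H(1,3)] unfolding hom_on_def by blast
    then show ?case using Suc by (simp add: algebra_simps)
  qed
  show ?thesis
  proof (cases k rule: int_cases2)
    case (nonneg n) then show ?thesis using nat by simp
  next
    case (nonpos n)
    have "F (0 - of_int (int n) * x) = F 0 - F (of_int (int n) * x)"
      by (rule hom_on_diff[OF H(1,2) add_subgroup_zero[OF H(1)] add_subgroup_of_int_mult[OF H(1,3)]])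
    then show ?thesis using nat hom_on_zero[OF H(1,2)] nonpos by simp
  qed
qed

definition add_iso :: "'a::ab_group_add set \<Rightarrow> 'b::ab_group_add set \<Rightarrow> bool" where
  "add_iso S T \<longleftrightarrow> (\<exists>F. bij_betw F S T \<and> hom_on S F)"

text \<open>Tuples of every length share one type, padded with 0, so that addition is pointwise and
  maps between different lengths are ordinary functions.\<close>

definition tup :: "nat \<Rightarrow> 'b::zero set \<Rightarrow> (nat \<Rightarrow> 'b) set" where
  "tup m S = {t. (\<forall>j<m. t j \<in> S) \<and> (\<forall>j\<ge>m. t j = 0)}"

definition emb :: "nat \<Rightarrow> 'b \<Rightarrow> nat \<Rightarrow> 'b::zero" where
  "emb j f = (\<lambda>i. if i = j then f else 0)"

lemma add_subgroup_tup: "add_subgroup S \<Longrightarrow> add_subgroup (tup m S)"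
  unfolding tup_def add_subgroup_def by auto

lemma emb_tup: "j < m \<Longrightarrow> f \<in> S \<Longrightarrow> add_subgroup S \<Longrightarrow> emb j f \<in> tup m S"
  unfolding tup_def emb_def by (auto intro: add_subgroup_zero)

lemma tup_mono: "S \<subseteq> T \<Longrightarrow> tup m S \<subseteq> tup m T"
  unfolding tup_def by auto

lemma tup_nth: "t \<in> tup m S \<Longrightarrow> j < m \<Longrightarrow> t j \<in> S"
  unfolding tup_def by auto

lemma countable_tup: "countable S \<Longrightarrow> countable (tup m S)"
proof (rule countable_subset)
  show "tup m S \<subseteq> (\<lambda>xs j. if j < length xs then xs ! j else 0) ` lists S"
  proof
    fix t assume "t \<in> tup m S"
    then show "t \<in> (\<lambda>xs j. if j < length xs then xs ! j else 0) ` lists S"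
      by (intro image_eqI[of _ _ "map t [0..<m]"]) (auto simp: tup_def fun_eq_iff)
  qed
  show "countable S \<Longrightarrow> countable ((\<lambda>xs j. if j < length xs then xs ! j else (0::'a)) ` lists S)"
    by (intro countable_image countable_lists)
qed

lemma sum_emb: "(\<Sum>l<k. emb l (f l)) = (\<lambda>l. if l < k then f l else (0 :: 'b::comm_monoid_add))"
proof
  fix x
  have "(\<Sum>l<k. emb l (f l)) x = (\<Sum>l<k. if x = l then f l else 0)"
    by (simp add: sum_fun_apply emb_def)
  also have "\<dots> = (if x \<in> {..<k} then f x else 0)" by (rule sum.delta') simp
  finally show "(\<Sum>l<k. emb l (f l)) x = (if x < k then f x else 0)" by simp
qed

section \<open>Elements of infinite height modulo bounded functions\<close>

context ladder_module
begin

text \<open>The bound is strictly below \<delta>: for \<delta> in \<open>cof_omega\<close> and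
  nonzero \<open>v\<close>, the function \<open>zed \<delta> i 0 v\<close> satisfies
  \<open>below \<delta>\<close> but stays outside this set.\<close>

definition Nd :: "w1 \<Rightarrow> (w1 \<Rightarrow> bool \<Rightarrow> 'a) set" where
  "Nd \<delta> = {f \<in> M. \<exists>\<beta><\<delta>. below \<beta> f}"

text \<open>Elements of infinite \<open>pr i\<close>-height modulo \<open>Nd \<delta>\<close>. The
  condition uses only addition, so homomorphisms that respect \<open>M\<close> and
  \<open>Nd \<delta>\<close> preserve it.\<close>

definition D :: "'a option \<Rightarrow> w1 \<Rightarrow> (w1 \<Rightarrow> bool \<Rightarrow> 'a) set" where
  "D i \<delta> = {f \<in> M. \<forall>n. \<exists>g\<in>M. f - of_int (int (pr i) ^ n) * g \<in> Nd \<delta>}"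

lemma Nd_sub: "\<delta> \<in> cof_omega \<Longrightarrow> add_subgroup (Nd \<delta>)"
  unfolding add_subgroup_def
proof (intro conjI ballI)
  assume \<delta>: "\<delta> \<in> cof_omega"
  show "0 \<in> Nd \<delta>"
    unfolding Nd_def using add_subgroup_zero[OF M_sub] below_zero lad_less[OF \<delta>] by blast
  fix f g assume "f \<in> Nd \<delta>" "g \<in> Nd \<delta>"
  then obtain \<alpha> \<beta> where "f \<in> M" "g \<in> M" "\<alpha> < \<delta>" "\<beta> < \<delta>" "below \<alpha> f" "below \<beta> g"
    unfolding Nd_def by blast
  then have "f - g \<in> M" "max \<alpha> \<beta> < \<delta>" "below (max \<alpha> \<beta>) (f - g)"
    using M_sub
    by (auto intro: add_subgroup_diff intro!: below_diff[OF below_mono[of \<alpha>] below_mono[of \<beta>]])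
  then show "f - g \<in> Nd \<delta>" unfolding Nd_def by blast
qed

lemma Nd_lad:
  assumes "f \<in> Nd \<delta>" "\<delta> \<in> cof_omega"
  shows "eventually (\<lambda>l. f (lad \<delta> l) = 0) sequentially"
proof -
  obtain \<beta> where b: "\<beta> < \<delta>" "below \<beta> f" using assms(1) unfolding Nd_def by blast
  then obtain L where "\<forall>l\<ge>L. \<beta> < lad \<delta> l" using lad_cofinal[OF assms(2)] by blast
  then have "\<forall>l\<ge>L. f (lad \<delta> l) = 0" using b(2) unfolding below_def by (simp add: order_less_imp_le)
  then show ?thesis unfolding eventually_sequentially by blast
qed

text \<open>From \<delta> on the correction terms in \<open>Nd \<delta>\<close> vanish, so the
  values of \<open>f\<close> there are divisible by all powers of \<open>pr i\<close>, hence zero by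
  \<open>reduced\<close>.\<close>

lemma D_below:
  assumes "f \<in> D i \<delta>" shows "below \<delta> f"
  unfolding below_def
proof (intro allI impI ext)
  fix \<gamma> b assume g: "\<delta> \<le> \<gamma>"
  have "f \<gamma> b = 0"
  proof (rule reduced)
    show "pr i > 1" using pr_prime prime_gt_1_nat by blast
    fix n
    obtain h where "f - of_int (int (pr i) ^ n) * h \<in> Nd \<delta>" using assms unfolding D_def by blast
    then obtain \<beta> where "\<beta> < \<delta>" "below \<beta> (f - of_int (int (pr i) ^ n) * h)" unfolding Nd_def by blast
    then have "(f - of_int (int (pr i) ^ n) * h) \<gamma> = 0" using g unfolding below_def by auto
    from fun_cong[OF this, of b] have "f \<gamma> b = of_int (int (pr i) ^ n) * h \<gamma> b" by simp
    then show "\<exists>w. f \<gamma> b = of_int (int (pr i) ^ n) * w" by blast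
  qed
  then show "f \<gamma> b = 0 b" by simp
qed

text \<open>Modulo \<open>Nd \<delta>\<close>, \<open>f\<close> is \<open>p ^ n\<close> times some
  \<open>g\<close>, where \<open>p = pr i\<close>. After \<open>codir i\<close> the denominator of
  the germ of \<open>g\<close> is prime to \<open>p\<close>, since direction \<open>i\<close> is
  killed and the other directions have other primes. So the germ \<open>codir i w\<close> is
  divisible by \<open>p ^ n\<close> for all \<open>n\<close> and vanishes.\<close>

lemma D_codir:
  assumes f: "f \<in> D i \<delta>" and i: "i \<in> Ind" and \<delta>: "\<delta> \<in> cof_omega"
  shows "eventually (\<lambda>l. codir i (f (lad \<delta> l)) = 0) sequentially"
proof -
  let ?p = "int (pr i)"
  have t: "(\<forall>v. codir i (dir j v) = 0) \<or> coprime (int (pr j)) ?p" if "j \<in> Ind" for j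
  proof (cases "j = i")
    case True then show ?thesis by (simp add: codir_dir)
  next
    case False
    then have "pr j \<noteq> pr i" using inj_onD[OF pr_inj, of j i] i that unfolding Ind_def by blast
    then have "coprime (pr j) (pr i)" using pr_prime primes_coprime by blast
    then show ?thesis by (simp add: coprime_int_iff)
  qed
  note scale = additive_of_int_mult[OF additive_codir]
  have fM: "f \<in> M" using f unfolding D_def by blast
  obtain N w L where N: "N > 0" "\<And>l. l \<ge> L \<Longrightarrow> of_int N * codir i (f (lad \<delta> l)) = of_int (fact l) * codir i w"
    using germ[OF fM \<delta> additive_codir t] by blast
  have "codir i w = 0"
  proof (rule reduced)
    show "pr i > 1" using pr_prime prime_gt_1_nat by blast
    fix n
    obtain g where g: "g \<in> M" "f - of_int (?p ^ n) * g \<in> Nd \<delta>" using f unfolding D_def by blast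
    obtain N' w' L' where N': "coprime N' ?p"
      "\<And>l. l \<ge> L' \<Longrightarrow> of_int N' * codir i (g (lad \<delta> l)) = of_int (fact l) * codir i w'"
      using germ[OF g(1) \<delta> additive_codir t] by blast
    obtain L'' where L'': "\<And>l. l \<ge> L'' \<Longrightarrow> (f - of_int (?p ^ n) * g) (lad \<delta> l) = 0"
      using Nd_lad[OF g(2) \<delta>] unfolding eventually_sequentially by blast
    \<comment> \<open>One ladder point beyond all three thresholds is enough: there the germs of
      \<open>f\<close> and \<open>g\<close> can be compared, and the common factor \<open>l!\<close>
      is cancelled.\<close>
    define l where "l = max L (max L' L'')"
    have "f (lad \<delta> l) = of_int (?p ^ n) * g (lad \<delta> l)"
      using L''[of l] unfolding l_def by (simp add: fun_eq_iff)
    then have cf: "codir i (f (lad \<delta> l)) = of_int (?p ^ n) * codir i (g (lad \<delta> l))"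
      using scale by metis
    have "of_int (fact l) * (of_int N' * codir i w) = of_int N' * (of_int (fact l) * codir i w)"
      by (simp only: of_int_scale mult.commute)
    also have "\<dots> = of_int N' * (of_int N * codir i (f (lad \<delta> l)))"
      using N(2)[of l] unfolding l_def by simp
    also have "\<dots> = of_int (N * ?p ^ n) * (of_int N' * codir i (g (lad \<delta> l)))"
      unfolding cf by (simp only: of_int_scale mult.assoc mult.commute mult.left_commute)
    also have "\<dots> = of_int (N * ?p ^ n) * (of_int (fact l) * codir i w')"
      using N'(2)[of l] unfolding l_def by simp
    also have "\<dots> = of_int (fact l) * (of_int (N * ?p ^ n) * codir i w')"
      by (simp only: of_int_scale mult.commute)
    finally have z: "of_int (fact l) * (of_int N' * codir i w - of_int (N * ?p ^ n) * codir i w') = 0"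
      by (simp only: right_diff_distrib) simp
    have eq: "of_int N' * codir i w = of_int (N * ?p ^ n) * codir i w'"
      using torsion_free[OF z fact_nonzero] by (simp only: right_minus_eq)
    have "coprime N' (?p ^ n)" using N'(1) by simp
    \<comment> \<open>Bezout removes the factor \<open>N'\<close>: divisibility of
      \<open>N' * codir i w\<close> by \<open>p ^ n\<close> passes to
      \<open>codir i w\<close>.\<close>
    then obtain a b where ab: "a * N' + b * ?p ^ n = 1"
      using bezout_int[of N' "?p ^ n"] by (metis coprime_iff_gcd_eq_1)
    have "codir i w = of_int (a * N' + b * ?p ^ n) * codir i w" unfolding ab by simp
    also have "\<dots> = of_int a * (of_int N' * codir i w) + of_int (?p ^ n) * (of_int b * codir i w)"
      by (simp only: of_int_scale of_int_add distrib_right mult.commute)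
    also have "\<dots> = of_int (?p ^ n) * (of_int (a * N) * codir i w' + of_int b * codir i w)"
      unfolding eq by (simp only: of_int_scale distrib_left mult.assoc mult.commute mult.left_commute)
    finally show "\<exists>u. codir i w = of_int (?p ^ n) * u" by blast
  qed
  then have "\<forall>l\<ge>L. codir i (f (lad \<delta> l)) = 0" using N torsion_free[of N] by simp
  then show ?thesis unfolding eventually_sequentially by blast
qed

lemma zed_0_lad: "\<delta> \<in> cof_omega \<Longrightarrow> zed \<delta> i 0 v (lad \<delta> l) = of_int (fact l) * dir i v"
  by (simp add: zed_lad coef_0)

text \<open>From the ladder point \<open>n * pr i\<close> on, \<open>zed \<delta> i n v\<close> is
  an exact quotient of \<open>zed \<delta> i 0 v\<close> by \<open>pr i ^ n\<close>; the discrepancy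
  before that point is bounded below \<delta>.\<close>

lemma zed_D:
  assumes \<delta>: "\<delta> \<in> cof_omega" and "i \<in> Ind" "v \<in> A"
  shows "zed \<delta> i 0 v \<in> D i \<delta>"
proof -
  have in_M: "zed \<delta> i n v \<in> M" for n using gens_M zed_gens assms by blast
  have "zed \<delta> i 0 v - of_int (int (pr i) ^ n) * zed \<delta> i n v \<in> Nd \<delta>" for n
  proof -
    let ?f = "zed \<delta> i 0 v - of_int (int (pr i) ^ n) * zed \<delta> i n v"
    have "?f \<gamma> = 0" if g: "\<gamma> \<ge> lad \<delta> (n * pr i)" for \<gamma>
    proof (cases "\<gamma> \<in> range (lad \<delta>)")
      case True
      then obtain l where l: "\<gamma> = lad \<delta> l" by blast
      with g have le: "n * pr i \<le> l" using lad_le_iff[OF \<delta>] by simp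
      have "of_int (int (pr i) ^ n) * zed \<delta> i n v \<gamma> = of_int (int (pr i) ^ n * coef i n l) * dir i v"
        unfolding l zed_lad[OF \<delta>] using le by (simp only: of_int_scale if_True)
      then have "of_int (int (pr i) ^ n) * zed \<delta> i n v \<gamma> = zed \<delta> i 0 v \<gamma>"
        unfolding coef_mult[OF le] l zed_0_lad[OF \<delta>] .
      then show ?thesis by (simp add: fun_eq_iff)
    next
      case False then show ?thesis using zed_off by (simp add: fun_eq_iff)
    qed
    then have "below (lad \<delta> (n * pr i)) ?f" unfolding below_def by blast
    moreover have "?f \<in> M" using in_M M_sub by (intro add_subgroup_diff add_subgroup_of_int_mult)
    ultimately show ?thesis unfolding Nd_def using lad_less[OF \<delta>] by blast
  qed
  then show ?thesis unfolding D_def using in_M by blast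
qed

text \<open>The identity \<open>(v, v g) = (v, 0) + (0, v g)\<close> at the level of generators; it
  ties the graphs to the two axes.\<close>

lemma zed_Some:
  assumes \<delta>: "\<delta> \<in> cof_omega"
  shows "zed \<delta> (Some g) 0 v = zed \<delta> (Some 0) 0 v + zed \<delta> None 0 (v * g)"
proof
  fix \<gamma>
  show "zed \<delta> (Some g) 0 v \<gamma> = (zed \<delta> (Some 0) 0 v + zed \<delta> None 0 (v * g)) \<gamma>"
  proof (cases "\<gamma> \<in> range (lad \<delta>)")
    case True
    then obtain l where l: "\<gamma> = lad \<delta> l" by blast
    have "dir (Some g) v b = dir (Some 0) v b + dir None (v * g) b" for b
      unfolding dir_def by auto
    then show ?thesis unfolding l by (auto simp: zed_0_lad[OF \<delta>] fun_eq_iff distrib_left)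
  next
    case False then show ?thesis using zed_off by simp
  qed
qed

text \<open>Agreement on late ladder points, together with vanishing off the ladder near \<delta>
  and from \<delta> on, leaves only a bounded difference.\<close>

lemma near_zed:
  assumes \<delta>: "\<delta> \<in> cof_omega" and f: "f \<in> M" "below \<delta> f" and c: "c \<in> A"
    and ev: "eventually (\<lambda>l. of_int N * f (lad \<delta> l) = of_int (fact l) * dir (Some 0) c) sequentially"
  shows "of_int N * f - zed \<delta> (Some 0) 0 c \<in> Nd \<delta>"
proof -
  have I: "Some 0 \<in> Ind" unfolding Ind_def using add_subgroup_zero[OF A_sub] by blast
  have M: "of_int N * f - zed \<delta> (Some 0) 0 c \<in> M"
    using f(1) c gens_M[OF zed_gens[OF \<delta> I c]] M_sub
    by (intro add_subgroup_diff add_subgroup_of_int_mult)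
  obtain \<beta> where b: "\<beta> < \<delta>" "\<And>\<gamma>. \<beta> \<le> \<gamma> \<Longrightarrow> \<gamma> < \<delta> \<Longrightarrow> \<gamma> \<notin> range (lad \<delta>) \<Longrightarrow> f \<gamma> = 0"
    using off_ladder[OF f(1) \<delta>] by blast
  obtain L where L: "\<And>l. l \<ge> L \<Longrightarrow> of_int N * f (lad \<delta> l) = of_int (fact l) * dir (Some 0) c"
    using ev unfolding eventually_sequentially by blast
  have "(of_int N * f - zed \<delta> (Some 0) 0 c) \<gamma> = 0" if g: "\<gamma> \<ge> max \<beta> (lad \<delta> L)" for \<gamma>
  proof (cases "\<gamma> \<in> range (lad \<delta>)")
    case True
    then obtain l where l: "\<gamma> = lad \<delta> l" by blast
    then have "l \<ge> L" using g lad_le_iff[OF \<delta>] by simp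
    from L[OF this] show ?thesis unfolding l by (simp add: zed_0_lad[OF \<delta>])
  next
    case False
    then have "zed \<delta> (Some 0) 0 c \<gamma> = 0" by (rule zed_off)
    moreover have "f \<gamma> = 0"
    proof (cases "\<gamma> < \<delta>")
      case True then show ?thesis using b(2)[of \<gamma>] False g by simp
    next
      case False then show ?thesis using f(2) unfolding below_def by simp
    qed
    ultimately show ?thesis by simp
  qed
  then have "below (max \<beta> (lad \<delta> L)) (of_int N * f - zed \<delta> (Some 0) 0 c)" unfolding below_def by blast
  moreover have "max \<beta> (lad \<delta> L) < \<delta>" using b(1) lad_less[OF \<delta>] by simp
  ultimately show ?thesis unfolding Nd_def using M by blast
qed

section \<open>Germs of homomorphisms that respect a stage\<close>

definition good :: "w1 \<Rightarrow> ((nat \<Rightarrow> w1 \<Rightarrow> bool \<Rightarrow> 'a) \<Rightarrow> nat \<Rightarrow> w1 \<Rightarrow> bool \<Rightarrow> 'a) \<Rightarrow> nat \<Rightarrow> nat \<Rightarrow> bool" where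
  "good \<delta> F m k \<longleftrightarrow> F ` tup m M \<subseteq> tup k M \<and> hom_on (tup m M) F \<and> F ` tup m (Nd \<delta>) \<subseteq> tup k (Nd \<delta>)"

lemma good_D:
  assumes "good \<delta> F m k" "j < m" "f \<in> D i \<delta>" "l < k" and \<delta>: "\<delta> \<in> cof_omega"
  shows "F (emb j f) l \<in> D i \<delta>"
proof -
  have F: "F ` tup m M \<subseteq> tup k M" "hom_on (tup m M) F" "F ` tup m (Nd \<delta>) \<subseteq> tup k (Nd \<delta>)"
    using assms(1) unfolding good_def by auto
  have f: "f \<in> M" using assms(3) unfolding D_def by blast
  have "\<exists>g\<in>M. F (emb j f) l - of_int (int (pr i) ^ n) * g \<in> Nd \<delta>" for n
  proof -
    obtain g where g: "g \<in> M" "f - of_int (int (pr i) ^ n) * g \<in> Nd \<delta>"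
      using assms(3) unfolding D_def by blast
    have t: "emb j f \<in> tup m M" "emb j g \<in> tup m M" using emb_tup[OF assms(2) _ M_sub] f g by auto
    note T = add_subgroup_tup[OF M_sub, of m]
    have "emb j (f - of_int (int (pr i) ^ n) * g) \<in> tup m (Nd \<delta>)"
      using emb_tup[OF assms(2) g(2) Nd_sub[OF \<delta>]] .
    moreover have "emb j (f - of_int (int (pr i) ^ n) * g) = emb j f - of_int (int (pr i) ^ n) * emb j g"
      unfolding emb_def by (auto simp: fun_eq_iff)
    ultimately have "F (emb j f - of_int (int (pr i) ^ n) * emb j g) \<in> tup k (Nd \<delta>)"
      using F(3) by auto
    moreover have "F (emb j f - of_int (int (pr i) ^ n) * emb j g) = F (emb j f) - of_int (int (pr i) ^ n) * F (emb j g)"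
      unfolding hom_on_diff[OF T F(2) t(1) add_subgroup_of_int_mult[OF T t(2)]] hom_on_of_int_mult[OF T F(2) t(2)] ..
    ultimately have "(F (emb j f) - of_int (int (pr i) ^ n) * F (emb j g)) l \<in> Nd \<delta>"
      using tup_nth assms(4) by metis
    moreover have "F (emb j g) l \<in> M" using F(1) t(2) assms(4) tup_nth by blast
    ultimately show ?thesis by auto
  qed
  moreover have "F (emb j f) l \<in> M" using F(1) emb_tup[OF assms(2) f M_sub] assms(4) tup_nth by blast
  ultimately show ?thesis unfolding D_def by blast
qed

text \<open>The germs of elements of \<open>D (Some g)\<close> lie in the graph of right multiplication by \<open>g\<close>, so
  an isomorphism respecting all of them is given by left multiplication with a matrix over \<open>A\<close>.\<close>

lemma good_linear:
  assumes F: "good \<delta> F m k" "j < m" "l < k" and \<delta>: "\<delta> \<in> cof_omega" and v: "v \<in> A"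
  shows "eventually (\<lambda>n. F (emb j (zed \<delta> (Some 0) 0 v)) l (lad \<delta> n) True = 0 \<and>
    F (emb j (zed \<delta> (Some 0) 0 v)) l (lad \<delta> n) False
      = F (emb j (zed \<delta> (Some 0) 0 1)) l (lad \<delta> n) False * v) sequentially"
proof -
  have Ind: "None \<in> Ind" "\<And>g. g \<in> A \<Longrightarrow> Some g \<in> Ind" unfolding Ind_def by auto
  have A0: "0 \<in> A" using add_subgroup_zero[OF A_sub] .
  let ?a = "\<lambda>v. F (emb j (zed \<delta> (Some 0) 0 v)) l"
  let ?w = "\<lambda>v. F (emb j (zed \<delta> None 0 v)) l"
  have a: "eventually (\<lambda>n. ?a u (lad \<delta> n) True = 0) sequentially" if u: "u \<in> A" for u
    using D_codir[OF good_D[OF F(1,2) zed_D[OF \<delta> Ind(2)[OF A0] u] F(3) \<delta>] Ind(2)[OF A0] \<delta>]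
    by (simp add: codir_def)
  have w: "eventually (\<lambda>n. ?w u (lad \<delta> n) False = 0) sequentially" if u: "u \<in> A" for u
    using D_codir[OF good_D[OF F(1,2) zed_D[OF \<delta> Ind(1) u] F(3) \<delta>] Ind(1) \<delta>]
    by (simp add: codir_def)
  \<comment> \<open>The equation of the graph of \<open>g\<close> takes this form because eventually
    \<open>?a u\<close> has no second coordinate and \<open>?w (u * g)\<close> no first.\<close>
  have graph: "eventually (\<lambda>n. ?w (u * g) (lad \<delta> n) True = ?a u (lad \<delta> n) False * g) sequentially"
    if u: "u \<in> A" and g: "g \<in> A" for u g
  proof -
    have "emb j (zed \<delta> (Some g) 0 u) = emb j (zed \<delta> (Some 0) 0 u) + emb j (zed \<delta> None 0 (u * g))"
      unfolding zed_Some[OF \<delta>, of g] emb_def by (auto simp: fun_eq_iff)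
    moreover have "emb j (zed \<delta> (Some 0) 0 u) \<in> tup m M" "emb j (zed \<delta> None 0 (u * g)) \<in> tup m M"
      using zed_gens[OF \<delta>] Ind A0 u g A_mult F(2) M_sub gens_M by (auto intro!: emb_tup)
    ultimately have "F (emb j (zed \<delta> (Some g) 0 u)) l = ?a u + ?w (u * g)"
      using F(1) unfolding good_def hom_on_def by simp
    then have "eventually (\<lambda>n. codir (Some g) ((?a u + ?w (u * g)) (lad \<delta> n)) = 0) sequentially"
      using D_codir[OF good_D[OF F(1,2) zed_D[OF \<delta> Ind(2)[OF g] u] F(3) \<delta>] Ind(2)[OF g] \<delta>] by simp
    with a[OF u] w[OF A_mult[OF u g]] show ?thesis
      by eventually_elim (simp add: codir_def)
  qed
  \<comment> \<open>The second axis is evaluated at \<open>v\<close> twice, as \<open>v * 1\<close>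
    and as \<open>1 * v\<close>; comparing the two gives linearity.\<close>
  show ?thesis
    using a[OF v] graph[OF v A_one] graph[OF A_one v]
    by eventually_elim simp
qed

text \<open>By \<open>good_linear\<close> a column is determined by the image of
  \<open>v = 1\<close>. Its entries come from \<open>germ\<close> with \<open>t = r\<close>, each
  with its own denominator prime to \<open>r\<close>; the product of all denominators serves the
  whole matrix.\<close>

lemma good_matrix:
  assumes F: "good \<delta> F m k" and \<delta>: "\<delta> \<in> cof_omega"
  shows "\<exists>N c. N > 0 \<and> coprime N (int r) \<and> (\<forall>l<k. \<forall>j<m. c l j \<in> A) \<and>
    (\<forall>j<m. \<forall>v\<in>A. of_int N * F (emb j (zed \<delta> (Some 0) 0 v))
       - (\<lambda>l. if l < k then zed \<delta> (Some 0) 0 (c l j * v) else 0) \<in> tup k (Nd \<delta>))"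
proof -
  have I0: "Some 0 \<in> Ind" unfolding Ind_def using add_subgroup_zero[OF A_sub] by blast
  let ?a = "\<lambda>l j v. F (emb j (zed \<delta> (Some 0) 0 v)) l"
  have t: "emb j (zed \<delta> (Some 0) 0 v) \<in> tup m M" if "j < m" "v \<in> A" for j v
    using emb_tup[OF that(1) gens_M[OF zed_gens[OF \<delta> I0 that(2)]] M_sub] .
  have Ft: "F (emb j (zed \<delta> (Some 0) 0 v)) \<in> tup k M" if "j < m" "v \<in> A" for j v
    using t[OF that] F unfolding good_def by blast
  have aM: "?a l j v \<in> M" if "l < k" "j < m" "v \<in> A" for l j v
    using tup_nth[OF Ft[OF that(2,3)] that(1)] .
  have add: "additive (\<lambda>w :: bool \<Rightarrow> 'a. w False)" by unfold_locales simp
  define P where "P l j N c \<longleftrightarrow> N > 0 \<and> coprime N (int r) \<and> c \<in> A \<and>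
    eventually (\<lambda>n. of_int N * ?a l j 1 (lad \<delta> n) False = of_int (fact n) * c) sequentially"
    for l j N c
  have "\<exists>N c. l < k \<and> j < m \<longrightarrow> P l j N c" for l j
  proof (cases "l < k \<and> j < m")
    case True
    have "coprime (int (pr i)) (int r)" for i using pr_coprime by (simp add: coprime_int_iff)
    then obtain N w where "N > 0" "coprime N (int r)" "w \<in> A2"
      "\<exists>L. \<forall>n\<ge>L. of_int N * ?a l j 1 (lad \<delta> n) False = of_int (fact n) * w False"
      using germ[OF aM[of l j 1] \<delta> add, of "int r"] True A_one by blast
    then show ?thesis
      unfolding P_def eventually_sequentially A2_def by (intro exI[of _ N] exI[of _ "w False"]) blast
  qed auto
  then obtain Nf cf where P: "\<And>l j. l < k \<Longrightarrow> j < m \<Longrightarrow> P l j (Nf l j) (cf l j)" by metis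
  have Nf: "\<And>l j. l < k \<Longrightarrow> j < m \<Longrightarrow> Nf l j > 0"
      "\<And>l j. l < k \<Longrightarrow> j < m \<Longrightarrow> coprime (Nf l j) (int r)"
      "\<And>l j. l < k \<Longrightarrow> j < m \<Longrightarrow> cf l j \<in> A"
      "\<And>l j. l < k \<Longrightarrow> j < m \<Longrightarrow>
        eventually (\<lambda>n. of_int (Nf l j) * ?a l j 1 (lad \<delta> n) False = of_int (fact n) * cf l j) sequentially"
    using P unfolding P_def by blast+
  define N where "N = (\<Prod>l<k. \<Prod>j<m. Nf l j)"
  have N: "N > 0" "coprime N (int r)"
    unfolding N_def using Nf by (auto intro!: prod_pos prod_coprime_left)
  have dvd: "Nf l j dvd N" if "l < k" "j < m" for l j
  proof -
    have "Nf l j dvd (\<Prod>j<m. Nf l j)" using that by (intro dvd_prodI) auto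
    also have "\<dots> dvd N" unfolding N_def using that by (intro dvd_prodI) auto
    finally show ?thesis .
  qed
  define c where "c l j = of_int (N div Nf l j) * cf l j" for l j
  have c: "c l j \<in> A" if "l < k" "j < m" for l j
    unfolding c_def using Nf(3)[OF that] A_sub by (intro add_subgroup_of_int_mult)
  have "of_int N * ?a l j v - zed \<delta> (Some 0) 0 (c l j * v) \<in> Nd \<delta>"
    if l: "l < k" and j: "j < m" and v: "v \<in> A" for l j v
  proof (rule near_zed[OF \<delta> aM[OF l j v]])
    show "below \<delta> (?a l j v)"
      using D_below[OF good_D[OF F j zed_D[OF \<delta> I0 v] l \<delta>]] .
    show "c l j * v \<in> A" using c[OF l j] v A_mult by blast
    show "eventually (\<lambda>n. of_int N * ?a l j v (lad \<delta> n) = of_int (fact n) * dir (Some 0) (c l j * v)) sequentially"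
      using good_linear[OF F j l \<delta> v] Nf(4)[OF l j]
    proof eventually_elim
      case (elim n)
      have "of_int N * ?a l j 1 (lad \<delta> n) False = of_int (N div Nf l j) * (of_int (Nf l j) * ?a l j 1 (lad \<delta> n) False)"
        using dvd[OF l j] by (simp only: of_int_scale dvd_div_mult_self)
      also have "\<dots> = of_int (fact n) * c l j"
        unfolding elim(2) c_def by (simp only: of_int_scale mult.commute)
      finally have "of_int N * (?a l j 1 (lad \<delta> n) False * v) = of_int (fact n) * (c l j * v)"
        by (simp only: mult.assoc[symmetric])
      then show ?case using elim(1) by (auto simp: fun_eq_iff dir_def)
    qed
  qed
  moreover have "F (emb j (zed \<delta> (Some 0) 0 v)) l = 0" if "l \<ge> k" "j < m" "v \<in> A" for l j v
    using Ft[OF that(2,3)] that(1) unfolding tup_def by simp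
  ultimately have "\<forall>j<m. \<forall>v\<in>A. of_int N * F (emb j (zed \<delta> (Some 0) 0 v))
       - (\<lambda>l. if l < k then zed \<delta> (Some 0) 0 (c l j * v) else 0) \<in> tup k (Nd \<delta>)"
    unfolding tup_def by (auto simp: fun_eq_iff)
  then show ?thesis using N c by blast
qed

text \<open>\<open>G\<close> is applied to the description of \<open>F\<close> on the
  \<open>j\<close>-th unit, and then the description of \<open>G\<close> is used; all error terms
  lie in \<open>Nd \<delta>\<close>. They vanish at a sufficiently late ladder point, where the
  first coordinates give the matrix identity up to the factor \<open>n!\<close>, which is
  cancelled.\<close>

lemma matrix_compose:
  assumes F: "good \<delta> F m k" and G: "good \<delta> G k m" and \<delta>: "\<delta> \<in> cof_omega"
    and GF: "\<And>t. t \<in> tup m M \<Longrightarrow> G (F t) = t"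
    and c: "\<And>l j. l < k \<Longrightarrow> j < m \<Longrightarrow> c l j \<in> A"
      "\<And>j v. j < m \<Longrightarrow> v \<in> A \<Longrightarrow> of_int N * F (emb j (zed \<delta> (Some 0) 0 v))
       - (\<lambda>l. if l < k then zed \<delta> (Some 0) 0 (c l j * v) else 0) \<in> tup k (Nd \<delta>)"
    and d: "\<And>j v. j < k \<Longrightarrow> v \<in> A \<Longrightarrow> of_int N' * G (emb j (zed \<delta> (Some 0) 0 v))
       - (\<lambda>l. if l < m then zed \<delta> (Some 0) 0 (d l j * v) else 0) \<in> tup m (Nd \<delta>)"
    and j: "j < m" "j' < m"
  shows "(\<Sum>l<k. d j' l * c l j) = of_int (N * N') * (if j = j' then 1 else 0)"
proof -
  have I0: "Some 0 \<in> Ind" unfolding Ind_def using add_subgroup_zero[OF A_sub] by blast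
  let ?Z = "zed \<delta> (Some 0) 0"
  note Tm = add_subgroup_tup[OF M_sub, of m] and Tk = add_subgroup_tup[OF M_sub, of k]
  have Z: "?Z v \<in> M" if "v \<in> A" for v using gens_M[OF zed_gens[OF \<delta> I0 that]] .
  have Fh: "hom_on (tup m M) F" "F ` tup m M \<subseteq> tup k M" using F unfolding good_def by auto
  have Gh: "hom_on (tup k M) G" "G ` tup k (Nd \<delta>) \<subseteq> tup m (Nd \<delta>)" using G unfolding good_def by auto
  have e1: "emb j (?Z 1) \<in> tup m M" using emb_tup[OF j(1) Z[OF A_one] M_sub] .
  then have Fe1: "F (emb j (?Z 1)) \<in> tup k M" using Fh(2) by blast
  have ec: "emb l (?Z (c l j)) \<in> tup k M" if "l < k" for l
    using emb_tup[OF that Z[OF c(1)[OF that j(1)]] M_sub] .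
  have "of_int N * F (emb j (?Z 1)) - (\<Sum>l<k. emb l (?Z (c l j))) \<in> tup k (Nd \<delta>)"
    using c(2)[OF j(1) A_one] unfolding sum_emb mult_1_right .
  then have GX: "G (of_int N * F (emb j (?Z 1)) - (\<Sum>l<k. emb l (?Z (c l j)))) \<in> tup m (Nd \<delta>)"
    using Gh(2) by blast
  have eqG: "G (of_int N * F (emb j (?Z 1)) - (\<Sum>l<k. emb l (?Z (c l j))))
    = of_int N * emb j (?Z 1) - (\<Sum>l<k. G (emb l (?Z (c l j))))"
  proof -
    have "(\<Sum>l<k. emb l (?Z (c l j))) \<in> tup k M" using ec Tk by (intro add_subgroup_sum) auto
    then have "G (of_int N * F (emb j (?Z 1)) - (\<Sum>l<k. emb l (?Z (c l j))))
      = G (of_int N * F (emb j (?Z 1))) - G (\<Sum>l<k. emb l (?Z (c l j)))"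
      using Fe1 Tk by (intro hom_on_diff[OF Tk Gh(1)] add_subgroup_of_int_mult)
    also have "G (of_int N * F (emb j (?Z 1))) = of_int N * emb j (?Z 1)"
      using hom_on_of_int_mult[OF Tk Gh(1) Fe1] GF[OF e1] by simp
    also have "G (\<Sum>l<k. emb l (?Z (c l j))) = (\<Sum>l<k. G (emb l (?Z (c l j))))"
      using ec by (intro hom_on_sum[OF Tk Gh(1)]) auto
    finally show ?thesis .
  qed
  have X: "(of_int N * emb j (?Z 1) - (\<Sum>l<k. G (emb l (?Z (c l j))))) j' \<in> Nd \<delta>"
    using tup_nth[OF GX j(2)] unfolding eqG .
  have Y: "(of_int N' * G (emb l (?Z (c l j))) - (\<lambda>i. if i < m then ?Z (d i l * c l j) else 0)) j' \<in> Nd \<delta>"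
    if "l < k" for l
    using tup_nth[OF d[OF that c(1)[OF that j(1)]] j(2)] .
  have X': "eventually (\<lambda>n. (of_int N * emb j (?Z 1) - (\<Sum>l<k. G (emb l (?Z (c l j))))) j' (lad \<delta> n) = 0) sequentially"
    using Nd_lad[OF X \<delta>] .
  have Y': "eventually (\<lambda>n. \<forall>l\<in>{..<k}. (of_int N' * G (emb l (?Z (c l j))) - (\<lambda>i. if i < m then ?Z (d i l * c l j) else 0)) j' (lad \<delta> n) = 0) sequentially"
    by (rule eventually_ball_finite) (use Nd_lad[OF Y \<delta>] in auto)
  from eventually_conj[OF X' Y'] obtain n where
    n: "(of_int N * emb j (?Z 1) - (\<Sum>l<k. G (emb l (?Z (c l j))))) j' (lad \<delta> n) = 0"
      "\<And>l. l < k \<Longrightarrow> (of_int N' * G (emb l (?Z (c l j))) - (\<lambda>i. if i < m then ?Z (d i l * c l j) else 0)) j' (lad \<delta> n) = 0"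
    unfolding eventually_sequentially by blast
  let ?g = "\<lambda>l. G (emb l (?Z (c l j))) j' (lad \<delta> n) False"
  have Zn: "?Z v (lad \<delta> n) False = of_int (fact n) * v" for v
    unfolding zed_0_lad[OF \<delta>] by (simp add: dir_def)
  have "of_int N * (if j = j' then of_int (fact n) else 0) = (\<Sum>l<k. ?g l)"
    using fun_cong[OF n(1), of False] Zn[of 1] by (auto simp: emb_def sum_fun_apply split: if_splits)
  moreover have "of_int N' * ?g l = of_int (fact n) * (d j' l * c l j)" if "l < k" for l
    using fun_cong[OF n(2)[OF that], of False] Zn j(2) by simp
  ultimately have "of_int N' * (of_int N * (if j = j' then of_int (fact n) else 0 :: 'a)) = (\<Sum>l<k. of_int (fact n) * (d j' l * c l j))"
    by (simp add: sum_distrib_left)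
  also have "of_int N' * (of_int N * (if j = j' then of_int (fact n) else 0)) =
      of_int (fact n) * (of_int (N * N') * (if j = j' then 1 else 0 :: 'a))"
  proof -
    have "of_int N' * (of_int N * of_int (fact n)) = of_int (fact n) * (of_int (N * N') * (1 :: 'a))"
      by (simp only: mult_1_right of_int_mult[symmetric] mult.assoc mult.commute mult.left_commute)
    then show ?thesis by (cases "j = j'") simp_all
  qed
  finally have "of_int (fact n) * (of_int (N * N') * (if j = j' then 1 else 0)) = of_int (fact n) * (\<Sum>l<k. d j' l * c l j)"
    unfolding sum_distrib_left[symmetric] .
  then have z: "of_int (fact n) * ((\<Sum>l<k. d j' l * c l j) - of_int (N * N') * (if j = j' then 1 else 0)) = 0"
    by (simp only: right_diff_distrib) simp
  show ?thesis using torsion_free[OF z fact_nonzero] by (simp only: right_minus_eq)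
qed

end

section \<open>Isomorphisms between powers of the module\<close>

lemma add_iso_refl: "add_iso S S"
  unfolding add_iso_def hom_on_def by (intro exI[of _ id]) auto

lemma add_iso_trans: "add_iso S T \<Longrightarrow> add_iso T U \<Longrightarrow> add_iso S U"
proof -
  assume "add_iso S T" "add_iso T U"
  then obtain F G where F: "bij_betw F S T" "hom_on S F" and G: "bij_betw G T U" "hom_on T G"
    unfolding add_iso_def by blast
  have "hom_on S (G \<circ> F)"
    using F G bij_betwE[OF F(1)] unfolding hom_on_def by simp
  then show ?thesis using bij_betw_trans[OF F(1) G(1)] unfolding add_iso_def by blast
qed

lemma hom_on_inv:
  assumes S: "add_subgroup S" and F: "bij_betw F S T" "hom_on S F"
  shows "hom_on T (inv_into S F)"
  unfolding hom_on_def
proof (intro ballI)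
  fix x y assume "x \<in> T" "y \<in> T"
  then obtain u v where uv: "u \<in> S" "x = F u" "v \<in> S" "y = F v"
    using F(1) unfolding bij_betw_def by blast
  then have "F (u + v) = x + y" using F(2) unfolding hom_on_def by simp
  moreover have "u + v \<in> S" using S uv by (simp add: add_subgroup_add)
  ultimately show "inv_into S F (x + y) = inv_into S F x + inv_into S F y"
    using uv F(1) by (metis bij_betw_inv_into_left)
qed

lemma add_iso_sym: "add_subgroup S \<Longrightarrow> add_iso S T \<Longrightarrow> add_iso T S"
  unfolding add_iso_def using hom_on_inv bij_betw_inv_into by blast

section \<open>Closing off under a map and its inverse, and comparison of traces\<close>

context ladder_module
begin

definition Mb :: "w1 \<Rightarrow> (w1 \<Rightarrow> bool \<Rightarrow> 'a) set" where
  "Mb \<alpha> = {f \<in> M. below \<alpha> f}"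

lemma Mb_mono: "\<alpha> \<le> \<beta> \<Longrightarrow> Mb \<alpha> \<subseteq> Mb \<beta>"
  unfolding Mb_def using below_mono by blast

lemma countable_Mb: "countable (Mb \<alpha>)"
  unfolding Mb_def by (rule countable_M_below)

lemma countable_subset_Mb:
  assumes "countable S" "S \<subseteq> M" shows "\<exists>\<alpha>. S \<subseteq> Mb \<alpha>"
proof -
  have "\<forall>f\<in>S. \<exists>\<alpha>. below \<alpha> f" using M_below assms(2) by blast
  then obtain a where a: "\<And>f. f \<in> S \<Longrightarrow> below (a f) f" by metis
  obtain \<alpha> where "\<forall>x\<in>a ` S. x < \<alpha>" using countable_bounded_w1[of "a ` S"] assms(1) by blast
  then have "below \<alpha> f" if "f \<in> S" for f
    using that by (intro below_mono[OF a[OF that]]) (simp add: less_imp_le)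
  then have "S \<subseteq> Mb \<alpha>" unfolding Mb_def using assms(2) by blast
  then show ?thesis by blast
qed

lemma countable_subset_tup_Mb:
  assumes "countable X" "X \<subseteq> tup k M" shows "\<exists>\<beta>. X \<subseteq> tup k (Mb \<beta>)"
proof -
  have "countable ((\<lambda>(t, j). t j) ` (X \<times> {..<k}))" using assms(1) by auto
  moreover have "(\<lambda>(t, j). t j) ` (X \<times> {..<k}) \<subseteq> M" using assms(2) unfolding tup_def by auto
  ultimately obtain \<beta> where "(\<lambda>(t, j). t j) ` (X \<times> {..<k}) \<subseteq> Mb \<beta>" using countable_subset_Mb by blast
  then have "X \<subseteq> tup k (Mb \<beta>)" using assms(2) unfolding tup_def by fastforce
  then show ?thesis by blast
qed

text \<open>\<open>s\<close> is any ladder of \<delta>, since the sequence built in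
  \<open>closed_stage\<close> need not be the chosen \<open>lad \<delta>\<close>.\<close>

lemma tup_Nd:
  assumes t: "t \<in> tup m (Nd \<delta>)" and s: "ladder \<delta> s"
  shows "\<exists>n. t \<in> tup m (Mb (s n))"
proof -
  have \<delta>: "\<delta> \<in> cof_omega" using s unfolding cof_omega_def by blast
  have "\<forall>j\<in>{..<m}. \<exists>\<beta>. \<beta> < \<delta> \<and> below \<beta> (t j)" using t unfolding tup_def Nd_def by auto
  then obtain b where b: "\<And>j. j < m \<Longrightarrow> b j < \<delta> \<and> below (b j) (t j)" by (metis lessThan_iff)
  obtain \<beta> where \<beta>: "\<beta> < \<delta>" "\<forall>x\<in>b ` {..<m}. x < \<beta>"
    using finite_bounded_below[OF \<delta>, of "b ` {..<m}"] b by auto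
  obtain n where n: "\<beta> < s n" using s \<beta>(1) unfolding ladder_def by blast
  have "t j \<in> Mb (s n)" if "j < m" for j
  proof -
    have "b j < \<beta>" using \<beta>(2) that by simp
    then have "below (s n) (t j)" using b[OF that] n by (meson below_mono less_imp_le less_trans)
    then show ?thesis using t that unfolding Mb_def tup_def Nd_def by simp
  qed
  then show ?thesis using t unfolding tup_def by auto
qed

lemma tup_Mb_Nd: "s n < \<delta> \<Longrightarrow> tup m (Mb (s n)) \<subseteq> tup m (Nd \<delta>)"
  by (rule tup_mono) (auto simp: Mb_def Nd_def)

text \<open>Each \<open>Mb \<alpha>\<close> is countable, so the images of its tuples under
  \<open>F\<close> and \<open>G\<close> are bounded by some later stage. After countably many such
  steps the supremum is closed, because every tuple over \<open>Nd \<delta>\<close> already lies in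
  one of the steps.\<close>

lemma closed_stage:
  assumes F: "F ` tup m M \<subseteq> tup k M" and G: "G ` tup k M \<subseteq> tup m M"
  shows "\<exists>\<delta>\<in>cof_omega. F ` tup m (Nd \<delta>) \<subseteq> tup k (Nd \<delta>) \<and> G ` tup k (Nd \<delta>) \<subseteq> tup m (Nd \<delta>)"
proof -
  have MbM: "tup n (Mb \<alpha>) \<subseteq> tup n M" for n \<alpha> by (rule tup_mono) (auto simp: Mb_def)
  have "\<exists>\<beta>>\<alpha>. F ` tup m (Mb \<alpha>) \<subseteq> tup k (Mb \<beta>) \<and> G ` tup k (Mb \<alpha>) \<subseteq> tup m (Mb \<beta>)" for \<alpha>
  proof -
    obtain \<beta>1 where 1: "F ` tup m (Mb \<alpha>) \<subseteq> tup k (Mb \<beta>1)"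
      using countable_subset_tup_Mb[of "F ` tup m (Mb \<alpha>)" k] F MbM[of m \<alpha>]
        countable_image[OF countable_tup[OF countable_Mb]] by blast
    obtain \<beta>2 where 2: "G ` tup k (Mb \<alpha>) \<subseteq> tup m (Mb \<beta>2)"
      using countable_subset_tup_Mb[of "G ` tup k (Mb \<alpha>)" m] G MbM[of k \<alpha>]
        countable_image[OF countable_tup[OF countable_Mb]] by blast
    obtain \<beta> where \<beta>: "\<forall>x\<in>{\<alpha>, \<beta>1, \<beta>2}. x < \<beta>" using countable_bounded_w1[of "{\<alpha>, \<beta>1, \<beta>2}"] by auto
    have "tup k (Mb \<beta>1) \<subseteq> tup k (Mb \<beta>)" "tup m (Mb \<beta>2) \<subseteq> tup m (Mb \<beta>)"
      using \<beta> by (auto intro!: tup_mono Mb_mono)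
    then show ?thesis using 1 2 \<beta> by blast
  qed
  then obtain h where h: "\<And>\<alpha>. \<alpha> < h \<alpha>" "\<And>\<alpha>. F ` tup m (Mb \<alpha>) \<subseteq> tup k (Mb (h \<alpha>))"
    "\<And>\<alpha>. G ` tup k (Mb \<alpha>) \<subseteq> tup m (Mb (h \<alpha>))" by metis
  \<comment> \<open>The starting stage is arbitrary; \<open>\<alpha> < h \<alpha>\<close> makes the
    iterates a ladder of their least strict upper bound.\<close>
  define s where "s n = (h ^^ n) undefined" for n
  have s_Suc: "s (Suc n) = h (s n)" for n unfolding s_def by simp
  have mono: "strict_mono s" unfolding strict_mono_Suc_iff using h(1) s_Suc by simp
  define \<delta> where "\<delta> = (LEAST b. \<forall>n. s n < b)"
  have "\<exists>b. \<forall>n. s n < b" using countable_bounded_w1[of "range s"] by auto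
  then have "\<forall>n. s n < \<delta>" unfolding \<delta>_def by (rule LeastI_ex)
  then have ub: "s n < \<delta>" for n by blast
  have "\<exists>n. \<beta> < s n" if "\<beta> < \<delta>" for \<beta>
  proof -
    have "\<not> (\<forall>n. s n < \<beta>)" using that not_less_Least unfolding \<delta>_def by blast
    then obtain n where "\<beta> \<le> s n" by (auto simp: not_less)
    then have "\<beta> < s (Suc n)" using h(1)[of "s n"] s_Suc by simp
    then show ?thesis by blast
  qed
  then have lad: "ladder \<delta> s" unfolding ladder_def using mono ub by blast
  have "F ` tup m (Nd \<delta>) \<subseteq> tup k (Nd \<delta>)"
  proof
    fix u assume "u \<in> F ` tup m (Nd \<delta>)"
    then obtain t n where "u = F t" "t \<in> tup m (Mb (s n))" using tup_Nd[OF _ lad] by blast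
    then have "u \<in> tup k (Mb (s (Suc n)))" using h(2)[of "s n"] s_Suc by auto
    then show "u \<in> tup k (Nd \<delta>)" using tup_Mb_Nd[of s, OF ub] by blast
  qed
  moreover have "G ` tup k (Nd \<delta>) \<subseteq> tup m (Nd \<delta>)"
  proof
    fix u assume "u \<in> G ` tup k (Nd \<delta>)"
    then obtain t n where "u = G t" "t \<in> tup k (Mb (s n))" using tup_Nd[OF _ lad] by blast
    then have "u \<in> tup m (Mb (s (Suc n)))" using h(3)[of "s n"] s_Suc by auto
    then show "u \<in> tup m (Nd \<delta>)" using tup_Mb_Nd[of s, OF ub] by blast
  qed
  moreover have "\<delta> \<in> cof_omega" using lad unfolding cof_omega_def by blast
  ultimately show ?thesis by blast
qed

text \<open>The matrices satisfy \<open>d c = N N' I\<close> in size \<open>m\<close> and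
  \<open>c d = N N' I\<close> in size \<open>k\<close>; comparing traces makes \<open>m N N'\<close>
  and \<open>k N N'\<close> congruent, and \<open>N N'\<close> is a unit modulo \<open>r\<close>.
  The trace is given by approximations \<open>tr n\<close>; only finitely many products occur, so a
  single \<open>n\<close> serves all of them.\<close>

theorem tup_iso_imp_cong:
  assumes tr: "\<And>n. additive (tr n)" "\<And>n. [tr n 1 = 1] (mod int r)"
    and tr_comm: "\<And>a b. a \<in> A \<Longrightarrow> b \<in> A \<Longrightarrow>
      eventually (\<lambda>n. [tr n (a * b) = tr n (b * a)] (mod int r)) sequentially"
    and iso: "add_iso (tup m M) (tup k M)"
  shows "[m = k] (mod r)"
proof -
  note Tm = add_subgroup_tup[OF M_sub, of m]
  obtain F where F: "bij_betw F (tup m M) (tup k M)" "hom_on (tup m M) F"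
    using iso unfolding add_iso_def by blast
  define G where "G = inv_into (tup m M) F"
  have G: "bij_betw G (tup k M) (tup m M)" "hom_on (tup k M) G"
    unfolding G_def using bij_betw_inv_into[OF F(1)] hom_on_inv[OF Tm F] by auto
  have GF: "G (F t) = t" if "t \<in> tup m M" for t
    unfolding G_def using that F(1) by (simp add: bij_betw_inv_into_left)
  have FG: "F (G t) = t" if "t \<in> tup k M" for t
    unfolding G_def using that F(1) by (simp add: bij_betw_inv_into_right)
  have FM: "F ` tup m M \<subseteq> tup k M" and GM: "G ` tup k M \<subseteq> tup m M"
    using F(1) G(1) unfolding bij_betw_def by auto
  obtain \<delta> where \<delta>: "\<delta> \<in> cof_omega" and gF: "good \<delta> F m k" and gG: "good \<delta> G k m"
    using closed_stage[OF FM GM] F(2) G(2) FM GM unfolding good_def by blast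
  obtain N c where N: "coprime N (int r)" and c: "\<And>l j. l < k \<Longrightarrow> j < m \<Longrightarrow> c l j \<in> A"
    "\<And>j v. j < m \<Longrightarrow> v \<in> A \<Longrightarrow> of_int N * F (emb j (zed \<delta> (Some 0) 0 v))
       - (\<lambda>l. if l < k then zed \<delta> (Some 0) 0 (c l j * v) else 0) \<in> tup k (Nd \<delta>)"
    using good_matrix[OF gF \<delta>] by blast
  obtain N' d where N': "coprime N' (int r)" and d: "\<And>l j. l < m \<Longrightarrow> j < k \<Longrightarrow> d l j \<in> A"
    "\<And>j v. j < k \<Longrightarrow> v \<in> A \<Longrightarrow> of_int N' * G (emb j (zed \<delta> (Some 0) 0 v))
       - (\<lambda>l. if l < m then zed \<delta> (Some 0) 0 (d l j * v) else 0) \<in> tup m (Nd \<delta>)"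
    using good_matrix[OF gG \<delta>] by blast
  have dc: "(\<Sum>l<k. d j l * c l j) = of_int (N * N')" if "j < m" for j
    using matrix_compose[OF gF gG \<delta> GF c d(2) that that] by simp
  have cd: "(\<Sum>j<m. c l j * d j l) = of_int (N * N')" if "l < k" for l
    using matrix_compose[OF gG gF \<delta> FG d c(2) that that] by (simp add: mult.commute)
  have "eventually (\<lambda>n. \<forall>j\<in>{..<m}. \<forall>l\<in>{..<k}. [tr n (d j l * c l j) = tr n (c l j * d j l)] (mod int r)) sequentially"
    using tr_comm d(1) c(1) by (intro eventually_ball_finite ballI) auto
  then obtain n where n: "\<And>j l. j < m \<Longrightarrow> l < k \<Longrightarrow> [tr n (d j l * c l j) = tr n (c l j * d j l)] (mod int r)"
    unfolding eventually_sequentially by auto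
  have tN: "tr n (of_int (N * N')) = N * N' * tr n 1"
    using additive_of_int_mult[OF tr(1), of n "N * N'" 1] by simp
  have "int m * (N * N' * tr n 1) = (\<Sum>j<m. \<Sum>l<k. tr n (d j l * c l j))"
    using dc tN by (simp flip: additive.sum[OF tr(1)])
  also have "[\<dots> = (\<Sum>j<m. \<Sum>l<k. tr n (c l j * d j l))] (mod int r)"
    using n by (intro cong_sum) auto
  also have "(\<Sum>j<m. \<Sum>l<k. tr n (c l j * d j l)) = (\<Sum>l<k. \<Sum>j<m. tr n (c l j * d j l))"
    by (rule sum.swap)
  also have "\<dots> = int k * (N * N' * tr n 1)"
    using cd tN by (simp flip: additive.sum[OF tr(1)])
  finally have "[int m * (N * N' * tr n 1) = int k * (N * N' * tr n 1)] (mod int r)" .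
  moreover have "coprime (tr n 1) (int r)"
    using tr(2)[of n] by (metis cong_imp_coprime cong_sym coprime_1_left)
  then have "coprime (N * N' * tr n 1) (int r)" using N N' by simp
  ultimately have "[int m = int k] (mod int r)" using cong_mult_rcancel by blast
  then show ?thesis by (simp add: cong_int_iff)
qed

section \<open>Left multiplication and the passage from \<open>m\<close> to \<open>m + r\<close>
  copies\<close>

definition lmul :: "'a \<Rightarrow> (w1 \<Rightarrow> bool \<Rightarrow> 'a) \<Rightarrow> w1 \<Rightarrow> bool \<Rightarrow> 'a" where
  "lmul a f = (\<lambda>\<beta> b. a * f \<beta> b)"

lemma lmul_add: "lmul a (f + g) = lmul a f + lmul a g"
  unfolding lmul_def by (auto simp: fun_eq_iff distrib_left)

lemma lmul_zero: "lmul a 0 = 0"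
  unfolding lmul_def by (auto simp: fun_eq_iff)

text \<open>Left multiplication preserves every line, because
  \<open>a * (v * g) = (a * v) * g\<close>, and it commutes with the integer coefficients.\<close>

lemma lmul_M:
  assumes a: "a \<in> A" and f: "f \<in> M" shows "lmul a f \<in> M"
proof -
  have "f \<in> {f. lmul a f \<in> M}"
    using f
  proof (rule M_induct)
    have "lmul a (f - g) = lmul a f - lmul a g" for f g
      unfolding lmul_def by (auto simp: fun_eq_iff right_diff_distrib)
    then show "add_subgroup {f. lmul a f \<in> M}"
      using M_sub unfolding add_subgroup_def by (auto simp: lmul_zero)
    fix s assume "s \<in> gens"
    then show "s \<in> {f. lmul a f \<in> M}"
    proof (cases rule: gens_cases)
      case (single \<beta> w)
      have "lmul a s = single \<beta> (\<lambda>b. a * w b)"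
        unfolding single single_def lmul_def by (auto simp: fun_eq_iff)
      moreover have "(\<lambda>b. a * w b) \<in> A2" using single(1) a A_mult unfolding A2_def by auto
      ultimately show ?thesis using single_gens gens_M by simp
    next
      case (zed \<delta> i n v)
      have "a * dir i v b = dir i (a * v) b" for b
        unfolding dir_def by (auto simp: mult.assoc split: option.split)
      moreover have "a * (of_int c * x) = of_int c * (a * x)" for c and x :: 'a
        by (metis mult.assoc mult_of_int_commute)
      ultimately have "lmul a s = zed \<delta> i n (a * v)"
        unfolding zed(4) zed_def lmul_def by (auto simp: fun_eq_iff)
      then show ?thesis using zed_gens[OF zed(1,2) A_mult[OF a zed(3)]] gens_M by simp
    qed
  qed
  then show ?thesis by simp
qed

text \<open>The relations between \<open>x\<close> and \<open>y\<close> say that left multiplication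
  by the \<open>y i\<close> identifies one copy of \<open>M\<close> with \<open>r + 1\<close>
  copies, the inverse being a sum weighted by the \<open>x i\<close>. This is applied to the first
  coordinate.\<close>

lemma tup_iso_shift:
  assumes xy: "\<And>i. i < Suc r \<Longrightarrow> x i \<in> A" "\<And>i. i < Suc r \<Longrightarrow> y i \<in> A"
    and yx: "\<And>i j. i < Suc r \<Longrightarrow> j < Suc r \<Longrightarrow> y i * x j = (if i = j then 1 else 0)"
    and sum_xy: "(\<Sum>i<Suc r. x i * y i) = 1" and m: "m > 0"
  shows "add_iso (tup m M) (tup (m + r) M)"
proof -
  \<comment> \<open>Coordinate 0 is replaced by the coordinates \<open>0, ..., r\<close>; every
    other one moves up by \<open>r\<close>, so a position \<open>j > r\<close> takes
    \<open>t (j - r)\<close> with \<open>j - r\<close> at least 1.\<close>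
  define P where "P t = (\<lambda>j. if j < Suc r then lmul (y j) (t 0) else t (j - r))"
    for t :: "nat \<Rightarrow> w1 \<Rightarrow> bool \<Rightarrow> 'a"
  define R where "R u = (\<lambda>j. if j = 0 then \<Sum>i<Suc r. lmul (x i) (u i) else u (j + r))"
    for u :: "nat \<Rightarrow> w1 \<Rightarrow> bool \<Rightarrow> 'a"
  have RP: "R (P t) = t" for t
  proof
    fix j
    have "(\<Sum>i<Suc r. lmul (x i) (lmul (y i) (t 0))) = t 0"
    proof (intro ext)
      fix \<beta> b
      have "(\<Sum>i<Suc r. lmul (x i) (lmul (y i) (t 0))) \<beta> b = (\<Sum>i<Suc r. x i * y i) * t 0 \<beta> b"
        unfolding sum_distrib_right by (simp add: sum_fun_apply lmul_def mult.assoc del: sum.lessThan_Suc)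
      then show "(\<Sum>i<Suc r. lmul (x i) (lmul (y i) (t 0))) \<beta> b = t 0 \<beta> b" unfolding sum_xy by simp
    qed
    then show "R (P t) j = t j" unfolding R_def P_def by (simp del: sum.lessThan_Suc)
  qed
  have PR: "P (R u) = u" for u
  proof
    fix j
    show "P (R u) j = u j"
    proof (cases "j < Suc r")
      case True
      have "lmul (y j) (\<Sum>i<Suc r. lmul (x i) (u i)) = u j"
      proof (intro ext)
        fix \<beta> b
        have "lmul (y j) (\<Sum>i<Suc r. lmul (x i) (u i)) \<beta> b = (\<Sum>i<Suc r. (y j * x i) * u i \<beta> b)"
          by (simp add: sum_fun_apply lmul_def sum_distrib_left mult.assoc del: sum.lessThan_Suc)
        also have "\<dots> = (\<Sum>i<Suc r. if j = i then u i \<beta> b else 0)"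
          using yx True by (intro sum.cong) auto
        also have "\<dots> = (if j \<in> {..<Suc r} then u j \<beta> b else 0)" by (rule sum.delta') simp
        finally show "lmul (y j) (\<Sum>i<Suc r. lmul (x i) (u i)) \<beta> b = u j \<beta> b" using True by simp
      qed
      then show ?thesis unfolding P_def R_def using True by (simp del: sum.lessThan_Suc)
    next
      case False then show ?thesis unfolding P_def R_def by simp
    qed
  qed
  have "bij_betw P (tup m M) (tup (m + r) M)"
  proof (rule bij_betw_byWitness[where f' = R])
    show "P ` tup m M \<subseteq> tup (m + r) M"
      unfolding P_def tup_def using m xy(2) lmul_M by auto
    show "R ` tup (m + r) M \<subseteq> tup m M"
    proof
      fix t assume "t \<in> R ` tup (m + r) M"
      then obtain u where u: "u \<in> tup (m + r) M" "t = R u" by blast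
      have "(\<Sum>i<Suc r. lmul (x i) (u i)) \<in> M"
        using u(1) m xy(1) unfolding tup_def by (intro add_subgroup_sum[OF M_sub] lmul_M) auto
      then show "t \<in> tup m M" using u m unfolding R_def tup_def by (auto simp del: sum.lessThan_Suc)
    qed
  qed (use RP PR in auto)
  moreover have "hom_on (tup m M) P"
    unfolding hom_on_def P_def by (auto simp: fun_eq_iff lmul_add)
  ultimately show ?thesis unfolding add_iso_def by blast
qed

theorem tup_iso_if_cong:
  assumes xy: "\<And>i. i < Suc r \<Longrightarrow> x i \<in> A" "\<And>i. i < Suc r \<Longrightarrow> y i \<in> A"
    and yx: "\<And>i j. i < Suc r \<Longrightarrow> j < Suc r \<Longrightarrow> y i * x j = (if i = j then 1 else 0)"
    and sum_xy: "(\<Sum>i<Suc r. x i * y i) = 1"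
    and mk: "m > 0" "k > 0" "[m = k] (mod r)"
  shows "add_iso (tup m M) (tup k M)"
proof -
  have step: "add_iso (tup m M) (tup (m + r * n) M)" if "m > 0" for m n
  proof (induction n)
    case (Suc n)
    have "add_iso (tup (m + r * n) M) (tup (m + r * n + r) M)"
      using xy yx sum_xy that by (intro tup_iso_shift) auto
    then have "add_iso (tup m M) (tup (m + r * n + r) M)" using Suc add_iso_trans by blast
    moreover have "m + r * n + r = m + r * Suc n" by simp
    ultimately show ?case by simp
  qed (simp add: add_iso_refl)
  show ?thesis
  proof (cases "m \<le> k")
    case True
    then obtain n where "k = n * r + m" using cong_le_nat[of m k r] cong_sym[OF mk(3)] by blast
    then have "k = m + r * n" by simp
    then show ?thesis using step[OF mk(1)] by simp
  next
    case False
    then obtain n where "m = n * r + k" using cong_le_nat[of k m r] mk(3) by auto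
    then have "m = k + r * n" by simp
    then show ?thesis using add_iso_sym[OF add_subgroup_tup[OF M_sub] step[OF mk(2)]] by simp
  qed
qed

end

section \<open>Transport to the type of the statement\<close>

definition add_monoid_of :: "'a::ab_group_add set \<Rightarrow> 'a monoid" where
  "add_monoid_of S = \<lparr>carrier = S, monoid.mult = (+), one = 0\<rparr>"

lemma group_add_monoid_of: "add_subgroup S \<Longrightarrow> group (add_monoid_of S)"
  unfolding add_monoid_of_def
  by (rule groupI)
    (auto intro: add_subgroup_add add_subgroup_zero bexI[of _ "- x" for x] add_subgroup_uminus simp: add.assoc)

lemma iso_add_monoid_of: "add_monoid_of S \<cong> add_monoid_of T \<longleftrightarrow> add_iso S T"
  if "add_subgroup S" "add_subgroup T"
  unfolding is_iso_def iso_def hom_def add_iso_def hom_on_def add_monoid_of_def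
  by (auto dest: bij_betwE)

text \<open>The statement fixes the element type \<open>nat set\<close>; the group is moved there
  along a map that is injective on \<open>S\<close>.\<close>

definition transport :: "('a::ab_group_add \<Rightarrow> 'b) \<Rightarrow> 'a set \<Rightarrow> 'b monoid" where
  "transport h S = \<lparr>carrier = h ` S,
     monoid.mult = (\<lambda>a b. h (inv_into S h a + inv_into S h b)), one = h 0\<rparr>"

context
  fixes h :: "'a::ab_group_add \<Rightarrow> 'b" and S :: "'a set"
  assumes S: "add_subgroup S" and h: "inj_on h S"
begin

lemma transport_simps:
  "carrier (transport h S) = h ` S" "\<one>\<^bsub>transport h S\<^esub> = h 0"
  "x \<in> S \<Longrightarrow> y \<in> S \<Longrightarrow> h x \<otimes>\<^bsub>transport h S\<^esub> h y = h (x + y)"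
  unfolding transport_def by (simp_all add: inv_into_f_f[OF h])

lemma comm_group_transport: "comm_group (transport h S)"
proof (rule comm_groupI)
  fix x assume "x \<in> carrier (transport h S)"
  then obtain u where u: "u \<in> S" "x = h u" by (auto simp: transport_simps)
  then have "h (- u) \<otimes>\<^bsub>transport h S\<^esub> x = \<one>\<^bsub>transport h S\<^esub>"
    using add_subgroup_uminus[OF S u(1)] by (simp add: transport_simps)
  then show "\<exists>y\<in>carrier (transport h S). y \<otimes>\<^bsub>transport h S\<^esub> x = \<one>\<^bsub>transport h S\<^esub>"
    using add_subgroup_uminus[OF S u(1)] by (auto simp: transport_simps)
qed (use S in \<open>auto simp: transport_simps add_subgroup_add add_subgroup_zero algebra_simps\<close>)

lemma inv_transport: "x \<in> S \<Longrightarrow> inv\<^bsub>transport h S\<^esub> h x = h (- x)"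
proof -
  assume x: "x \<in> S"
  interpret comm_group "transport h S" by (rule comm_group_transport)
  show ?thesis
    by (rule inv_equality) (use x add_subgroup_uminus[OF S x] in \<open>auto simp: transport_simps\<close>)
qed

lemma subgroup_transport:
  assumes "add_subgroup T" "T \<subseteq> S" shows "subgroup (h ` T) (transport h S)"
proof -
  interpret comm_group "transport h S" by (rule comm_group_transport)
  have "h x \<otimes>\<^bsub>transport h S\<^esub> h y \<in> h ` T" if "x \<in> T" "y \<in> T" for x y
  proof -
    have "x \<in> S" "y \<in> S" using that assms(2) by auto
    then show ?thesis using add_subgroup_add[OF assms(1) that] by (simp add: transport_simps)
  qed
  moreover have "inv\<^bsub>transport h S\<^esub> h x \<in> h ` T" if "x \<in> T" for x
  proof -
    have "x \<in> S" using that assms(2) by auto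
    then show ?thesis using add_subgroup_uminus[OF assms(1) that] by (simp add: inv_transport)
  qed
  moreover have "h ` T \<noteq> {}" using add_subgroup_zero[OF assms(1)] by blast
  moreover have "h ` T \<subseteq> carrier (transport h S)" using assms(2) by (auto simp: transport_simps)
  ultimately show ?thesis by (intro subgroupI) auto
qed

lemma direct_summand_transport:
  assumes T: "add_subgroup T" "T \<subseteq> S" and K: "add_subgroup K" "K \<subseteq> S"
    and disj: "T \<inter> K \<subseteq> {0}" and sum: "\<And>x. x \<in> S \<Longrightarrow> \<exists>u\<in>T. \<exists>v\<in>K. x = u + v"
  shows "direct_summand (h ` T) (transport h S)"
  unfolding direct_summand_def
proof (intro conjI exI)
  show "subgroup (h ` T) (transport h S)" by (rule subgroup_transport[OF T])
  show "subgroup (h ` K) (transport h S)" by (rule subgroup_transport[OF K])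
  have "T \<inter> K = {0}" using disj add_subgroup_zero[OF T(1)] add_subgroup_zero[OF K(1)] by blast
  then show "h ` T \<inter> h ` K = {\<one>\<^bsub>transport h S\<^esub>}"
    using inj_on_image_Int[OF h T(2) K(2)] by (simp add: transport_simps)
  show "h ` T <#>\<^bsub>transport h S\<^esub> h ` K = carrier (transport h S)"
  proof (intro equalityI subsetI)
    fix a assume "a \<in> h ` T <#>\<^bsub>transport h S\<^esub> h ` K"
    then obtain u v where uv: "u \<in> T" "v \<in> K" "a = h u \<otimes>\<^bsub>transport h S\<^esub> h v"
      unfolding set_mult_def by blast
    then have "u \<in> S" "v \<in> S" using T(2) K(2) by auto
    then show "a \<in> carrier (transport h S)" using uv(3) S by (simp add: transport_simps add_subgroup_add)
  next
    fix a assume "a \<in> carrier (transport h S)"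
    then obtain x where x: "x \<in> S" "a = h x" by (auto simp: transport_simps)
    then obtain u v where uv: "u \<in> T" "v \<in> K" "x = u + v" using sum by blast
    then have "u \<in> S" "v \<in> S" using T(2) K(2) by auto
    then have "a = h u \<otimes>\<^bsub>transport h S\<^esub> h v" using x uv(3) by (simp add: transport_simps)
    then show "a \<in> h ` T <#>\<^bsub>transport h S\<^esub> h ` K" using uv unfolding set_mult_def by blast
  qed
qed

lemma dsum_pow_transport: "add_monoid_of (tup m S) \<cong> dsum_pow (transport h S) m"
proof -
  interpret comm_group "transport h S" by (rule comm_group_transport)
  let ?D = "dsum_pow (transport h S) m"
  \<comment> \<open>Padding with 0 on one side corresponds to the value \<open>undefined\<close>
    outside \<open>{..<m}\<close> in the extensional functions of \<open>sum_group\<close>.\<close>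
  let ?\<phi> = "\<lambda>t. \<lambda>j\<in>{..<m}. h (t j)"
  have carr: "carrier ?D = (\<Pi>\<^sub>E i\<in>{..<m}. h ` S)"
    unfolding dsum_pow_def by (subst carrier_sum_group) (auto simp: transport_simps is_group)
  have mult: "\<And>a b. a \<otimes>\<^bsub>?D\<^esub> b = (\<lambda>j\<in>{..<m}. a j \<otimes>\<^bsub>transport h S\<^esub> b j)"
    unfolding dsum_pow_def by simp
  have maps: "?\<phi> \<in> carrier (add_monoid_of (tup m S)) \<rightarrow> carrier ?D"
    unfolding carr add_monoid_of_def tup_def by auto
  have "?\<phi> \<in> iso (add_monoid_of (tup m S)) ?D"
    unfolding iso_def hom_def
  proof (intro CollectI conjI ballI)
    show "?\<phi> \<in> carrier (add_monoid_of (tup m S)) \<rightarrow> carrier ?D" by (rule maps)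
    fix s t assume "s \<in> carrier (add_monoid_of (tup m S))" "t \<in> carrier (add_monoid_of (tup m S))"
    then have "\<And>j. j < m \<Longrightarrow> s j \<in> S \<and> t j \<in> S" unfolding add_monoid_of_def tup_def by auto
    then show "?\<phi> (s \<otimes>\<^bsub>add_monoid_of (tup m S)\<^esub> t) = ?\<phi> s \<otimes>\<^bsub>?D\<^esub> ?\<phi> t"
      unfolding mult by (auto simp: fun_eq_iff transport_simps add_monoid_of_def)
  next
    show "bij_betw ?\<phi> (carrier (add_monoid_of (tup m S))) (carrier ?D)"
    proof (rule bij_betw_byWitness[where f' = "\<lambda>a j. if j < m then inv_into S h (a j) else 0"])
      show "\<forall>t\<in>carrier (add_monoid_of (tup m S)). (\<lambda>j. if j < m then inv_into S h (?\<phi> t j) else 0) = t"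
        unfolding add_monoid_of_def tup_def by (auto simp: fun_eq_iff inv_into_f_f[OF h])
      show "\<forall>a\<in>carrier ?D. ?\<phi> (\<lambda>j. if j < m then inv_into S h (a j) else 0) = a"
      proof (intro ballI ext)
        fix a j assume "a \<in> carrier ?D"
        then have a: "a \<in> (\<Pi>\<^sub>E i\<in>{..<m}. h ` S)" unfolding carr .
        show "?\<phi> (\<lambda>j. if j < m then inv_into S h (a j) else 0) j = a j"
        proof (cases "j < m")
          case True
          then have "a j \<in> h ` S" using PiE_mem[OF a] by simp
          then show ?thesis using True by (simp add: f_inv_into_f)
        next
          case False then show ?thesis using PiE_arb[OF a] by simp
        qed
      qed
      show "?\<phi> ` carrier (add_monoid_of (tup m S)) \<subseteq> carrier ?D"
        by (rule funcset_image[OF maps])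
      show "(\<lambda>a j. if j < m then inv_into S h (a j) else 0) ` carrier ?D \<subseteq> carrier (add_monoid_of (tup m S))"
      proof
        fix t assume "t \<in> (\<lambda>a j. if j < m then inv_into S h (a j) else 0) ` carrier ?D"
        then obtain a where a: "a \<in> (\<Pi>\<^sub>E i\<in>{..<m}. h ` S)"
          and t: "t = (\<lambda>j. if j < m then inv_into S h (a j) else 0)" unfolding carr by blast
        have "inv_into S h (a j) \<in> S" if "j < m" for j
          using PiE_mem[OF a] that by (intro inv_into_into) simp
        then show "t \<in> carrier (add_monoid_of (tup m S))" unfolding t add_monoid_of_def tup_def by simp
      qed
    qed
  qed
  then show ?thesis unfolding is_iso_def by blast
qed

lemma dsum_pow_transport_iso:
  "dsum_pow (transport h S) m \<cong> dsum_pow (transport h S) k \<longleftrightarrow> add_iso (tup m S) (tup k S)"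
proof -
  have grp: "group (add_monoid_of (tup n S))" for n
    by (rule group_add_monoid_of[OF add_subgroup_tup[OF S]])
  have "group (dsum_pow (transport h S) n)" for n
    unfolding dsum_pow_def using comm_group_transport by (intro sum_group) (simp add: comm_group_def)
  then have bwd: "dsum_pow (transport h S) n \<cong> add_monoid_of (tup n S)" for n
    using group.iso_sym[OF grp dsum_pow_transport] by blast
  have "dsum_pow (transport h S) m \<cong> dsum_pow (transport h S) k \<longleftrightarrow> add_monoid_of (tup m S) \<cong> add_monoid_of (tup k S)"
    (is "?D \<longleftrightarrow> ?T")
  proof
    show "?D \<Longrightarrow> ?T" by (rule iso_trans[OF dsum_pow_transport iso_trans[OF _ bwd]])
    show "?T \<Longrightarrow> ?D" by (rule iso_trans[OF bwd iso_trans[OF _ dsum_pow_transport]])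
  qed
  then show ?thesis
    using iso_add_monoid_of[OF add_subgroup_tup[OF S, of m] add_subgroup_tup[OF S, of k]] by simp
qed

end

section \<open>Separability and cardinality\<close>

context ladder_module
begin

lemma M_single_one: "single \<beta> (\<lambda>_. 1) \<in> M"
  using gens_M[OF single_gens] A_one unfolding A2_def by simp

lemma Mb_sub: "add_subgroup (Mb \<alpha>)"
  using M_sub below_zero below_diff unfolding Mb_def add_subgroup_def by blast

lemma aleph1_separable_transport:
  assumes h: "inj_on h M" shows "aleph1_separable (transport h M)"
  unfolding aleph1_separable_def
proof (intro conjI allI impI)
  note simps = transport_simps[OF M_sub h]
  show comm: "comm_group (transport h M)" by (rule comm_group_transport[OF M_sub h])
  fix X assume X: "X \<subseteq> carrier (transport h M) \<and> countable X"
  have "inv_into M h ` X \<subseteq> M" using X by (auto simp: simps inv_into_into)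
  then obtain \<alpha> where \<alpha>: "inv_into M h ` X \<subseteq> Mb \<alpha>"
    using countable_subset_Mb X by (metis countable_image)
  have "X \<subseteq> h ` Mb \<alpha>"
  proof
    fix a assume a: "a \<in> X"
    then have "h (inv_into M h a) = a" using X by (auto simp: simps f_inv_into_f)
    then show "a \<in> h ` Mb \<alpha>" using \<alpha> a by (metis image_eqI image_subset_iff)
  qed
  moreover have "countable (h ` Mb \<alpha>)" using countable_Mb by simp
  \<comment> \<open>The complement consists of the functions in \<open>M\<close> that vanish below
    \<alpha>; \<open>restr \<alpha>\<close> is the projection along it.\<close>
  moreover have "direct_summand (h ` Mb \<alpha>) (transport h M)"
  proof (rule direct_summand_transport[OF M_sub h Mb_sub, where K = "{f \<in> M. \<forall>\<gamma><\<alpha>. f \<gamma> = 0}"])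
    show "Mb \<alpha> \<subseteq> M" unfolding Mb_def by blast
    show "add_subgroup {f \<in> M. \<forall>\<gamma><\<alpha>. f \<gamma> = 0}" using M_sub unfolding add_subgroup_def by simp
    show "{f \<in> M. \<forall>\<gamma><\<alpha>. f \<gamma> = 0} \<subseteq> M" by blast
    show "Mb \<alpha> \<inter> {f \<in> M. \<forall>\<gamma><\<alpha>. f \<gamma> = 0} \<subseteq> {0}"
    proof
      fix f assume "f \<in> Mb \<alpha> \<inter> {f \<in> M. \<forall>\<gamma><\<alpha>. f \<gamma> = 0}"
      then have "f \<gamma> = 0" for \<gamma> unfolding Mb_def below_def by (cases "\<gamma> < \<alpha>") auto
      then have "f = 0" by (simp add: fun_eq_iff)
      then show "f \<in> {0}" by simp
    qed
    fix f assume f: "f \<in> M"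
    have "restr \<alpha> f \<in> Mb \<alpha>" unfolding Mb_def using restr_M[OF f] below_restr by blast
    moreover have "f - restr \<alpha> f \<in> {f \<in> M. \<forall>\<gamma><\<alpha>. f \<gamma> = 0}"
      using add_subgroup_diff[OF M_sub f restr_M[OF f]] by (auto simp: restr_def)
    moreover have "f = restr \<alpha> f + (f - restr \<alpha> f)" by simp
    ultimately show "\<exists>u\<in>Mb \<alpha>. \<exists>v\<in>{f \<in> M. \<forall>\<gamma><\<alpha>. f \<gamma> = 0}. f = u + v" by blast
  qed
  \<comment> \<open>Coordinates of the embedding are a stage, a component of the pair and a
    functional; separation by \<open>ev\<close> makes it injective.\<close>
  moreover have "free_abelian_grp (transport h M\<lparr>carrier := h ` Mb \<alpha>\<rparr>)"
  proof (rule free_abelian_grpI_embedding[where h = "\<lambda>a (\<beta>, b, t). ev t (inv_into M h a \<beta> b)"])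
    have sub: "subgroup (h ` Mb \<alpha>) (transport h M)"
      by (rule subgroup_transport[OF M_sub h Mb_sub]) (auto simp: Mb_def)
    show "comm_group (transport h M\<lparr>carrier := h ` Mb \<alpha>\<rparr>)"
    proof (rule group.group_comm_groupI[OF subgroup.subgroup_is_group[OF sub]])
      show "group (transport h M)" using comm by (simp add: comm_group_def)
      fix x y
      assume "x \<in> carrier (transport h M\<lparr>carrier := h ` Mb \<alpha>\<rparr>)" "y \<in> carrier (transport h M\<lparr>carrier := h ` Mb \<alpha>\<rparr>)"
      then show "x \<otimes>\<^bsub>transport h M\<lparr>carrier := h ` Mb \<alpha>\<rparr>\<^esub> y = y \<otimes>\<^bsub>transport h M\<lparr>carrier := h ` Mb \<alpha>\<rparr>\<^esub> x"
        using comm_groupE(4)[OF comm] subgroup.mem_carrier[OF sub] by simp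
    qed
    show "countable (carrier (transport h M\<lparr>carrier := h ` Mb \<alpha>\<rparr>))" using countable_Mb by simp
    have MbM: "f \<in> M" if "f \<in> Mb \<alpha>" for f using that unfolding Mb_def by blast
    show "(\<lambda>(\<beta>, b, t). ev t (inv_into M h (x \<otimes>\<^bsub>transport h M\<lparr>carrier := h ` Mb \<alpha>\<rparr>\<^esub> y) \<beta> b)) =
        (\<lambda>(\<beta>, b, t). ev t (inv_into M h x \<beta> b)) + (\<lambda>(\<beta>, b, t). ev t (inv_into M h y \<beta> b))"
      if xy: "x \<in> carrier (transport h M\<lparr>carrier := h ` Mb \<alpha>\<rparr>)" "y \<in> carrier (transport h M\<lparr>carrier := h ` Mb \<alpha>\<rparr>)" for x y
    proof -
      obtain f g where fg: "f \<in> M" "x = h f" "g \<in> M" "y = h g" using xy MbM by auto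
      then have "h f \<otimes>\<^bsub>transport h M\<^esub> h g = h (f + g)" "f + g \<in> M"
        using M_sub by (simp_all add: simps add_subgroup_add)
      then show ?thesis
        using fg by (auto simp: fun_eq_iff inv_into_f_f[OF h] additive.add[OF ev_additive])
    qed
    show "inj_on (\<lambda>a (\<beta>, b, t). ev t (inv_into M h a \<beta> b)) (carrier (transport h M\<lparr>carrier := h ` Mb \<alpha>\<rparr>))"
    proof (rule inj_onI)
      fix x y
      assume x: "x \<in> carrier (transport h M\<lparr>carrier := h ` Mb \<alpha>\<rparr>)"
        and y: "y \<in> carrier (transport h M\<lparr>carrier := h ` Mb \<alpha>\<rparr>)"
        and eq: "(\<lambda>(\<beta>, b, t). ev t (inv_into M h x \<beta> b)) = (\<lambda>(\<beta>, b, t). ev t (inv_into M h y \<beta> b))"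
      obtain f g where fg: "f \<in> M" "x = h f" "g \<in> M" "y = h g" using x y MbM by auto
      have "f \<beta> b = g \<beta> b" for \<beta> b
      proof (rule ccontr)
        assume "f \<beta> b \<noteq> g \<beta> b"
        then obtain t where "ev t (f \<beta> b - g \<beta> b) \<noteq> 0" using ev_separates[of "f \<beta> b - g \<beta> b"] by auto
        moreover have "ev t (f \<beta> b) = ev t (g \<beta> b)"
          using fun_cong[OF eq, of "(\<beta>, b, t)"] fg by (simp add: inv_into_f_f[OF h])
        ultimately show False by (simp add: additive.diff[OF ev_additive])
      qed
      then have "f = g" by (auto simp: fun_eq_iff)
      then show "x = y" using fg by simp
    qed
  qed
  ultimately show "\<exists>N. X \<subseteq> N \<and> countable N \<and> direct_summand N (transport h M) \<and>
    free_abelian_grp (transport h M\<lparr>carrier := N\<rparr>)" by blast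
qed

text \<open>Upper bound: \<open>M\<close> is a union of countable parts indexed by
  \<open>w1\<close>. Lower bound: the one-point functions with constant pair 1.\<close>

lemma card_of_M: "|M| =o cardSuc natLeq"
proof -
  have inf: "infinite (UNIV :: w1 set)" using uncountable_w1 countable_finite by blast
  have "M \<subseteq> (\<Union>\<alpha>\<in>UNIV. Mb \<alpha>)" using M_below unfolding Mb_def by blast
  moreover have "|\<Union>\<alpha>\<in>(UNIV :: w1 set). Mb \<alpha>| \<le>o |UNIV :: w1 set|"
  proof (rule card_of_UNION_ordLeq_infinite[OF inf])
    show "|UNIV :: w1 set| \<le>o |UNIV :: w1 set|" by (rule ordLeq_refl[OF card_of_Card_order])
    have "natLeq \<le>o |UNIV :: w1 set|" using inf infinite_iff_natLeq_ordLeq by blast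
    then show "\<forall>\<alpha>\<in>UNIV. |Mb \<alpha>| \<le>o |UNIV :: w1 set|"
      using countable_Mb unfolding countable_card_le_natLeq by (meson ordLeq_transitive)
  qed
  ultimately have le: "|M| \<le>o |UNIV :: w1 set|" using card_of_mono1 ordLeq_transitive by blast
  have "inj (\<lambda>\<beta>. single \<beta> (\<lambda>_ :: bool. 1 :: 'a))"
  proof (rule injI)
    fix \<beta> \<gamma> assume eq: "single \<beta> (\<lambda>_ :: bool. 1 :: 'a) = single \<gamma> (\<lambda>_. 1)"
    have "single \<beta> (\<lambda>_ :: bool. 1 :: 'a) \<beta> True = single \<gamma> (\<lambda>_. 1) \<beta> True" by (simp only: eq)
    then show "\<beta> = \<gamma>" unfolding single_def by (auto split: if_splits)
  qed
  moreover have "range (\<lambda>\<beta>. single \<beta> (\<lambda>_ :: bool. 1 :: 'a)) \<subseteq> M" using M_single_one by blast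
  ultimately have "|UNIV :: w1 set| \<le>o |M|" using card_of_ordLeq by blast
  with le have "|M| =o |UNIV :: w1 set|" by (simp add: ordIso_iff_ordLeq)
  then show ?thesis using card_of_w1 by (rule ordIso_transitive)
qed

lemma inj_M_nat_set: "\<exists>h :: (w1 \<Rightarrow> bool \<Rightarrow> 'a) \<Rightarrow> nat set. inj_on h M"
proof -
  have "|M| =o |UNIV :: w1 set|" using card_of_M card_of_w1 by (meson ordIso_symmetric ordIso_transitive)
  then obtain f :: "(w1 \<Rightarrow> bool \<Rightarrow> 'a) \<Rightarrow> w1" where f: "bij_betw f M UNIV" using card_of_ordIso by blast
  have "inj Rep_w1" by (simp add: inj_def Rep_w1_inject)
  then have "inj_on (Rep_w1 \<circ> f) M" using f by (auto simp: bij_betw_def intro: comp_inj_on inj_on_subset)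
  then show ?thesis by blast
qed

end

section \<open>Choice of the primes and final assembly\<close>

lemma exists_prime_index:
  fixes I :: "'i set"
  assumes "countable I" "r > 0"
  shows "\<exists>pr :: 'i \<Rightarrow> nat. inj_on pr I \<and> (\<forall>i. prime (pr i) \<and> coprime (pr i) r)"
proof -
  define S where "S = {p :: nat. prime p \<and> p > r}"
  have "infinite S"
  proof
    assume "finite S"
    then have "finite (S \<union> {..r})" by simp
    moreover have "{p :: nat. prime p} \<subseteq> S \<union> {..r}" unfolding S_def by auto
    ultimately show False using primes_infinite finite_subset by blast
  qed
  have S: "prime p \<and> coprime p r" if "p \<in> S" for p
  proof -
    have p: "prime p" "r < p" using that unfolding S_def by auto
    have "\<not> p dvd r" using p(2) assms(2) by (auto dest: dvd_imp_le)
    then show ?thesis using p(1) by (simp add: prime_imp_coprime)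
  qed
  \<comment> \<open>Outside \<open>I\<close> the value of \<open>to_nat_on\<close> is arbitrary, but
    every \<open>enumerate S n\<close> is still a prime above \<open>r\<close>.\<close>
  let ?pr = "\<lambda>i. enumerate S (to_nat_on I i)"
  have "inj (enumerate S)" using strict_mono_enumerate[OF \<open>infinite S\<close>] strict_mono_imp_inj_on by blast
  then have "inj_on ?pr I"
    using inj_on_to_nat_on[OF assms(1)] by (auto simp: inj_on_def)
  moreover have "\<forall>i. prime (?pr i) \<and> coprime (?pr i) r"
    using S enumerate_in_set[OF \<open>infinite S\<close>] by blast
  ultimately show ?thesis by blast
qed

theorem theorem0p1:
  shows "\<forall>r::nat. r > 0 \<longrightarrow>
    (\<exists>M :: nat set monoid. comm_group M \<and> aleph1_separable M \<and> has_card_aleph1 (carrier M) \<and>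
       (\<forall>m k :: nat. m > 0 \<longrightarrow> k > 0 \<longrightarrow>
          (dsum_pow M m \<cong> dsum_pow M k \<longleftrightarrow> [m = k] (mod r))))"
proof (intro allI impI)
  fix r :: nat assume r: "r > 0"
  let ?A = "leavitt (Suc r)"
  have "countable (insert None (Some ` ?A))" using countable_leavitt by simp
  then obtain pr :: "endo option \<Rightarrow> nat" where
    pr: "inj_on pr (insert None (Some ` ?A))" "\<And>i. prime (pr i)" "\<And>i. coprime (pr i) r"
    using exists_prime_index[OF _ r] by metis
  \<comment> \<open>The functional at \<open>(f, N)\<close> applies an operator to the sequence
    \<open>f\<close> and reads off entry \<open>N\<close>.\<close>
  interpret ladder_module ?A "\<lambda>(f, N) T. app T f N" pr r
  proof (rule ladder_module.intro)
    show "add_subgroup ?A" by (rule add_subgroup_leavitt)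
    show "additive ((\<lambda>(f, N) T. app T f N) t)" for t
      by unfold_locales (auto simp: app_simps split: prod.split)
    show "\<exists>t. (\<lambda>(f, N) T. app T f N) t v \<noteq> 0" if "v \<noteq> 0" for v
    proof (rule ccontr)
      assume "\<not> ?thesis"
      then have "app v f N = 0" for f N by (metis case_prod_conv)
      then have "v = 0" by (intro endo_eqI) (simp add: app_simps)
      with that show False by simp
    qed
  qed (use pr one_leavitt mult_leavitt countable_leavitt in auto)
  obtain h :: "(w1 \<Rightarrow> bool \<Rightarrow> endo) \<Rightarrow> nat set" where h: "inj_on h M" using inj_M_nat_set by blast
  let ?M = "transport h M"
  have "dsum_pow ?M m \<cong> dsum_pow ?M k \<longleftrightarrow> [m = k] (mod r)" if mk: "m > 0" "k > 0" for m k
  proof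
    assume "dsum_pow ?M m \<cong> dsum_pow ?M k"
    then have "add_iso (tup m M) (tup k M)" using dsum_pow_transport_iso[OF M_sub h] by blast
    moreover have "[trunc_trace (Suc r) n 1 = 1] (mod int r)" for n
    proof -
      \<comment> \<open>\<open>trunc_trace\<close> of 1 is \<open>q ^ n\<close> with
        \<open>q = r + 1\<close>, hence 1 modulo \<open>r\<close>.\<close>
      have "[int (Suc r) = 1] (mod int r)" by (simp add: cong_iff_dvd_diff)
      from cong_pow[OF this, of n] show ?thesis by (simp add: trunc_trace_one)
    qed
    ultimately show "[m = k] (mod r)"
      using trunc_trace_commute[OF refl r] additive_trunc_trace
      by (intro tup_iso_imp_cong[of "trunc_trace (Suc r)"]) auto
  next
    assume "[m = k] (mod r)"
    then have "add_iso (tup m M) (tup k M)"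
      using mk shift_in_leavitt shift_out_leavitt shift_out_in sum_shift_in_out[of "Suc r"]
      by (intro tup_iso_if_cong[where x = "shift_in (Suc r)" and y = "shift_out (Suc r)"]) auto
    then show "dsum_pow ?M m \<cong> dsum_pow ?M k" using dsum_pow_transport_iso[OF M_sub h] by blast
  qed
  moreover have "has_card_aleph1 (carrier ?M)"
  proof -
    have "|h ` M| =o |M|" using h card_of_ordIso bij_betw_imageI ordIso_symmetric by blast
    then show ?thesis
      unfolding has_card_aleph1_def transport_simps(1)[OF M_sub h]
      using card_of_M ordIso_transitive by blast
  qed
  ultimately show "\<exists>M :: nat set monoid. comm_group M \<and> aleph1_separable M \<and> has_card_aleph1 (carrier M) \<and>
       (\<forall>m k :: nat. m > 0 \<longrightarrow> k > 0 \<longrightarrow>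
          (dsum_pow M m \<cong> dsum_pow M k \<longleftrightarrow> [m = k] (mod r)))"
    using comm_group_transport[OF M_sub h] aleph1_separable_transport[OF h] by blast
qed

end
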